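(* Let $\alpha:\mathscr{F}\to\mathscr{F}'$ be a homomorphism of frames, $\mathscr{F}=(S,I,R,\sigma,\sigma_1)$, $\mathscr{F}'=(S',I',R',\sigma',\sigma_1')$, inducing an isomorphism $R\cong R'$ and a surjection $S\to S'$ with kernel $\mathfrak{a}$. Assume there is a finite filtration $\mathfrak{a}=\mathfrak{a}_0\supseteq\cdots\supseteq\mathfrak{a}_n=0$ with $\sigma(\mathfrak{a}_i)\subseteq\mathfrak{a}_{i+1}$ and $\sigma_1(\mathfrak{a}_i)\subseteq\mathfrak{a}_i$, and that finitely generated projective $S'$-modules lift to projective $S$-modules. Let $J\subset S$ be an ideal of definition for $\mathscr{F}$ with $J^m\mathfrak{a}=0$ for large $m$. Then $\alpha$ is nil-crystalline with respect to $J\subset S$ and $J'=J/\mathfrak{a}\subset S'$.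
   Context: A frame is $(S,I,R,\sigma,\sigma_1)$ with $R=S/I$, $\sigma$ a ring endomorphism of $S$, $\sigma_1:I\to S$ $\sigma$-linear, $I+pS\subseteq\mathrm{Rad}(S)$, $\sigma(a)\equiv a^p\bmod pS$, and $\sigma_1(I)$ generating $S$; $\theta\in S$ is the unique element with $\sigma(a)=\theta\sigma_1(a)$ for $a\in I$. A window is $(P,Q,F,F_1)$ with $P$ f.g. projective, $Q\subseteq P$, $F:P\to P$, $F_1:Q\to P$ $\sigma$-linear, $P=L\oplus T$ with $Q=L\oplus IT$, $F_1(ax)=\sigma_1(a)F(x)$ for $a\in I$, $F_1(Q)$ generating $P$. A homomorphism of frames is a ring map $\alpha:S\to S'$ with $\alpha(I)\subseteq I'$, $\sigma'\alpha=\alpha\sigma$, $\sigma_1'\alpha=u\,\alpha\sigma_1$ for a unit $u\in S'$; base change $\alpha_*$ of windows is characterised by $\mathrm{Hom}(\alpha_*\mathscr{P},\mathscr{P}')=\{g:P\to P'\mid g(Q)\subseteq Q',F'g=gF,F_1'g=u\,gF_1\}$. For a window $\mathscr{P}$, $V^\sharp:P\to P^{(\sigma)}=S\otimes_{\sigma,S}P$ is the unique $S$-linear map with $V^\sharp(F_1(x))=1\otimes x$ for $x\in Q$, and $(V^\sharp)^n:P\to P^{(\sigma^n)}$ denotes the iterated composite. An ideal of definition of $\mathscr{F}$ is an ideal $J\subseteq S$ with $\sigma(J)+I+\theta S\subseteq J$. A window is nilpotent with respect to $J$ if $(V^\sharp)^n\equiv0$ modulo $J$ for $n$ large. For ideals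 of definition $J\subset S$, $J'\subset S'$ with $\alpha(J)\subseteq J'$, $\alpha$ is nil-crystalline if $\alpha_*$ induces an equivalence between nilpotent $\mathscr{F}$-windows and nilpotent $\mathscr{F}'$-windows. *)

theory Defs
  imports Main "HOL-Library.Function_Algebras" "HOL-Computational_Algebra.Primes"
begin

definition is_ideal :: "'a::comm_ring_1 set \<Rightarrow> bool" where
  "is_ideal A \<longleftrightarrow> 0 \<in> A \<and> (\<forall>x\<in>A. \<forall>y\<in>A. x + y \<in> A) \<and> (\<forall>s. \<forall>x\<in>A. s * x \<in> A)"

definition gen_ideal :: "'a::comm_ring_1 set \<Rightarrow> 'a set" where
  "gen_ideal A = {y. \<exists>(k::nat) c x. (\<forall>i<k. x i \<in> A) \<and> y = (\<Sum>i<k. c i * x i)}"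

definition jac_rad :: "'a::comm_ring_1 set" where
  "jac_rad = {x. \<forall>y. (1 - x * y) dvd 1}"

definition ring_endo :: "('a::comm_ring_1 \<Rightarrow> 'a) \<Rightarrow> bool" where
  "ring_endo f \<longleftrightarrow> f 1 = 1 \<and> (\<forall>a b. f (a + b) = f a + f b) \<and> (\<forall>a b. f (a * b) = f a * f b)"

definition ring_hom' :: "('a::comm_ring_1 \<Rightarrow> 'b::comm_ring_1) \<Rightarrow> bool" where
  "ring_hom' f \<longleftrightarrow> f 1 = 1 \<and> (\<forall>a b. f (a + b) = f a + f b) \<and> (\<forall>a b. f (a * b) = f a * f b)"

text \<open>A frame \<open>(S,I,R,\<sigma>,\<sigma>\<^sub>1)\<close>: \<open>S\<close> is the ring (the type), \<open>R = S/I\<close> is implicit.\<close>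
definition frame :: "nat \<Rightarrow> 'a::comm_ring_1 set \<Rightarrow> ('a \<Rightarrow> 'a) \<Rightarrow> ('a \<Rightarrow> 'a) \<Rightarrow> bool" where
  "frame p I \<sigma> \<sigma>1 \<longleftrightarrow>
     prime p \<and> is_ideal I \<and> ring_endo \<sigma> \<and>
     (\<forall>a\<in>I. \<forall>b\<in>I. \<sigma>1 (a + b) = \<sigma>1 a + \<sigma>1 b) \<and>
     (\<forall>s. \<forall>a\<in>I. \<sigma>1 (s * a) = \<sigma> s * \<sigma>1 a) \<and>
     {a + of_nat p * s | a s. a \<in> I} \<subseteq> jac_rad \<and>
     (\<forall>a. \<exists>s. \<sigma> a - a ^ p = of_nat p * s) \<and>
     gen_ideal (\<sigma>1 ` I) = UNIV"

definition frame_theta :: "'a::comm_ring_1 set \<Rightarrow> ('a \<Rightarrow> 'a) \<Rightarrow> ('a \<Rightarrow> 'a) \<Rightarrow> 'a" where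
  "frame_theta I \<sigma> \<sigma>1 = (THE t. \<forall>a\<in>I. \<sigma> a = t * \<sigma>1 a)"

definition ideal_of_def :: "'a::comm_ring_1 set \<Rightarrow> ('a \<Rightarrow> 'a) \<Rightarrow> ('a \<Rightarrow> 'a) \<Rightarrow> 'a set \<Rightarrow> bool" where
  "ideal_of_def I \<sigma> \<sigma>1 J \<longleftrightarrow> is_ideal J \<and>
     {x + y + frame_theta I \<sigma> \<sigma>1 * s | x y s. x \<in> \<sigma> ` J \<and> y \<in> I} \<subseteq> J"

definition frame_hom :: "'a::comm_ring_1 set \<Rightarrow> ('a \<Rightarrow> 'a) \<Rightarrow> ('a \<Rightarrow> 'a) \<Rightarrow>
     'b::comm_ring_1 set \<Rightarrow> ('b \<Rightarrow> 'b) \<Rightarrow> ('b \<Rightarrow> 'b) \<Rightarrow> ('a \<Rightarrow> 'b) \<Rightarrow> 'b \<Rightarrow> bool" where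
  "frame_hom I \<sigma> \<sigma>1 I' \<sigma>' \<sigma>1' \<alpha> u \<longleftrightarrow> ring_hom' \<alpha> \<and> \<alpha> ` I \<subseteq> I' \<and>
     (\<forall>a. \<sigma>' (\<alpha> a) = \<alpha> (\<sigma> a)) \<and> u dvd 1 \<and> (\<forall>a\<in>I. \<sigma>1' (\<alpha> a) = u * \<alpha> (\<sigma>1 a))"

text \<open>Vectors are \<open>nat \<Rightarrow> 'a\<close>; \<open>S^n\<close> is the set of vectors supported in \<open>{..<n}\<close>.\<close>

definition sc :: "'a::comm_ring_1 \<Rightarrow> (nat \<Rightarrow> 'a) \<Rightarrow> (nat \<Rightarrow> 'a)" where
  "sc a v = (\<lambda>i. a * v i)"

definition fvec :: "nat \<Rightarrow> (nat \<Rightarrow> 'a::comm_ring_1) set" where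
  "fvec n = {v. \<forall>i\<ge>n. v i = 0}"

definition submod :: "(nat \<Rightarrow> 'a::comm_ring_1) set \<Rightarrow> bool" where
  "submod M \<longleftrightarrow> 0 \<in> M \<and> (\<forall>x\<in>M. \<forall>y\<in>M. x + y \<in> M) \<and> (\<forall>a. \<forall>x\<in>M. sc a x \<in> M)"

definition mspan :: "(nat \<Rightarrow> 'a::comm_ring_1) set \<Rightarrow> (nat \<Rightarrow> 'a) set" where
  "mspan A = {v. \<exists>(k::nat) c x. (\<forall>i<k. x i \<in> A) \<and> v = (\<Sum>i<k. sc (c i) (x i))}"

definition dsum :: "(nat \<Rightarrow> 'a::comm_ring_1) set \<Rightarrow> (nat \<Rightarrow> 'a) set \<Rightarrow> (nat \<Rightarrow> 'a) set \<Rightarrow> bool" where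
  "dsum M A B \<longleftrightarrow> A \<inter> B = {0} \<and> M = {x + y | x y. x \<in> A \<and> y \<in> B}"

definition fg_proj :: "(nat \<Rightarrow> 'a::comm_ring_1) set \<Rightarrow> bool" where
  "fg_proj P \<longleftrightarrow> (\<exists>n C. submod P \<and> submod C \<and> dsum (fvec n) P C)"

definition imult :: "'a::comm_ring_1 set \<Rightarrow> (nat \<Rightarrow> 'a) set \<Rightarrow> (nat \<Rightarrow> 'a) set" where
  "imult J M = mspan {sc a x | a x. a \<in> J \<and> x \<in> M}"

definition lin_on :: "('a::comm_ring_1 \<Rightarrow> 'b::comm_ring_1) \<Rightarrow> (nat \<Rightarrow> 'a) set \<Rightarrow>
     ((nat \<Rightarrow> 'a) \<Rightarrow> (nat \<Rightarrow> 'b)) \<Rightarrow> bool" where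
  "lin_on \<alpha> M f \<longleftrightarrow> (\<forall>x\<in>M. \<forall>y\<in>M. f (x + y) = f x + f y) \<and>
     (\<forall>a. \<forall>x\<in>M. f (sc a x) = sc (\<alpha> a) (f x))"

text \<open>base change of a (summand of a) free module along a ring map \<open>\<beta>\<close>:
  \<open>T \<otimes>\<^sub>\<beta> P\<close> is identified with the submodule of \<open>T^n\<close> spanned by \<open>\<beta>(P)\<close>,
  with \<open>t \<otimes> x \<mapsto> t \<beta>(x)\<close>.\<close>
definition bchg :: "('a::comm_ring_1 \<Rightarrow> 'b::comm_ring_1) \<Rightarrow> (nat \<Rightarrow> 'a) set \<Rightarrow> (nat \<Rightarrow> 'b) set" where
  "bchg \<beta> P = mspan ((\<lambda>v. \<beta> \<circ> v) ` P)"

record 'a win =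
  wP :: "(nat \<Rightarrow> 'a) set"
  wQ :: "(nat \<Rightarrow> 'a) set"
  wF :: "(nat \<Rightarrow> 'a) \<Rightarrow> (nat \<Rightarrow> 'a)"
  wF1 :: "(nat \<Rightarrow> 'a) \<Rightarrow> (nat \<Rightarrow> 'a)"

definition window :: "'a::comm_ring_1 set \<Rightarrow> ('a \<Rightarrow> 'a) \<Rightarrow> ('a \<Rightarrow> 'a) \<Rightarrow> 'a win \<Rightarrow> bool" where
  "window I \<sigma> \<sigma>1 W \<longleftrightarrow>
     fg_proj (wP W) \<and> wQ W \<subseteq> wP W \<and>
     (\<forall>x\<in>wP W. wF W x \<in> wP W) \<and> lin_on \<sigma> (wP W) (wF W) \<and>
     (\<forall>x\<in>wQ W. wF1 W x \<in> wP W) \<and> lin_on \<sigma> (wQ W) (wF1 W) \<and>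
     (\<exists>L T. submod L \<and> submod T \<and> dsum (wP W) L T \<and>
        wQ W = {l + t | l t. l \<in> L \<and> t \<in> imult I T}) \<and>
     (\<forall>a\<in>I. \<forall>x\<in>wP W. wF1 W (sc a x) = sc (\<sigma>1 a) (wF W x)) \<and>
     mspan (wF1 W ` wQ W) = wP W"

text \<open>maps \<open>g : P \<rightarrow> P'\<close> that are \<open>\<alpha>\<close>-linear with \<open>g(Q) \<subseteq> Q'\<close>, \<open>F' g = g F\<close>,
  \<open>F\<^sub>1' g = u g F\<^sub>1\<close>; for \<open>\<alpha> = id, u = 1\<close> these are the window homomorphisms\<close>
definition win_mor :: "('a::comm_ring_1 \<Rightarrow> 'b::comm_ring_1) \<Rightarrow> 'b \<Rightarrow> 'a win \<Rightarrow> 'b win \<Rightarrow>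
     ((nat \<Rightarrow> 'a) \<Rightarrow> (nat \<Rightarrow> 'b)) \<Rightarrow> bool" where
  "win_mor \<alpha> u W W' g \<longleftrightarrow>
     (\<forall>x\<in>wP W. g x \<in> wP W') \<and> lin_on \<alpha> (wP W) g \<and> (\<forall>x\<in>wQ W. g x \<in> wQ W') \<and>
     (\<forall>x\<in>wP W. wF W' (g x) = g (wF W x)) \<and>
     (\<forall>x\<in>wQ W. wF1 W' (g x) = sc u (g (wF1 W x)))"

text \<open>\<open>(W', \<iota>)\<close> is a base change \<open>\<alpha>\<^sub>* W\<close>: it represents the functor
  \<open>W'' \<mapsto> {g : P \<rightarrow> P'' | g(Q) \<subseteq> Q'', F'' g = g F, F\<^sub>1'' g = u g F\<^sub>1}\<close> via \<open>\<iota>\<close>.\<close>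
definition is_base_change :: "'b::comm_ring_1 set \<Rightarrow> ('b \<Rightarrow> 'b) \<Rightarrow> ('b \<Rightarrow> 'b) \<Rightarrow>
     ('a::comm_ring_1 \<Rightarrow> 'b) \<Rightarrow> 'b \<Rightarrow> 'a win \<Rightarrow> 'b win \<Rightarrow> ((nat \<Rightarrow> 'a) \<Rightarrow> (nat \<Rightarrow> 'b)) \<Rightarrow> bool" where
  "is_base_change I' \<sigma>' \<sigma>1' \<alpha> u W W' \<iota> \<longleftrightarrow>
     window I' \<sigma>' \<sigma>1' W' \<and> win_mor \<alpha> u W W' \<iota> \<and>
     (\<forall>W''. window I' \<sigma>' \<sigma>1' W'' \<longrightarrow>
        (\<forall>g. win_mor \<alpha> u W W'' g \<longrightarrow>
           (\<exists>h. win_mor id 1 W' W'' h \<and> (\<forall>x\<in>wP W. h (\<iota> x) = g x) \<and>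
              (\<forall>h'. win_mor id 1 W' W'' h' \<and> (\<forall>x\<in>wP W. h' (\<iota> x) = g x) \<longrightarrow>
                 (\<forall>y\<in>wP W'. h' y = h y)))))"

text \<open>\<open>V\<^sup>\<sharp> : P \<rightarrow> P\<^bsup>(\<sigma>)\<^esup>\<close>, the \<open>S\<close>-linear map with \<open>V\<^sup>\<sharp>(F\<^sub>1 x) = 1 \<otimes> x\<close>\<close>
definition is_Vsharp :: "('a::comm_ring_1 \<Rightarrow> 'a) \<Rightarrow> 'a win \<Rightarrow> ((nat \<Rightarrow> 'a) \<Rightarrow> (nat \<Rightarrow> 'a)) \<Rightarrow> bool" where
  "is_Vsharp \<sigma> W V \<longleftrightarrow> lin_on id (wP W) V \<and> (\<forall>x\<in>wP W. V x \<in> bchg \<sigma> (wP W)) \<and>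
     (\<forall>x\<in>wQ W. V (wF1 W x) = \<sigma> \<circ> x)"

primrec itcomp :: "(nat \<Rightarrow> ('v \<Rightarrow> 'v)) \<Rightarrow> nat \<Rightarrow> 'v \<Rightarrow> 'v" where
  "itcomp fs 0 = id"
| "itcomp fs (Suc k) = fs k \<circ> itcomp fs k"

text \<open>\<open>fs k = (\<sigma>\<^sup>k)\<^sup>*(V\<^sup>\<sharp>) : P\<^bsup>(\<sigma>\<^sup>k)\<^esup> \<rightarrow> P\<^bsup>(\<sigma>\<^bsup>k+1\<^esup>)\<^esup>\<close>, so \<open>itcomp fs k = (V\<^sup>\<sharp>)\<^sup>k\<close>;
  nilpotence: \<open>(V\<^sup>\<sharp>)\<^sup>k\<close> has image in \<open>J P\<^bsup>(\<sigma>\<^sup>k)\<^esup>\<close> for all large \<open>k\<close>.\<close>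
definition nilpotent_win :: "('a::comm_ring_1 \<Rightarrow> 'a) \<Rightarrow> 'a set \<Rightarrow> 'a win \<Rightarrow> bool" where
  "nilpotent_win \<sigma> J W \<longleftrightarrow>
     (\<exists>V fs N. is_Vsharp \<sigma> W V \<and>
        (\<forall>k. lin_on id (bchg (\<sigma> ^^ k) (wP W)) (fs k) \<and>
             (\<forall>x\<in>wP W. fs k ((\<sigma> ^^ k) \<circ> x) = (\<sigma> ^^ k) \<circ> V x)) \<and>
        (\<forall>k\<ge>N. \<forall>x\<in>wP W. itcomp fs k x \<in> imult J (bchg (\<sigma> ^^ k) (wP W))))"

definition nil_crystalline :: "'a::comm_ring_1 set \<Rightarrow> ('a \<Rightarrow> 'a) \<Rightarrow> ('a \<Rightarrow> 'a) \<Rightarrow> 'a set \<Rightarrow>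
     'b::comm_ring_1 set \<Rightarrow> ('b \<Rightarrow> 'b) \<Rightarrow> ('b \<Rightarrow> 'b) \<Rightarrow> 'b set \<Rightarrow> ('a \<Rightarrow> 'b) \<Rightarrow> 'b \<Rightarrow> bool" where
  "nil_crystalline I \<sigma> \<sigma>1 J I' \<sigma>' \<sigma>1' J' \<alpha> u \<longleftrightarrow>
     ideal_of_def I \<sigma> \<sigma>1 J \<and> ideal_of_def I' \<sigma>' \<sigma>1' J' \<and> \<alpha> ` J \<subseteq> J' \<and>
     \<comment> \<open>the base change functor is defined on nilpotent windows\<close>
     (\<forall>W. window I \<sigma> \<sigma>1 W \<and> nilpotent_win \<sigma> J W \<longrightarrow>
        (\<exists>W' \<iota>. is_base_change I' \<sigma>' \<sigma>1' \<alpha> u W W' \<iota>)) \<and>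
     \<comment> \<open>and takes values in nilpotent windows\<close>
     (\<forall>W W' \<iota>. window I \<sigma> \<sigma>1 W \<and> nilpotent_win \<sigma> J W \<and> is_base_change I' \<sigma>' \<sigma>1' \<alpha> u W W' \<iota>
        \<longrightarrow> nilpotent_win \<sigma>' J' W') \<and>
     \<comment> \<open>fully faithful: every \<open>h : \<alpha>\<^sub>*W\<^sub>1 \<rightarrow> \<alpha>\<^sub>*W\<^sub>2\<close> is \<open>\<alpha>\<^sub>*f\<close> for a unique \<open>f\<close>\<close>
     (\<forall>W1 W2 W1' W2' \<iota>1 \<iota>2. window I \<sigma> \<sigma>1 W1 \<and> nilpotent_win \<sigma> J W1 \<and>
        window I \<sigma> \<sigma>1 W2 \<and> nilpotent_win \<sigma> J W2 \<and>
        is_base_change I' \<sigma>' \<sigma>1' \<alpha> u W1 W1' \<iota>1 \<and> is_base_change I' \<sigma>' \<sigma>1' \<alpha> u W2 W2' \<iota>2 \<longrightarrow>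
        (\<forall>h. win_mor id 1 W1' W2' h \<longrightarrow>
           (\<exists>f. win_mor id 1 W1 W2 f \<and> (\<forall>x\<in>wP W1. h (\<iota>1 x) = \<iota>2 (f x)) \<and>
              (\<forall>f'. win_mor id 1 W1 W2 f' \<and> (\<forall>x\<in>wP W1. h (\<iota>1 x) = \<iota>2 (f' x)) \<longrightarrow>
                 (\<forall>x\<in>wP W1. f' x = f x))))) \<and>
     \<comment> \<open>essentially surjective\<close>
     (\<forall>W'. window I' \<sigma>' \<sigma>1' W' \<and> nilpotent_win \<sigma>' J' W' \<longrightarrow>
        (\<exists>W \<iota>. window I \<sigma> \<sigma>1 W \<and> nilpotent_win \<sigma> J W \<and> is_base_change I' \<sigma>' \<sigma>1' \<alpha> u W W' \<iota>))"

end

theory Submission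
  imports Defs "Jordan_Normal_Form.Determinant"
begin

text \<open>
  Every window \<open>P = L \<oplus> T\<close> is universal for its maps \<open>F\<close>, \<open>F\<^sub>1\<close>: the linearisation
  \<open>P\<^bsup>(\<sigma>)\<^esup> \<rightarrow> P\<close> of \<open>F\<^sub>1|L + F|T\<close> is surjective, hence bijective because \<open>\<sigma>\<close> is the Frobenius modulo
  \<open>p \<in> Rad S\<close>, so that \<open>P\<^bsup>(\<sigma>)\<^esup>\<close> and \<open>P\<close> have the same rank.

  Given nilpotent windows over \<open>S\<close> and a homomorphism \<open>h\<close> of their base changes, any linear lift \<open>f\<close> of
  \<open>h\<close> can be replaced by the unique linear map \<open>U f\<close> with \<open>U f \<circ> F\<^sub>1 = F\<^sub>1 \<circ> f\<close>. Two lifts differ by a map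
  \<open>\<delta>\<close> into \<open>\<aa>P\<close>, and \<open>U\<^sup>k \<delta>\<close> factors through \<open>(V\<^sup>\<sharp>)\<^sup>k\<close>, whose image lies in \<open>J\<^sup>m P\<^bsup>(\<sigma>\<^sup>k)\<^esup>\<close> for large \<open>k\<close>.
  As \<open>J\<^sup>m\<aa> = 0\<close>, the iteration \<open>U\<close> stabilises at the unique lift of \<open>h\<close> that is a homomorphism.

  A window over \<open>S'\<close> is lifted by lifting \<open>L'\<close>, \<open>T'\<close> and then \<open>F\<^sub>1|L\<close>, \<open>F|T\<close> arbitrarily; since
  \<open>\<aa> \<subseteq> J\<close> is nilpotent, the generation axiom lifts as well.
\<close>

section \<open>Ring homomorphisms, ideals and the Jacobson radical\<close>

text \<open>Modules live inside \<open>S^n\<close>, and a projective one is given by the columns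
  \<open>e\<close> of an idempotent, so each of its vectors is its own coefficient vector. Tensor
  products, membership in \<open>J P\<close> and the iterates of \<open>V\<^sup>\<sharp>\<close>
  thereby become coordinate statements. Since \<open>R \<cong> R'\<close>, the kernel
  \<open>\<aa>\<close> of \<open>\<alpha>\<close> lies in \<open>I\<close>, so
  \<open>\<aa>P \<subseteq> Q\<close>. Hence \<open>F\<^sub>1\<close> is defined on the difference
  of two lifts, and \<open>\<sigma>\<^sub>1(\<aa>) \<subseteq> \<aa>\<close> keeps its values in
  \<open>\<aa>P\<close>. Pulling a coefficient out of \<open>F\<^sub>1\<close> twists it by
  \<open>\<sigma>\<close>; this is how the twisted coefficients of
  \<open>(V\<^sup>\<sharp>)\<^sup>k\<close> and the inclusion
  \<open>\<sigma>(J) \<subseteq> J\<close> enter. The unit \<open>u\<close> makes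
  \<open>V\<^sup>\<sharp>\<close> commute with base change only up to a unit, which does not affect
  membership in an ideal. As base change is given by its universal property alone, each one is
  compared with an explicit quotient modulo \<open>\<aa>\<close>.\<close>

lemma ring_endo_eq_ring_hom': "ring_endo f = ring_hom' f"
  by (simp add: ring_endo_def ring_hom'_def)

lemma ring_hom'_simps:
  assumes "ring_hom' f"
  shows "f 1 = 1" "f (a + b) = f a + f b" "f (a * b) = f a * f b"
    "f 0 = 0" "f (- a) = - f a" "f (a - b) = f a - f b"
proof -
  show add: "f (a + b) = f a + f b" for a b using assms by (simp add: ring_hom'_def)
  show "f 1 = 1" "f (a * b) = f a * f b" using assms by (auto simp: ring_hom'_def)
  show z: "f 0 = 0" using add[of 0 0] by simp
  show m: "f (- a) = - f a" for a using add[of a "- a"] z by (simp add: eq_neg_iff_add_eq_0 add.commute)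
  show "f (a - b) = f a - f b" using add[of a "- b"] m[of b] by simp
qed

lemma ring_hom'_sum: "ring_hom' f \<Longrightarrow> f (sum g A) = (\<Sum>i\<in>A. f (g i))"
  by (induction A rule: infinite_finite_induct) (auto simp: ring_hom'_simps)

lemma ring_hom'_of_nat: "ring_hom' f \<Longrightarrow> f (of_nat k) = of_nat k"
  by (induction k) (auto simp: ring_hom'_simps)

lemma ring_hom'_id: "ring_hom' id"
  by (simp add: ring_hom'_def)

lemma ring_hom'_funpow:
  fixes f :: "'a::comm_ring_1 \<Rightarrow> 'a"
  shows "ring_hom' f \<Longrightarrow> ring_hom' (f ^^ k)"
  by (induction k) (auto simp: ring_hom'_def)

lemma is_idealD:
  assumes "is_ideal A"
  shows "0 \<in> A" "x \<in> A \<Longrightarrow> y \<in> A \<Longrightarrow> x + y \<in> A" "x \<in> A \<Longrightarrow> s * x \<in> A" "x \<in> A \<Longrightarrow> x * s \<in> A"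
    "x \<in> A \<Longrightarrow> - x \<in> A" "x \<in> A \<Longrightarrow> y \<in> A \<Longrightarrow> x - y \<in> A"
proof -
  show add: "x \<in> A \<Longrightarrow> y \<in> A \<Longrightarrow> x + y \<in> A" for x y using assms by (auto simp: is_ideal_def)
  show "0 \<in> A" and mul: "x \<in> A \<Longrightarrow> s * x \<in> A" for s x using assms by (auto simp: is_ideal_def)
  show "x \<in> A \<Longrightarrow> x * s \<in> A" using mul[of x s] by (simp add: mult.commute[of x])
  show neg: "x \<in> A \<Longrightarrow> - x \<in> A" for x using mul[of x "-1"] by simp
  show "x \<in> A \<Longrightarrow> y \<in> A \<Longrightarrow> x - y \<in> A" using add[of x "- y"] neg[of y] by simp
qed

lemma is_ideal_sum: "is_ideal A \<Longrightarrow> (\<And>i. i \<in> B \<Longrightarrow> f i \<in> A) \<Longrightarrow> sum f B \<in> A"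
  by (induction B rule: infinite_finite_induct) (auto intro: is_idealD)

text \<open>Multiplying \<open>1 - (x + y) * z\<close> by the inverse \<open>w\<close> of
  \<open>1 - x * z\<close> leaves \<open>1 - y * (z * w)\<close>, which is a unit because
  \<open>y\<close> is in the radical.\<close>

lemma jac_rad_add:
  assumes "x \<in> jac_rad" "y \<in> jac_rad"
  shows "x + y \<in> jac_rad"
  unfolding jac_rad_def
proof (intro CollectI allI)
  fix z
  obtain w where w: "1 = (1 - x * z) * w" using assms(1) by (auto simp: jac_rad_def dvd_def)
  obtain v where v: "1 = (1 - y * (z * w)) * v" using assms(2) by (auto simp: jac_rad_def dvd_def)
  have "(1 - (x + y) * z) * w = 1 - y * (z * w)" using w by (simp add: algebra_simps)
  then have "1 = (1 - (x + y) * z) * (w * v)" using v by (metis mult.assoc)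
  then show "1 - (x + y) * z dvd 1" by (rule dvdI)
qed

lemma is_ideal_jac_rad: "is_ideal jac_rad"
proof -
  have "s * x \<in> jac_rad" if "x \<in> jac_rad" for s x :: 'a
    unfolding jac_rad_def
  proof (intro CollectI allI)
    fix y
    have "1 - x * (s * y) dvd 1" using that by (auto simp: jac_rad_def)
    then show "1 - s * x * y dvd 1" by (simp add: mult.commute mult.left_commute)
  qed
  then show ?thesis by (auto simp: is_ideal_def intro: jac_rad_add) (auto simp: jac_rad_def)
qed

text \<open>The geometric sum exhibits \<open>1 - x * y\<close> as a divisor of the unit
  \<open>1 - (x * y) ^ k\<close>.\<close>

lemma jac_rad_power:
  assumes "x ^ k \<in> jac_rad"
  shows "x \<in> jac_rad"
  unfolding jac_rad_def
proof (intro CollectI allI)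
  fix y
  have "1 - (x * y) ^ k dvd 1"
    using assms by (auto simp: jac_rad_def power_mult_distrib)
  moreover have "1 - x * y dvd 1 - (x * y) ^ k"
    using one_diff_power_eq[of "x * y" k] by (metis dvd_triv_left)
  ultimately show "1 - x * y dvd 1" by (rule dvd_trans[rotated])
qed

text \<open>Gaussian elimination: \<open>1 - r k k\<close> is a unit, so the last equation can be
  solved for \<open>v k\<close>. Substituting it into the others leaves a system of size
  \<open>k\<close> whose coefficients are again in the radical.\<close>

lemma nakayama_coordinates:
  fixes v :: "nat \<Rightarrow> 'a::comm_ring_1"
  assumes "\<And>j. j < k \<Longrightarrow> v j = (\<Sum>i<k. r j i * v i)"
    and "\<And>j i. j < k \<Longrightarrow> i < k \<Longrightarrow> r j i \<in> jac_rad" and "j < k"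
  shows "v j = 0"
  using assms
proof (induction k arbitrary: r j)
  case 0
  then show ?case by simp
next
  case (Suc k)
  note rad = is_idealD[OF is_ideal_jac_rad]
  have "1 - r k k dvd 1" using Suc.prems(2)[of k k] by (auto simp: jac_rad_def dest: spec[of _ 1])
  then obtain w where w: "1 = (1 - r k k) * w" by (auto simp: dvd_def)
  have "(1 - r k k) * v k = (\<Sum>i<k. r k i * v i)" using Suc.prems(1)[of k] by (simp add: algebra_simps)
  then have "w * ((1 - r k k) * v k) = (\<Sum>i<k. w * r k i * v i)" by (simp add: sum_distrib_left mult.assoc)
  moreover have "w * ((1 - r k k) * v k) = v k" using w by (metis mult.assoc mult.commute mult_1)
  ultimately have vk: "v k = (\<Sum>i<k. w * r k i * v i)" by simp
  have *: "v j = (\<Sum>i<k. (r j i + r j k * (w * r k i)) * v i)" if "j < k" for j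
  proof -
    have "v j = (\<Sum>i<k. r j i * v i) + r j k * v k" using Suc.prems(1)[of j] that by simp
    then show ?thesis by (subst (asm) vk) (simp add: algebra_simps sum_distrib_left sum.distrib)
  qed
  have **: "v j = 0" if "j < k" for j
    by (rule Suc.IH[where r = "\<lambda>j i. r j i + r j k * (w * r k i)"])
      (use * that Suc.prems(2) in \<open>auto intro!: rad(2,3)\<close>)
  show ?case
  proof (cases "j = k")
    case True
    then show ?thesis using vk ** by simp
  qed (use ** Suc.prems(3) in auto)
qed

section \<open>Linear combinations and coordinate dual bases\<close>

text \<open>Coefficients and vectors share one type. This permits \<open>lcomb n x e = x\<close>,
  where \<open>x\<close> supplies its own coefficients, and makes \<open>lcomb_lcomb\<close> the
  associativity of the matrix product.\<close>

definition lcomb :: "nat \<Rightarrow> (nat \<Rightarrow> 'a::comm_ring_1) \<Rightarrow> (nat \<Rightarrow> nat \<Rightarrow> 'a) \<Rightarrow> nat \<Rightarrow> 'a" where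
  "lcomb n c v = (\<lambda>i. \<Sum>j<n. c j * v j i)"

lemma sc_apply: "sc a v i = a * v i"
  by (simp add: sc_def)

lemmas vec_apply = plus_fun_apply zero_fun_apply minus_apply uminus_apply o_apply sc_apply

text \<open>Resolution may eta-expand vectors; simplifying under the abstraction would then destroy them.\<close>

declare plus_fun_apply [simp del] zero_fun_apply [simp del] minus_apply [simp del]
  uminus_apply [simp del] o_apply [simp del]

lemma sc_simps [simp]:
  "sc a 0 = 0" "sc 0 v = 0" "sc 1 v = v" "sc a (sc b v) = sc (a * b) v"
  by (auto simp: sc_def fun_eq_iff vec_apply mult.assoc)

lemma sc_add: "sc a (v + w) = sc a v + sc a w"
  by (auto simp: fun_eq_iff vec_apply algebra_simps)

lemma sc_minus_one: "sc (- 1) v = - v"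
  by (auto simp: fun_eq_iff vec_apply)

lemma sum_sc_eq_lcomb: "(\<Sum>j<n. sc (c j) (v j)) = lcomb n c v"
proof -
  have "(\<Sum>j<n. sc (c j) (v j)) i = (\<Sum>j<n. c j * v j i)" for i by (induction n) (auto simp: vec_apply)
  then show ?thesis by (auto simp: lcomb_def)
qed

lemma lcomb_cong: "(\<And>j. j < n \<Longrightarrow> c j = d j) \<Longrightarrow> (\<And>j. j < n \<Longrightarrow> v j = w j) \<Longrightarrow> lcomb n c v = lcomb n d w"
  by (auto simp: lcomb_def intro!: sum.cong)

lemma lcomb_add: "lcomb n (c + d) v = lcomb n c v + lcomb n d v"
  by (auto simp: lcomb_def fun_eq_iff vec_apply algebra_simps sum.distrib)

lemma lcomb_sc: "lcomb n (sc a c) v = sc a (lcomb n c v)"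
  by (auto simp: lcomb_def fun_eq_iff vec_apply algebra_simps sum_distrib_left)

lemma lcomb_0 [simp]: "lcomb n 0 v = 0" "lcomb 0 c v = 0"
  by (auto simp: lcomb_def fun_eq_iff vec_apply)

lemma lcomb_Suc: "lcomb (Suc n) c v = lcomb n c v + sc (c n) (v n)"
  by (auto simp: lcomb_def fun_eq_iff vec_apply)

lemma lcomb_sc_right: "lcomb n c (\<lambda>j. sc a (v j)) = sc a (lcomb n c v)"
  by (auto simp: lcomb_def fun_eq_iff vec_apply sum_distrib_left algebra_simps)

lemma lcomb_lcomb: "lcomb n (lcomb m c w) v = lcomb m c (\<lambda>k. lcomb n (w k) v)"
proof
  fix i
  have "(\<Sum>j<n. (\<Sum>k<m. c k * w k j) * v j i) = (\<Sum>j<n. \<Sum>k<m. c k * (w k j * v j i))"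
    by (simp add: sum_distrib_right mult.assoc)
  also have "\<dots> = (\<Sum>k<m. \<Sum>j<n. c k * (w k j * v j i))" by (rule sum.swap)
  finally show "lcomb n (lcomb m c w) v i = lcomb m c (\<lambda>k. lcomb n (w k) v) i"
    by (simp add: lcomb_def sum_distrib_left)
qed

lemma comp_lcomb: "ring_hom' \<beta> \<Longrightarrow> \<beta> \<circ> lcomb n c v = lcomb n (\<beta> \<circ> c) (\<lambda>j. \<beta> \<circ> v j)"
  by (auto simp: lcomb_def fun_eq_iff vec_apply ring_hom'_sum ring_hom'_simps)

lemma comp_sc: "ring_hom' \<beta> \<Longrightarrow> \<beta> \<circ> sc a v = sc (\<beta> a) (\<beta> \<circ> v)"
  by (auto simp: fun_eq_iff vec_apply ring_hom'_simps)

lemma comp_add: "ring_hom' \<beta> \<Longrightarrow> \<beta> \<circ> (v + w) = (\<beta> \<circ> v) + (\<beta> \<circ> w)"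
  by (auto simp: fun_eq_iff vec_apply ring_hom'_simps)

lemma comp_diff: "ring_hom' \<beta> \<Longrightarrow> \<beta> \<circ> (v - w) = (\<beta> \<circ> v) - (\<beta> \<circ> w)"
  by (auto simp: fun_eq_iff vec_apply ring_hom'_simps)

lemma lcomb_coords_in: "is_ideal A \<Longrightarrow> (\<And>j. j < n \<Longrightarrow> c j \<in> A) \<Longrightarrow> lcomb n c v i \<in> A"
  unfolding lcomb_def by (rule is_ideal_sum) (auto intro: is_idealD(4))

section \<open>Submodules, spans and semilinear maps\<close>

lemma submodD:
  assumes "submod M"
  shows "0 \<in> M" "x \<in> M \<Longrightarrow> y \<in> M \<Longrightarrow> x + y \<in> M" "x \<in> M \<Longrightarrow> sc a x \<in> M"
    "x \<in> M \<Longrightarrow> - x \<in> M" "x \<in> M \<Longrightarrow> y \<in> M \<Longrightarrow> x - y \<in> M"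
proof -
  show add: "x \<in> M \<Longrightarrow> y \<in> M \<Longrightarrow> x + y \<in> M" for x y using assms by (auto simp: submod_def)
  show "0 \<in> M" and mul: "x \<in> M \<Longrightarrow> sc a x \<in> M" for a x using assms by (auto simp: submod_def)
  show neg: "x \<in> M \<Longrightarrow> - x \<in> M" for x using mul[of x "-1"] by (simp add: sc_minus_one)
  show "x \<in> M \<Longrightarrow> y \<in> M \<Longrightarrow> x - y \<in> M" using add[of x "- y"] neg[of y] by simp
qed

lemma submod_lcomb: "submod M \<Longrightarrow> (\<And>j. j < n \<Longrightarrow> v j \<in> M) \<Longrightarrow> lcomb n c v \<in> M"
  by (induction n) (auto simp: lcomb_Suc submodD)

lemma mspan_iff: "v \<in> mspan A \<longleftrightarrow> (\<exists>k c x. (\<forall>i<k. x i \<in> A) \<and> v = lcomb k c x)"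
  by (simp add: mspan_def sum_sc_eq_lcomb)

lemma mspan_subset: "A \<subseteq> M \<Longrightarrow> submod M \<Longrightarrow> mspan A \<subseteq> M"
  by (auto simp: mspan_iff subset_iff intro!: submod_lcomb)

lemma mspan_superset: "A \<subseteq> mspan A"
proof
  fix x assume "x \<in> A"
  then show "x \<in> mspan A"
    unfolding mspan_iff by (intro exI[of _ 1] exI[of _ "\<lambda>_. 1"] exI[of _ "\<lambda>_. x"]) (simp add: lcomb_def)
qed

lemma lcomb_append:
  "lcomb m c v + lcomb n d w =
    lcomb (m + n) (\<lambda>i. if i < m then c i else d (i - m)) (\<lambda>i. if i < m then v i else w (i - m))"
proof (induction n)
  case 0
  then show ?case by (simp, intro lcomb_cong) auto
next
  case (Suc n)
  then show ?case by (simp add: lcomb_Suc add.assoc[symmetric])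
qed

lemma submod_mspan: "submod (mspan A)"
proof -
  have "0 \<in> mspan A" unfolding mspan_iff by (rule exI[of _ 0]) simp
  moreover have "x + y \<in> mspan A" if xy: "x \<in> mspan A" "y \<in> mspan A" for x y
  proof -
    obtain k c v where *: "\<forall>i<k. v i \<in> A" "x = lcomb k c v"
      using xy(1) unfolding mspan_iff by blast
    moreover obtain l d w where "\<forall>i<l. w i \<in> A" "y = lcomb l d w"
      using xy(2) unfolding mspan_iff by blast
    ultimately have *: "\<forall>i<k. v i \<in> A" "x = lcomb k c v" "\<forall>i<l. w i \<in> A" "y = lcomb l d w" by auto
    have "\<forall>i<k + l. (if i < k then v i else w (i - k)) \<in> A" using * by auto
    then show ?thesis unfolding mspan_iff *(2,4) lcomb_append
      by (intro exI conjI) (assumption, rule refl)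
  qed
  moreover have "sc a x \<in> mspan A" if "x \<in> mspan A" for a x
    using that unfolding mspan_iff by (metis lcomb_sc)
  ultimately show ?thesis by (simp add: submod_def)
qed

lemma mspan_induct:
  assumes "v \<in> mspan A" and "Pr 0" and "\<And>x y. Pr x \<Longrightarrow> Pr y \<Longrightarrow> Pr (x + y)"
    and "\<And>a x. x \<in> A \<Longrightarrow> Pr (sc a x)"
  shows "Pr v"
proof -
  obtain k c x where "\<forall>i<k. x i \<in> A" "v = lcomb k c x" using assms(1) unfolding mspan_iff by blast
  moreover have "(\<forall>i<k. x i \<in> A) \<Longrightarrow> Pr (lcomb k c x)"
    by (induction k) (auto simp: lcomb_Suc assms)
  ultimately show ?thesis by simp
qed

lemma lin_onD:
  assumes "lin_on \<beta> M f" "submod M" "ring_hom' \<beta>"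
  shows "x \<in> M \<Longrightarrow> y \<in> M \<Longrightarrow> f (x + y) = f x + f y" "x \<in> M \<Longrightarrow> f (sc a x) = sc (\<beta> a) (f x)"
    "f 0 = 0" "x \<in> M \<Longrightarrow> f (- x) = - f x" "x \<in> M \<Longrightarrow> y \<in> M \<Longrightarrow> f (x - y) = f x - f y"
    "(\<And>j. j < n \<Longrightarrow> v j \<in> M) \<Longrightarrow> f (lcomb n c v) = lcomb n (\<beta> \<circ> c) (\<lambda>j. f (v j))"
proof -
  show add: "x \<in> M \<Longrightarrow> y \<in> M \<Longrightarrow> f (x + y) = f x + f y" for x y using assms(1) by (auto simp: lin_on_def)
  show scl: "x \<in> M \<Longrightarrow> f (sc a x) = sc (\<beta> a) (f x)" for a x using assms(1) by (auto simp: lin_on_def)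
  show zero: "f 0 = 0" using scl[of 0 0] submodD(1)[OF assms(2)] assms(3) by (simp add: ring_hom'_simps)
  show neg: "x \<in> M \<Longrightarrow> f (- x) = - f x" for x
    using scl[of x "-1"] assms(3) by (simp add: ring_hom'_simps sc_minus_one)
  show "x \<in> M \<Longrightarrow> y \<in> M \<Longrightarrow> f (x - y) = f x - f y"
    using add[of x "- y"] neg[of y] submodD(4)[OF assms(2), of y] by simp
  show "(\<And>j. j < n \<Longrightarrow> v j \<in> M) \<Longrightarrow> f (lcomb n c v) = lcomb n (\<beta> \<circ> c) (\<lambda>j. f (v j))"
  proof (induction n)
    case (Suc n)
    then have "lcomb n c v \<in> M" "v n \<in> M" by (auto intro: submod_lcomb[OF assms(2)])
    then show ?case using Suc by (simp add: lcomb_Suc add scl submodD(3)[OF assms(2)] o_apply)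
  qed (simp add: zero)
qed

text \<open>The vectors \<open>v j\<close> themselves may lie outside the domain \<open>M\<close>;
  only their multiples need to be in it. This is the situation of \<open>F\<^sub>1\<close> on
  \<open>Q\<close>, where \<open>a x\<close> is in \<open>Q\<close> for \<open>a\<close> in
  \<open>I\<close> although \<open>x\<close> need not be.\<close>

lemma additive_lcomb:
  assumes f: "lin_on \<beta> M f" "submod M" "ring_hom' \<beta>"
    and "\<And>j. j < k \<Longrightarrow> sc (c j) (v j) \<in> M" "\<And>j. j < k \<Longrightarrow> f (sc (c j) (v j)) = sc (d j) (w j)"
  shows "f (lcomb k c v) = lcomb k d w"
proof -
  have "lcomb k c v \<in> M \<and> f (lcomb k c v) = lcomb k d w"
    using assms(4,5)
  proof (induction k)
    case 0
    then show ?case using lin_onD(3)[OF f] submodD(1)[OF f(2)] by simp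
  next
    case (Suc k)
    then have IH: "lcomb k c v \<in> M" "f (lcomb k c v) = lcomb k d w"
      and new: "sc (c k) (v k) \<in> M" "f (sc (c k) (v k)) = sc (d k) (w k)" by auto
    show ?case
      unfolding lcomb_Suc lin_onD(1)[OF f IH(1) new(1)] IH(2) new(2)
      using submodD(2)[OF f(2) IH(1) new(1)] by simp
  qed
  then show ?thesis by blast
qed

lemma lin_on_eq_on_mspan:
  assumes "lin_on \<beta> M f" "lin_on \<beta> M g" "submod M" "ring_hom' \<beta>" "A \<subseteq> M"
    and "\<And>x. x \<in> A \<Longrightarrow> f x = g x" and "x \<in> mspan A"
  shows "f x = g x"
proof -
  have "x \<in> M \<and> f x = g x"
  proof (rule mspan_induct[OF assms(7)])
    show "0 \<in> M \<and> f 0 = g 0"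
      using lin_onD(3)[OF assms(1,3,4)] lin_onD(3)[OF assms(2,3,4)] submodD(1)[OF assms(3)] by simp
  next
    fix x y assume "x \<in> M \<and> f x = g x" "y \<in> M \<and> f y = g y"
    then show "x + y \<in> M \<and> f (x + y) = g (x + y)"
      using lin_onD(1)[OF assms(1,3,4)] lin_onD(1)[OF assms(2,3,4)] submodD(2)[OF assms(3)] by simp
  next
    fix a x assume "x \<in> A"
    then show "sc a x \<in> M \<and> f (sc a x) = g (sc a x)"
      using lin_onD(2)[OF assms(1,3,4)] lin_onD(2)[OF assms(2,3,4)] submodD(3)[OF assms(3)] assms(5,6) by auto
  qed
  then show ?thesis by simp
qed

lemma lin_on_subset: "lin_on \<beta> M f \<Longrightarrow> N \<subseteq> M \<Longrightarrow> lin_on \<beta> N f"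
  unfolding lin_on_def by blast

lemma lin_on_compose:
  assumes "lin_on \<beta> M f" "lin_on \<gamma> N g" "\<And>x. x \<in> M \<Longrightarrow> f x \<in> N"
  shows "lin_on (\<gamma> \<circ> \<beta>) M (\<lambda>x. g (f x))"
  using assms unfolding lin_on_def by (auto simp: o_apply)

lemma lin_on_comp_hom: "ring_hom' \<beta> \<Longrightarrow> lin_on \<beta> M (\<lambda>x. \<beta> \<circ> x)"
  by (simp add: lin_on_def comp_add comp_sc)

lemma lin_on_lcomb: "ring_hom' \<beta> \<Longrightarrow> lin_on \<beta> M (\<lambda>x. lcomb n (\<beta> \<circ> x) v)"
  by (simp add: lin_on_def comp_add comp_sc lcomb_add lcomb_sc)

lemma lin_on_id_lcomb: "lin_on id M (\<lambda>x. lcomb n x v)"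
  by (simp add: lin_on_def lcomb_add lcomb_sc)

lemma lin_on_plus: "lin_on \<beta> M f \<Longrightarrow> lin_on \<beta> M g \<Longrightarrow> lin_on \<beta> M (\<lambda>x. f x + g x)"
  by (auto simp: lin_on_def sc_add)

lemma lin_on_diff: "lin_on \<beta> M f \<Longrightarrow> lin_on \<beta> M g \<Longrightarrow> lin_on \<beta> M (\<lambda>x. f x - g x)"
  by (auto simp: lin_on_def fun_eq_iff vec_apply algebra_simps)

lemma lin_on_sc: "lin_on \<beta> M f \<Longrightarrow> lin_on \<beta> M (\<lambda>x. sc a (f x))"
  by (auto simp: lin_on_def sc_add mult.commute)

section \<open>Projective modules through dual bases\<close>

text \<open>The dual basis is \<open>e\<close> together with the ambient coordinate functions.\<close>

definition dbasis :: "nat \<Rightarrow> (nat \<Rightarrow> nat \<Rightarrow> 'a::comm_ring_1) \<Rightarrow> (nat \<Rightarrow> 'a) set \<Rightarrow> bool" where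
  "dbasis n e P \<longleftrightarrow> submod P \<and> P \<subseteq> fvec n \<and> (\<forall>j<n. e j \<in> P) \<and> (\<forall>x\<in>P. lcomb n x e = x)"

lemma dbasisD:
  assumes "dbasis n e P"
  shows "submod P" "j < n \<Longrightarrow> e j \<in> P" "x \<in> P \<Longrightarrow> lcomb n x e = x" "x \<in> P \<Longrightarrow> i \<ge> n \<Longrightarrow> x i = 0"
    "x \<in> P \<Longrightarrow> y \<in> P \<Longrightarrow> x + y \<in> P" "x \<in> P \<Longrightarrow> sc a x \<in> P"
    "x \<in> P \<Longrightarrow> y \<in> P \<Longrightarrow> x - y \<in> P" "0 \<in> P" "lcomb n c e \<in> P"
proof -
  have P: "submod P" "P \<subseteq> fvec n" "\<And>j. j < n \<Longrightarrow> e j \<in> P" "\<And>x. x \<in> P \<Longrightarrow> lcomb n x e = x"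
    using assms by (auto simp: dbasis_def)
  show "submod P" "j < n \<Longrightarrow> e j \<in> P" "x \<in> P \<Longrightarrow> lcomb n x e = x" by fact+
  show "x \<in> P \<Longrightarrow> i \<ge> n \<Longrightarrow> x i = 0" using P(2) by (auto simp: fvec_def)
  show "x \<in> P \<Longrightarrow> y \<in> P \<Longrightarrow> x + y \<in> P" "x \<in> P \<Longrightarrow> sc a x \<in> P"
    "x \<in> P \<Longrightarrow> y \<in> P \<Longrightarrow> x - y \<in> P" "0 \<in> P" using submodD[OF P(1)] by auto
  show "lcomb n c e \<in> P" by (rule submod_lcomb[OF P(1) P(3)])
qed

lemma dbasis_lin_on:
  assumes "dbasis n e P" "lin_on \<beta> P f" "ring_hom' \<beta>" "x \<in> P"
  shows "f x = lcomb n (\<beta> \<circ> x) (\<lambda>j. f (e j))"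
  using lin_onD(6)[OF assms(2) dbasisD(1)[OF assms(1)] assms(3), of n e x] dbasisD(2,3)[OF assms(1)] assms(4)
  by simp

text \<open>Each coordinate of \<open>f x\<close> is a linear combination of the
  \<open>\<beta> (x i)\<close>, the coefficients being coordinates of the
  \<open>f (e j)\<close>.\<close>

lemma lin_on_coords_in:
  assumes "dbasis n e P" "lin_on \<beta> P f" "ring_hom' \<beta>" "x \<in> P" "is_ideal A" "\<And>i. \<beta> (x i) \<in> A"
  shows "f x i \<in> A"
  by (subst dbasis_lin_on[OF assms(1-4)], rule lcomb_coords_in) (use assms in \<open>auto simp: o_apply\<close>)

lemma submod_fvec: "submod (fvec n)"
  by (auto simp: submod_def fvec_def vec_apply)

definition std_vec :: "nat \<Rightarrow> nat \<Rightarrow> 'a::comm_ring_1" where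
  "std_vec j = (\<lambda>i. if i = j then 1 else 0)"

lemma lcomb_std_vec:
  assumes "x \<in> fvec n"
  shows "lcomb n x std_vec = x"
proof
  fix i
  have "lcomb n x std_vec i = (\<Sum>j<n. if i = j then x j else 0)"
    unfolding lcomb_def std_vec_def by (intro sum.cong) auto
  also have "\<dots> = x i" using assms by (simp add: fvec_def)
  finally show "lcomb n x std_vec i = x i" .
qed

text \<open>Take for \<open>e j\<close> the \<open>P\<close>-component of the standard vector
  \<open>std_vec j\<close>. Then \<open>x - lcomb n x e\<close> lies both in \<open>P\<close> and in
  the complement, hence vanishes.\<close>

lemma fg_proj_imp_dbasis:
  assumes "fg_proj P"
  shows "\<exists>n e. dbasis n e P"
proof -
  obtain n C where P: "submod P" and C: "submod C" and d: "dsum (fvec n) P C"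
    using assms unfolding fg_proj_def by blast
  have "\<forall>j<n. \<exists>e\<in>P. \<exists>c\<in>C. std_vec j = e + c"
  proof (intro allI impI)
    fix j assume "j < n"
    then have "std_vec j \<in> fvec n" by (auto simp: fvec_def std_vec_def)
    then show "\<exists>e\<in>P. \<exists>c\<in>C. std_vec j = e + c" using d unfolding dsum_def by blast
  qed
  then obtain e c where ec: "\<And>j. j < n \<Longrightarrow> e j \<in> P \<and> c j \<in> C \<and> std_vec j = e j + c j" by metis
  have sub: "P \<subseteq> fvec n"
  proof
    fix x assume "x \<in> P"
    then have "x + 0 \<in> fvec n" using d submodD(1)[OF C] unfolding dsum_def by blast
    then show "x \<in> fvec n" by simp
  qed
  have "lcomb n x e = x" if x: "x \<in> P" for x
  proof -
    have "x = lcomb n x std_vec" using lcomb_std_vec sub x by (metis subsetD)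
    also have "\<dots> = lcomb n x (\<lambda>j. e j + c j)" by (rule lcomb_cong) (use ec in auto)
    also have "\<dots> = lcomb n x e + lcomb n x c"
      by (auto simp: lcomb_def fun_eq_iff vec_apply algebra_simps sum.distrib)
    finally have "x - lcomb n x e = lcomb n x c" by (simp add: algebra_simps)
    moreover have "x - lcomb n x e \<in> P" using x ec by (auto intro!: submodD[OF P] submod_lcomb[OF P])
    moreover have "lcomb n x c \<in> C" using ec by (auto intro!: submod_lcomb[OF C])
    ultimately have "x - lcomb n x e \<in> P \<inter> C" by simp
    then have "x - lcomb n x e = 0" using d unfolding dsum_def by blast
    then show ?thesis by simp
  qed
  then show ?thesis unfolding dbasis_def using P sub ec by blast
qed

text \<open>The map \<open>x \<mapsto> lcomb n x e\<close> is a projector of \<open>S^n\<close> onto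
  \<open>P\<close>; its kernel is the complement.\<close>

lemma dbasis_imp_fg_proj:
  assumes "dbasis n e P"
  shows "fg_proj P"
proof -
  note dD = dbasisD[OF assms]
  have sub: "P \<subseteq> fvec n" using assms by (simp add: dbasis_def)
  define C where "C = {x \<in> fvec n. lcomb n x e = 0}"
  have "submod C"
    unfolding C_def submod_def using submodD[OF submod_fvec[of n]] by (auto simp: lcomb_add lcomb_sc)
  moreover have "dsum (fvec n) P C"
    unfolding dsum_def
  proof (intro conjI Set.set_eqI iffI)
    fix x
    show "x \<in> P \<inter> C \<Longrightarrow> x \<in> {0}" unfolding C_def using dD(3) by fastforce
    show "x \<in> {0} \<Longrightarrow> x \<in> P \<inter> C" using dD(8) submodD(1)[OF submod_fvec[of n]] by (simp add: C_def)
    show "x \<in> {x + y |x y. x \<in> P \<and> y \<in> C} \<Longrightarrow> x \<in> fvec n"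
      using sub submodD(2)[OF submod_fvec[of n]] by (auto simp: C_def)
    assume x: "x \<in> fvec n"
    have p: "lcomb n x e \<in> P" by (rule dD)
    have "lcomb n (x - lcomb n x e) e = lcomb n x e - lcomb n (lcomb n x e) e"
      by (auto simp: lcomb_def fun_eq_iff vec_apply algebra_simps sum_subtractf)
    then have "lcomb n (x - lcomb n x e) e = 0" using dD(3)[OF p] by simp
    moreover have "x - lcomb n x e \<in> fvec n" using x p sub submodD(5)[OF submod_fvec[of n]] by blast
    ultimately have "x - lcomb n x e \<in> C" by (simp add: C_def)
    then have "x = lcomb n x e + (x - lcomb n x e) \<and> lcomb n x e \<in> P \<and> x - lcomb n x e \<in> C" using p by simp
    then show "x \<in> {x + y |x y. x \<in> P \<and> y \<in> C}" by blast
  qed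
  ultimately show ?thesis using dD(1) unfolding fg_proj_def by blast
qed

lemma submod_bchg: "submod (bchg \<beta> P)"
  unfolding bchg_def by (rule submod_mspan)

lemma bchg_gen: "x \<in> P \<Longrightarrow> \<beta> \<circ> x \<in> bchg \<beta> P"
  unfolding bchg_def using mspan_superset by blast

text \<open>The projector with columns \<open>\<beta> \<circ> e j\<close> fixes
  \<open>\<beta> \<circ> x\<close> for \<open>x\<close> in \<open>P\<close>, and therefore
  everything spanned by such vectors.\<close>

lemma dbasis_bchg:
  assumes "dbasis n e P" "ring_hom' \<beta>"
  shows "dbasis n (\<lambda>j. \<beta> \<circ> e j) (bchg \<beta> P)"
proof -
  note dD = dbasisD[OF assms(1)]
  have "lcomb n y (\<lambda>j. \<beta> \<circ> e j) = y \<and> y \<in> fvec n" if "y \<in> bchg \<beta> P" for y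
    using that unfolding bchg_def
  proof (rule mspan_induct)
    fix a y assume "y \<in> (\<lambda>v. \<beta> \<circ> v) ` P"
    then obtain x where x: "x \<in> P" "y = \<beta> \<circ> x" by auto
    have "lcomb n y (\<lambda>j. \<beta> \<circ> e j) = y"
      using comp_lcomb[OF assms(2), of n x e] dD(3)[OF x(1)] x(2) by simp
    moreover have "y \<in> fvec n" using dD(4)[OF x(1)] x(2) assms(2) by (auto simp: fvec_def vec_apply ring_hom'_simps)
    ultimately show "lcomb n (sc a y) (\<lambda>j. \<beta> \<circ> e j) = sc a y \<and> sc a y \<in> fvec n"
      by (simp add: lcomb_sc submodD[OF submod_fvec])
  qed (auto simp: lcomb_add submodD[OF submod_fvec])
  then show ?thesis unfolding dbasis_def using submod_bchg bchg_gen dD(2) by (metis subsetI)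
qed

text \<open>This is \<open>A P = P \<inter> A^n\<close>, valid because \<open>P\<close> is a direct
  summand: the expansion of \<open>y\<close> along \<open>e\<close> has the coordinates of
  \<open>y\<close> as coefficients.\<close>

lemma imult_iff:
  assumes "dbasis n e P" "is_ideal A"
  shows "y \<in> imult A P \<longleftrightarrow> y \<in> P \<and> (\<forall>i. y i \<in> A)"
proof
  assume "y \<in> imult A P"
  then show "y \<in> P \<and> (\<forall>i. y i \<in> A)"
    unfolding imult_def
  proof (rule mspan_induct)
    show "0 \<in> P \<and> (\<forall>i. 0 i \<in> A)"
      using dbasisD(8)[OF assms(1)] is_idealD(1)[OF assms(2)] by (simp add: zero_fun_apply)
  next
    fix x y assume "x \<in> P \<and> (\<forall>i. x i \<in> A)" "y \<in> P \<and> (\<forall>i. y i \<in> A)"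
    then show "x + y \<in> P \<and> (\<forall>i. (x + y) i \<in> A)"
      using dbasisD(5)[OF assms(1)] is_idealD(2)[OF assms(2)] by (simp add: plus_fun_apply)
  next
    fix b y assume "y \<in> {sc a x |a x. a \<in> A \<and> x \<in> P}"
    then obtain a x where "y = sc a x" "a \<in> A" "x \<in> P" by blast
    then show "sc b y \<in> P \<and> (\<forall>i. (sc b y) i \<in> A)"
      using dbasisD(6)[OF assms(1)] is_idealD(3,4)[OF assms(2)] by (simp add: sc_apply)
  qed
next
  assume y: "y \<in> P \<and> (\<forall>i. y i \<in> A)"
  then have "y = lcomb n (\<lambda>_. 1) (\<lambda>j. sc (y j) (e j))"
    using dbasisD(3)[OF assms(1)] by (auto simp: lcomb_def fun_eq_iff vec_apply)
  moreover have "\<forall>j<n. sc (y j) (e j) \<in> {sc a x |a x. a \<in> A \<and> x \<in> P}"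
    using y dbasisD(2)[OF assms(1)] by blast
  ultimately show "y \<in> imult A P" unfolding imult_def mspan_iff by (metis (no_types, lifting))
qed

text \<open>Projecting \<open>e\<close> to a summand gives a dual basis of that summand with the
  same index range, so \<open>P\<close>, \<open>L\<close> and \<open>T\<close> share their
  coordinates.\<close>

lemma dbasis_summand:
  assumes "dbasis n e P" "submod L" "submod T" "dsum P L T"
  shows "\<exists>pL pT. lin_on id P pL \<and> lin_on id P pT \<and> (\<forall>x\<in>P. pL x \<in> L \<and> pT x \<in> T \<and> x = pL x + pT x) \<and>
    (\<forall>x\<in>L. pL x = x \<and> pT x = 0) \<and> (\<forall>x\<in>T. pL x = 0 \<and> pT x = x) \<and> L \<subseteq> P \<and> T \<subseteq> P \<and>
    dbasis n (\<lambda>j. pL (e j)) L \<and> dbasis n (\<lambda>j. pT (e j)) T"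
proof -
  note dD = dbasisD[OF assms(1)] and L = submodD[OF assms(2)] and T = submodD[OF assms(3)]
  have int: "L \<inter> T = {0}" and P: "P = {x + y |x y. x \<in> L \<and> y \<in> T}" using assms(4) by (auto simp: dsum_def)
  have "\<forall>x\<in>P. \<exists>l\<in>L. \<exists>t\<in>T. x = l + t" using P by blast
  then obtain pL pT where p: "\<forall>x\<in>P. pL x \<in> L \<and> pT x \<in> T \<and> x = pL x + pT x" by metis
  have LP: "L \<subseteq> P"
  proof
    fix x assume "x \<in> L" then show "x \<in> P" unfolding P using T(1) by (intro CollectI exI[of _ x] exI[of _ 0]) simp
  qed
  have TP: "T \<subseteq> P"
  proof
    fix x assume "x \<in> T" then show "x \<in> P" unfolding P using L(1) by (intro CollectI exI[of _ 0] exI[of _ x]) simp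
  qed
  have uniq: "pL x = l \<and> pT x = t" if "l \<in> L" "t \<in> T" "x = l + t" for x l t
  proof -
    have "x \<in> P" using that P by blast
    then have *: "pL x \<in> L" "pT x \<in> T" "x = pL x + pT x" using p by auto
    then have "pL x - l = t - pT x" using that(3) by (metis add.commute add_diff_eq diff_eq_eq)
    then have "pL x - l \<in> L \<inter> T" "t - pT x \<in> L \<inter> T"
      using L(5)[OF *(1) that(1)] T(5)[OF that(2) *(2)] by auto
    then show ?thesis using int by auto
  qed
  have add: "pL (x + y) = pL x + pL y \<and> pT (x + y) = pT x + pT y" if "x \<in> P" "y \<in> P" for x y
  proof (rule uniq)
    have "x + y = (pL x + pT x) + (pL y + pT y)" using p that by simp
    then show "x + y = pL x + pL y + (pT x + pT y)" by (simp add: algebra_simps)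
  qed (use p that in \<open>auto intro: L(2) T(2)\<close>)
  have scl: "pL (sc a x) = sc a (pL x) \<and> pT (sc a x) = sc a (pT x)" if "x \<in> P" for a x
    by (rule uniq) (use p that in \<open>auto simp: sc_add[symmetric] intro: L(3) T(3)\<close>)
  have lin: "lin_on id P pL" "lin_on id P pT" using add scl by (auto simp: lin_on_def)
  have on: "pL x = x \<and> pT x = 0" if "x \<in> L" for x by (rule uniq) (use that T in auto)
  have on': "pL x = 0 \<and> pT x = x" if "x \<in> T" for x by (rule uniq) (use that L in auto)
  have sub: "P \<subseteq> fvec n" using assms(1) by (simp add: dbasis_def)
  have "dbasis n (\<lambda>j. pL (e j)) L"
    unfolding dbasis_def
    using assms(2) LP sub p dD(2) on dbasis_lin_on[OF assms(1) lin(1) ring_hom'_id]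
    by (auto simp: subset_iff)
  moreover have "dbasis n (\<lambda>j. pT (e j)) T"
    unfolding dbasis_def
    using assms(3) TP sub p dD(2) on' dbasis_lin_on[OF assms(1) lin(2) ring_hom'_id]
    by (auto simp: subset_iff)
  ultimately show ?thesis using lin p on on' LP TP by blast
qed

section \<open>Frames and the Frobenius rank argument\<close>

text \<open>A free module of rank \<open>n\<close> cannot support \<open>n + 1\<close> independent
  dual pairs. Padded to square matrices of size \<open>n + 1\<close>, \<open>X\<close> acquires a
  zero row, so the diagonal matrix \<open>Y * X\<close> has determinant 0.\<close>

lemma prod_eq_0_if_diagonal_pairing:
  fixes x y :: "nat \<Rightarrow> nat \<Rightarrow> 'a::comm_ring_1"
  assumes "\<And>i j. i < Suc n \<Longrightarrow> j < Suc n \<Longrightarrow> (\<Sum>k<n. y j k * x k i) = (if i = j then c i else 0)"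
  shows "(\<Prod>i<Suc n. c i) = 0"
proof -
  let ?N = "Suc n"
  define Y where "Y = mat ?N ?N (\<lambda>(j, k). if k < n then y j k else 0)"
  define X where "X = mat ?N ?N (\<lambda>(k, i). if k < n then x k i else 0)"
  define D where "D = mat ?N ?N (\<lambda>(j, i). if i = j then c i else 0)"
  have carr: "X \<in> carrier_mat ?N ?N" "Y \<in> carrier_mat ?N ?N" "D \<in> carrier_mat ?N ?N"
    by (auto simp: X_def Y_def D_def)
  have "Y * X = D"
  proof (rule eq_matI)
    fix j i assume "j < dim_row D" "i < dim_col D"
    then have ji: "j < ?N" "i < ?N" by (auto simp: D_def)
    have "(Y * X) $$ (j, i) = (\<Sum>k = 0..<?N. Y $$ (j, k) * X $$ (k, i))"
      using ji carr by (auto simp: scalar_prod_def)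
    also have "\<dots> = (\<Sum>k<n. y j k * x k i)"
      using ji by (simp add: X_def Y_def atLeast0LessThan)
    also have "\<dots> = D $$ (j, i)" using assms[OF ji(2,1)] ji by (simp add: D_def)
    finally show "(Y * X) $$ (j, i) = D $$ (j, i)" .
  qed (use carr in auto)
  moreover have "det X = 0"
  proof -
    have "(\<Prod>i = 0..<?N. X $$ (i, q i)) = 0" if "q permutes {0..<?N}" for q
    proof (rule prod_zero)
      show "\<exists>i\<in>{0..<?N}. X $$ (i, q i) = 0"
        using permutes_in_image[OF that, of n] by (intro bexI[of _ n]) (auto simp: X_def)
    qed simp
    then show ?thesis unfolding det_def'[OF carr(1)] by (auto intro!: sum.neutral)
  qed
  ultimately have "det D = 0" using det_mult[OF carr(2,1)] by simp
  moreover have "det D = prod_list (diag_mat D)"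
    by (rule det_upper_triangular[OF _ carr(3)]) (auto simp: D_def)
  moreover have "prod_list (diag_mat D) = (\<Prod>i<?N. c i)"
    using carr(3) by (simp add: prod_list_diag_prod D_def atLeast0LessThan)
  ultimately show ?thesis by simp
qed

text \<open>A matrix product with unrestricted outer indices: matrix identities become equations
  between functions and can be used for rewriting without bounds on indices.\<close>

definition mm :: "nat \<Rightarrow> (nat \<Rightarrow> nat \<Rightarrow> 'a::comm_ring_1) \<Rightarrow> (nat \<Rightarrow> nat \<Rightarrow> 'a) \<Rightarrow> nat \<Rightarrow> nat \<Rightarrow> 'a" where
  "mm n A B = (\<lambda>i j. \<Sum>k<n. A i k * B k j)"

lemma mm_assoc: "mm n (mm n A B) C = mm n A (mm n B C)"
proof (intro ext)
  fix i j
  have "(\<Sum>k<n. (\<Sum>l<n. A i l * B l k) * C k j) = (\<Sum>k<n. \<Sum>l<n. A i l * (B l k * C k j))"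
    by (simp add: sum_distrib_right mult.assoc)
  also have "\<dots> = (\<Sum>l<n. \<Sum>k<n. A i l * (B l k * C k j))" by (rule sum.swap)
  finally show "mm n (mm n A B) C i j = mm n A (mm n B C) i j"
    by (simp add: mm_def sum_distrib_left)
qed

lemma mm_diff:
  "mm n A (\<lambda>i j. B i j - C i j) = (\<lambda>i j. mm n A B i j - mm n A C i j)"
  "mm n (\<lambda>i j. B i j - C i j) A = (\<lambda>i j. mm n B A i j - mm n C A i j)"
  by (auto simp: mm_def fun_eq_iff algebra_simps sum_subtractf)

lemma mm_hom:
  "ring_hom' \<beta> \<Longrightarrow> mm n (\<lambda>i j. \<beta> (A i j)) (\<lambda>i j. \<beta> (B i j)) = (\<lambda>i j. \<beta> (mm n A B i j))"
  by (auto simp: mm_def fun_eq_iff ring_hom'_sum ring_hom'_simps)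

section \<open>Frames, the element \<open>\<theta>\<close> and the Frobenius\<close>

locale wframe =
  fixes p :: nat and I :: "'a::comm_ring_1 set" and \<sigma> \<sigma>1 :: "'a \<Rightarrow> 'a"
  assumes frame: "frame p I \<sigma> \<sigma>1"
begin

abbreviation \<theta> :: 'a where "\<theta> \<equiv> frame_theta I \<sigma> \<sigma>1"

lemma ideal_I: "is_ideal I"
  and hom: "ring_hom' \<sigma>"
  and \<sigma>1_add: "a \<in> I \<Longrightarrow> b \<in> I \<Longrightarrow> \<sigma>1 (a + b) = \<sigma>1 a + \<sigma>1 b"
  and \<sigma>1_mult: "a \<in> I \<Longrightarrow> \<sigma>1 (s * a) = \<sigma> s * \<sigma>1 a"
  and p_rad: "of_nat p * s \<in> jac_rad"
  and frobenius: "of_nat p dvd \<sigma> a - a ^ p"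
  and \<sigma>1_generates: "gen_ideal (\<sigma>1 ` I) = UNIV"
proof -
  show "of_nat p * s \<in> jac_rad"
  proof -
    have "0 + of_nat p * s \<in> jac_rad" using frame unfolding frame_def is_ideal_def by blast
    then show ?thesis by simp
  qed
qed (use frame in \<open>auto simp: frame_def ring_endo_eq_ring_hom' dvd_def\<close>)

lemma hom_funpow: "ring_hom' (\<sigma> ^^ k)"
  using hom by (rule ring_hom'_funpow)

text \<open>The generation axiom as a partition of unity by values of \<open>\<sigma>1\<close>. An
  identity can thus be checked after multiplication with every \<open>\<sigma>1 a\<close>.\<close>

lemma \<sigma>1_partition: "\<exists>(k::nat) c a. (\<forall>i<k. a i \<in> I) \<and> (\<Sum>i<k. c i * \<sigma>1 (a i)) = 1"
proof -
  have "1 \<in> gen_ideal (\<sigma>1 ` I)" using \<sigma>1_generates by simp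
  then obtain k :: nat and c x where *: "\<forall>i<k. x i \<in> \<sigma>1 ` I" "1 = (\<Sum>i<k. c i * x i)"
    unfolding gen_ideal_def by blast
  then obtain a where "\<forall>i<k. a i \<in> I \<and> x i = \<sigma>1 (a i)" unfolding image_iff by metis
  then show ?thesis using * by (intro exI[of _ k] exI[of _ c] exI[of _ a]) simp
qed

lemma \<sigma>1_cancel:
  assumes "\<And>a. a \<in> I \<Longrightarrow> sc (\<sigma>1 a) x = sc (\<sigma>1 a) y"
  shows "x = y"
proof
  fix i
  obtain k :: nat and c a where *: "\<forall>i<k. a i \<in> I" "(\<Sum>i<k. c i * \<sigma>1 (a i)) = 1"
    using \<sigma>1_partition by blast
  have "(\<Sum>j<k. c j * \<sigma>1 (a j)) * x i = (\<Sum>j<k. c j * \<sigma>1 (a j)) * y i"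
    unfolding sum_distrib_right
  proof (rule sum.cong)
    fix j assume "j \<in> {..<k}"
    then have "sc (\<sigma>1 (a j)) x i = sc (\<sigma>1 (a j)) y i" using assms * by simp
    then show "c j * \<sigma>1 (a j) * x i = c j * \<sigma>1 (a j) * y i" by (simp add: sc_apply mult.assoc)
  qed simp
  then show "x i = y i" using * by simp
qed

text \<open>Computing \<open>\<sigma>1 (b * a)\<close> in two ways gives
  \<open>\<sigma> b * \<sigma>1 a = \<sigma>1 b * \<sigma> a\<close>. Summing against a partition of
  unity shows that \<open>\<Sum>i<k. c i * \<sigma> (b i)\<close> has the required property.\<close>

lemma \<theta>: "a \<in> I \<Longrightarrow> \<sigma> a = \<theta> * \<sigma>1 a"
proof -
  obtain k :: nat and c b where *: "\<forall>i<k. b i \<in> I" "(\<Sum>i<k. c i * \<sigma>1 (b i)) = 1"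
    using \<sigma>1_partition by blast
  have ex: "\<forall>a\<in>I. \<sigma> a = (\<Sum>i<k. c i * \<sigma> (b i)) * \<sigma>1 a"
  proof
    fix a assume a: "a \<in> I"
    have "\<sigma> (b i) * \<sigma>1 a = \<sigma>1 (b i) * \<sigma> a" if "i < k" for i
      using \<sigma>1_mult[OF a, of "b i"] \<sigma>1_mult[of "b i" a] * that by (simp add: mult.commute)
    then have "(\<Sum>i<k. c i * \<sigma> (b i)) * \<sigma>1 a = (\<Sum>i<k. c i * \<sigma>1 (b i)) * \<sigma> a"
      unfolding sum_distrib_right by (intro sum.cong) (auto simp: mult.assoc)
    then show "\<sigma> a = (\<Sum>i<k. c i * \<sigma> (b i)) * \<sigma>1 a" using * by simp
  qed
  have uniq: "t = t'" if "\<forall>a\<in>I. \<sigma> a = t * \<sigma>1 a" "\<forall>a\<in>I. \<sigma> a = t' * \<sigma>1 a" for t t'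
  proof -
    have "t * 1 = (\<Sum>i<k. c i * (t * \<sigma>1 (b i)))" unfolding *(2)[symmetric] sum_distrib_left
      by (intro sum.cong) (auto simp: mult.commute mult.left_commute)
    also have "\<dots> = (\<Sum>i<k. c i * (t' * \<sigma>1 (b i)))"
      using that * by (intro sum.cong) auto
    also have "\<dots> = t' * 1" unfolding *(2)[symmetric] sum_distrib_left
      by (intro sum.cong) (auto simp: mult.commute mult.left_commute)
    finally show ?thesis by simp
  qed
  have "\<forall>a\<in>I. \<sigma> a = \<theta> * \<sigma>1 a"
    unfolding frame_theta_def by (rule theI[where a = "\<Sum>i<k. c i * \<sigma> (b i)"]) (use uniq ex in blast)+
  then show "a \<in> I \<Longrightarrow> \<sigma> a = \<theta> * \<sigma>1 a" by blast
qed

lemma \<theta>_unique: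
  assumes "\<And>a. a \<in> I \<Longrightarrow> \<sigma> a = t * \<sigma>1 a"
  shows "\<theta> = t"
proof -
  \<comment> \<open>Scalars are turned into constant vectors in order to apply
    \<open>\<sigma>1_cancel\<close>.\<close>
  have "(\<lambda>_::nat. \<theta>) = (\<lambda>_. t)"
    by (rule \<sigma>1_cancel) (use \<theta> assms in \<open>auto simp: sc_def mult.commute\<close>)
  then show ?thesis by meson
qed

lemma funpow_frobenius: "of_nat p dvd (\<sigma> ^^ i) a - a ^ (p ^ i)"
proof (induction i)
  case (Suc i)
  then obtain d where "(\<sigma> ^^ i) a - a ^ (p ^ i) = of_nat p * d" by (auto simp: dvd_def)
  then have "\<sigma> ((\<sigma> ^^ i) a) - \<sigma> (a ^ (p ^ i)) = of_nat p * \<sigma> d"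
    using hom by (metis ring_hom'_simps(3,6) ring_hom'_of_nat)
  then have "of_nat p dvd \<sigma> ((\<sigma> ^^ i) a) - \<sigma> (a ^ (p ^ i))" by simp
  moreover have "of_nat p dvd \<sigma> (a ^ (p ^ i)) - (a ^ (p ^ i)) ^ p" by (rule frobenius)
  ultimately have "of_nat p dvd (\<sigma> ((\<sigma> ^^ i) a) - \<sigma> (a ^ (p ^ i))) + (\<sigma> (a ^ (p ^ i)) - (a ^ (p ^ i)) ^ p)"
    by (rule dvd_add)
  then show ?case by (simp add: o_apply power_mult[symmetric] mult.commute)
qed simp

text \<open>Modulo \<open>p\<close> the factor \<open>(\<sigma> ^^ i) a\<close> is
  \<open>a ^ (p ^ i)\<close>, so the product is a single power of \<open>a\<close>. That power lies
  in \<open>pS\<close>, hence in the radical, and the radical contains every element having a power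
  in it.\<close>

lemma prod_funpow_eq_0_imp_rad:
  assumes "(\<Prod>i<n. (\<sigma> ^^ i) a) = 0"
  shows "a \<in> jac_rad"
proof -
  have "of_nat p dvd (\<Prod>i<n. (\<sigma> ^^ i) a) - a ^ (\<Sum>i<n. p ^ i)"
  proof (induction n)
    case (Suc n)
    let ?x = "\<Prod>i<n. (\<sigma> ^^ i) a" and ?y = "a ^ (\<Sum>i<n. p ^ i)"
    have "?x * (\<sigma> ^^ n) a - ?y * a ^ (p ^ n) = (?x - ?y) * (\<sigma> ^^ n) a + ?y * ((\<sigma> ^^ n) a - a ^ (p ^ n))"
      by (simp add: algebra_simps)
    then show ?case using Suc funpow_frobenius[of n a] by (simp add: power_add)
  qed simp
  then have "of_nat p dvd a ^ (\<Sum>i<n. p ^ i)" using assms by simp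
  then have "a ^ (\<Sum>i<n. p ^ i) \<in> jac_rad" using p_rad by (auto simp: dvd_def)
  then show ?thesis by (rule jac_rad_power)
qed

text \<open>\<open>A\<close> is a surjection \<open>P\<^bsup>(\<sigma>)\<^esup> \<rightarrow> P\<close> with section \<open>B\<close>, and \<open>G\<close> projects onto its kernel \<open>K\<close>. Iterating
  the splitting \<open>P\<^bsup>(\<sigma>)\<^esup> = P \<oplus> K\<close> puts \<open>K \<oplus> K\<^bsup>(\<sigma>)\<^esup> \<oplus> \<dots> \<oplus> K\<^bsup>(\<sigma>\<^sup>n)\<^esup>\<close> into a module with \<open>n\<close> generators, so
  for each entry \<open>g\<close> of \<open>G\<close> the product \<open>g \<sigma>(g) \<dots> \<sigma>\<^sup>n(g)\<close> vanishes; this is a power of \<open>g\<close> modulo \<open>p\<close>.\<close>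

lemma frobenius_rank:
  assumes AB: "mm n A B = E" and EA: "mm n E A = A" and AE: "mm n A (\<lambda>i j. \<sigma> (E i j)) = A"
    and EB: "mm n (\<lambda>i j. \<sigma> (E i j)) B = B" and BE: "mm n B E = B" and ij: "i < n" "j < n"
  shows "mm n B A i j = \<sigma> (E i j)"
proof -
  let ?tw = "\<lambda>k M i j. (\<sigma> ^^ k) (M i j)"
  define E1 where "E1 = (\<lambda>i j. \<sigma> (E i j))"
  define G where "G = (\<lambda>i j. E1 i j - mm n B A i j)"
  have EE: "mm n E E = E" using mm_assoc[of n E A B] AB EA by simp
  have E1E1: "mm n E1 E1 = E1" unfolding E1_def mm_hom[OF hom] EE ..
  note AE = AE[folded E1_def] and EB = EB[folded E1_def]
  have AG: "mm n A G = (\<lambda>i j. 0)" unfolding G_def mm_diff AE mm_assoc[symmetric] AB EA by simp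
  have GB: "mm n G B = (\<lambda>i j. 0)" unfolding G_def mm_diff EB mm_assoc AB BE by simp
  have GE: "mm n G E1 = G" unfolding G_def mm_diff E1E1 mm_assoc AE ..
  have EG: "mm n E1 G = G" unfolding G_def mm_diff E1E1 mm_assoc[symmetric] EB ..
  have GG: "mm n G G = G"
  proof -
    have "mm n G G = (\<lambda>i j. mm n G E1 i j - mm n G (mm n B A) i j)"
      by (subst (2) G_def) (simp only: mm_diff)
    then show ?thesis unfolding GE mm_assoc[symmetric] GB by (simp add: mm_def)
  qed
  have tw: "mm n (?tw k M) (?tw k N) = ?tw k (mm n M N)" for k M N
    by (rule mm_hom[OF hom_funpow])
  have twE: "?tw (Suc k) E = ?tw k E1" for k
    by (simp add: E1_def funpow_swap1 o_apply)
  have tw0: "?tw k (\<lambda>i j. 0) = (\<lambda>(i::nat) (j::nat). 0)" for k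
    using ring_hom'_simps(4)[OF hom_funpow] by simp
  have rad: "G a b \<in> jac_rad" for a b
  proof (rule prod_funpow_eq_0_imp_rad)
    \<comment> \<open>The columns of \<open>X\<close> are vectors of \<open>P^(\<sigma>^N)\<close>,
      the rows of \<open>Y\<close> are functionals on it, and their pairings are diagonal with
      entries the twists of \<open>G a b\<close>.\<close>
    have "\<exists>X Y. mm n (?tw N E) X = X \<and> mm n Y (?tw N E) = Y \<and>
        (\<forall>i<N. \<forall>j<N. mm n Y X j i = (if i = j then (\<sigma> ^^ i) (G a b) else 0))" for N
    proof (induction N)
      case 0
      show ?case by (intro exI[of _ "\<lambda>_ _. 0"]) (simp add: mm_def)
    next
      case (Suc N)
      then obtain X Y where X: "mm n (?tw N E) X = X" and Y: "mm n Y (?tw N E) = Y"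
        and YX: "\<And>i j. i < N \<Longrightarrow> j < N \<Longrightarrow> mm n Y X j i = (if i = j then (\<sigma> ^^ i) (G a b) else 0)"
        by blast
      let ?A = "?tw N A" and ?B = "?tw N B" and ?G = "?tw N G" and ?E = "?tw N E1"
      \<comment> \<open>Old columns move along the section \<open>B\<close>, old rows are pulled
        back along \<open>A\<close>, and the new pair is column \<open>b\<close> and row
        \<open>a\<close> of the twisted \<open>G\<close>. Mixed pairings vanish by \<open>AG\<close>
        and \<open>GB\<close>; the new diagonal entry is the twist of \<open>G a b\<close> by
        \<open>GG\<close>.\<close>
      define X' where "X' = (\<lambda>k i. if i < N then mm n ?B X k i else ?G k b)"
      define Y' where "Y' = (\<lambda>j k. if j < N then mm n Y ?A j k else ?G a k)"
      have X'_col: "mm n M X' j i = (if i < N then mm n M (mm n ?B X) j i else mm n M ?G j b)" for M i j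
        by (simp add: mm_def X'_def)
      have Y'_row: "mm n Y' M j i = (if j < N then mm n (mm n Y ?A) M j i else mm n ?G M a i)" for M i j
        by (simp add: mm_def Y'_def)
      have "mm n (?tw (Suc N) E) X' = X'"
        unfolding twE by (intro ext) (simp add: X'_col mm_assoc[symmetric] tw EB EG, simp add: X'_def)
      moreover have "mm n Y' (?tw (Suc N) E) = Y'"
        unfolding twE by (intro ext) (simp add: Y'_row mm_assoc tw AE GE, simp add: Y'_def)
      moreover have "mm n Y' X' j i = (if i = j then (\<sigma> ^^ i) (G a b) else 0)"
        if "i < Suc N" "j < Suc N" for i j
      proof -
        have 1: "mm n (mm n Y ?A) (mm n ?B X) = mm n Y X"
          unfolding mm_assoc mm_assoc[of n ?A ?B X, symmetric] tw AB X ..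
        have 2: "mm n (mm n Y ?A) ?G = (\<lambda>i j. 0)"
          unfolding mm_assoc tw AG tw0 by (simp add: mm_def)
        have 3: "mm n ?G (mm n ?B X) = (\<lambda>i j. 0)"
          unfolding mm_assoc[symmetric] tw GB tw0 by (simp add: mm_def)
        show ?thesis
          using that YX by (auto simp: Y'_row X'_col 1 2 3 tw GG less_Suc_eq)
      qed
      ultimately show ?case by blast
    qed
    from this[of "Suc n"] obtain X Y where
      "\<forall>i<Suc n. \<forall>j<Suc n. mm n Y X j i = (if i = j then (\<sigma> ^^ i) (G a b) else 0)" by blast
    then show "(\<Prod>i<Suc n. (\<sigma> ^^ i) (G a b)) = 0"
      by (intro prod_eq_0_if_diagonal_pairing[where x = X and y = Y]) (auto simp: mm_def)
  qed
  \<comment> \<open>By \<open>GG\<close> each column \<open>v\<close> of \<open>G\<close> satisfies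
    \<open>v = G v\<close>, with all entries of \<open>G\<close> in the radical.\<close>
  have "G i j = 0"
    by (rule nakayama_coordinates[where v = "\<lambda>i. G i j" and r = G and k = n])
      (use fun_cong[OF fun_cong[OF GG]] rad ij in \<open>auto simp: mm_def\<close>)
  then show ?thesis by (simp add: G_def E1_def)
qed

text \<open>The hypothesis says that the linearisation \<open>P^(\<sigma>) \<rightarrow> P\<close>
  of \<open>\<Psi>\<close> is surjective. By \<open>frobenius_rank\<close> a right inverse is then
  also a left inverse, and \<open>g\<close> is the linearisation of \<open>\<chi>\<close> after this
  inverse.\<close>

lemma factor_through_generating:
  assumes db: "dbasis n e P" and \<Psi>: "lin_on \<sigma> P \<Psi>" "\<And>x. x \<in> P \<Longrightarrow> \<Psi> x \<in> P"
    and gen: "P \<subseteq> mspan (\<Psi> ` P)" and \<chi>: "lin_on \<sigma> P \<chi>"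
    and N: "submod N" "\<And>x. x \<in> P \<Longrightarrow> \<chi> x \<in> N"
  shows "\<exists>g. lin_on id P g \<and> (\<forall>x\<in>P. g x \<in> N) \<and> (\<forall>x\<in>P. g (\<Psi> x) = \<chi> x)"
proof -
  note dD = dbasisD[OF db]
  have \<Psi>_coord: "\<Psi> x = lcomb n (\<sigma> \<circ> x) (\<lambda>k. \<Psi> (e k))" if "x \<in> P" for x
    by (rule dbasis_lin_on[OF db \<Psi>(1) hom that])
  have "\<exists>b. e j = lcomb n b (\<lambda>k. \<Psi> (e k))" if j: "j < n" for j
  proof -
    have "e j \<in> mspan (\<Psi> ` P)" using gen dD(2)[OF j] by blast
    then obtain k :: nat and c y where y: "\<forall>i<k. y i \<in> \<Psi> ` P" "e j = lcomb k c y"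
      unfolding mspan_iff by blast
    then obtain x where x: "\<And>i. i < k \<Longrightarrow> x i \<in> P \<and> y i = \<Psi> (x i)" unfolding image_iff by metis
    have "e j = lcomb k c (\<lambda>i. lcomb n (\<sigma> \<circ> x i) (\<lambda>k. \<Psi> (e k)))"
      unfolding y(2) by (rule lcomb_cong) (use x \<Psi>_coord in auto)
    then show ?thesis unfolding lcomb_lcomb[symmetric] by blast
  qed
  then obtain b where b: "\<And>j. j < n \<Longrightarrow> e j = lcomb n (b j) (\<lambda>k. \<Psi> (e k))" by metis
  define E where "E = (\<lambda>i j. if j < n then e j i else 0)"
  define A where "A = (\<lambda>i j. if j < n then \<Psi> (e j) i else 0)"
  \<comment> \<open>The coefficients \<open>b\<close> are arbitrary. Composing with the projector
    \<open>E\<close> on the right and with its twist on the left makes \<open>B\<close> a map from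
    \<open>P\<close> to \<open>P^(\<sigma>)\<close>, without losing \<open>A B = E\<close>.\<close>
  define B0 where "B0 = mm n (\<lambda>k j. b j k) E"
  define B where "B = mm n (\<lambda>i j. \<sigma> (E i j)) B0"
  have mmE: "mm n E M i j = lcomb n (\<lambda>k. M k j) e i" for M i j
    by (auto simp: mm_def E_def lcomb_def mult.commute intro!: sum.cong)
  have mmA: "mm n A M i j = lcomb n (\<lambda>k. M k j) (\<lambda>k. \<Psi> (e k)) i" for M i j
    by (auto simp: mm_def A_def lcomb_def mult.commute intro!: sum.cong)
  have EE: "mm n E E = E"
  proof (intro ext)
    fix i j show "mm n E E i j = E i j"
      unfolding mmE by (cases "j < n") (use dD(2,3) in \<open>auto simp: E_def lcomb_0(1)[unfolded zero_fun_def]\<close>)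
  qed
  have EA: "mm n E A = A"
  proof (intro ext)
    fix i j show "mm n E A i j = A i j"
      unfolding mmE by (cases "j < n") (use dD(2,3) \<Psi>(2) in \<open>auto simp: A_def lcomb_0(1)[unfolded zero_fun_def]\<close>)
  qed
  have AE: "mm n A (\<lambda>i j. \<sigma> (E i j)) = A"
  proof (intro ext)
    fix i j
    show "mm n A (\<lambda>i j. \<sigma> (E i j)) i j = A i j"
    proof (cases "j < n")
      case True
      then show ?thesis unfolding mmA using fun_cong[OF \<Psi>_coord[OF dD(2)[OF True]], of i]
        by (simp add: E_def A_def o_def)
    qed (simp add: mm_def E_def A_def ring_hom'_simps(4)[OF hom])
  qed
  have "mm n (mm n A (\<lambda>k j. b j k)) E i j = mm n E E i j" for i j
    unfolding mm_def[of n _ E] by (intro sum.cong) (use b in \<open>auto simp: mmA E_def\<close>)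
  then have "mm n A B0 = E" unfolding B0_def mm_assoc[symmetric] EE by blast
  then have AB: "mm n A B = E" unfolding B_def mm_assoc[symmetric] AE .
  have EB: "mm n (\<lambda>i j. \<sigma> (E i j)) B = B"
    unfolding B_def mm_assoc[symmetric] mm_hom[OF hom] EE ..
  have BE: "mm n B E = B" unfolding B_def B0_def mm_assoc EE ..
  note BA = frobenius_rank[OF AB EA AE EB BE]
  define g where "g = (\<lambda>x. lcomb n (lcomb n x (\<lambda>j k. B k j)) (\<lambda>k. \<chi> (e k)))"
  have "lin_on id P g"
    unfolding g_def lin_on_def by (simp add: lcomb_add lcomb_sc)
  moreover have "\<forall>x\<in>P. g x \<in> N"
    unfolding g_def using N dD(2) by (auto intro!: submod_lcomb)
  moreover have "g (\<Psi> z) = \<chi> z" if z: "z \<in> P" for z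
  proof -
    have "lcomb n (\<Psi> z) (\<lambda>j k. B k j) i = (\<sigma> \<circ> z) i" if i: "i < n" for i
    proof -
      have "lcomb n (\<Psi> (e k)) (\<lambda>j k. B k j) i = \<sigma> (e k i)" if k: "k < n" for k
        using BA[OF i k] k by (simp add: lcomb_def mm_def A_def E_def mult.commute)
      then have "lcomb n (\<Psi> z) (\<lambda>j k. B k j) i = lcomb n (\<sigma> \<circ> z) (\<lambda>k. \<sigma> \<circ> e k) i"
        unfolding \<Psi>_coord[OF z] lcomb_lcomb by (simp add: lcomb_def o_apply)
      also have "\<dots> = (\<sigma> \<circ> z) i" using comp_lcomb[OF hom, of n z e] dD(3)[OF z] by simp
      finally show ?thesis .
    qed
    then have "g (\<Psi> z) = lcomb n (\<sigma> \<circ> z) (\<lambda>k. \<chi> (e k))" unfolding g_def by (intro lcomb_cong) auto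
    then show ?thesis using dbasis_lin_on[OF db \<chi> hom z] by simp
  qed
  ultimately show ?thesis by blast
qed

end

section \<open>Windows, the map \<open>V\<^sup>\<sharp>\<close> and nilpotence in coordinates\<close>

context wframe
begin

lemma windowD:
  assumes "window I \<sigma> \<sigma>1 W"
  shows "wQ W \<subseteq> wP W" "x \<in> wP W \<Longrightarrow> wF W x \<in> wP W" "lin_on \<sigma> (wP W) (wF W)"
    "x \<in> wQ W \<Longrightarrow> wF1 W x \<in> wP W" "lin_on \<sigma> (wQ W) (wF1 W)"
    "a \<in> I \<Longrightarrow> x \<in> wP W \<Longrightarrow> wF1 W (sc a x) = sc (\<sigma>1 a) (wF W x)"
    "mspan (wF1 W ` wQ W) = wP W"
  using assms by (auto simp: window_def)

text \<open>\<open>Q\<close> is recorded as \<open>L + (T \<inter> I^n)\<close>, which by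
  \<open>imult_iff\<close> is the same as \<open>L + I T\<close>.\<close>

definition normal_decomposition where
  "normal_decomposition W n e pL pT L T \<longleftrightarrow> dbasis n e (wP W) \<and>
    lin_on id (wP W) pL \<and> lin_on id (wP W) pT \<and>
    (\<forall>x\<in>wP W. pL x \<in> L \<and> pT x \<in> T \<and> x = pL x + pT x) \<and>
    (\<forall>x\<in>L. pL x = x \<and> pT x = 0) \<and> (\<forall>x\<in>T. pL x = 0 \<and> pT x = x) \<and>
    L \<subseteq> wP W \<and> T \<subseteq> wP W \<and> dbasis n (\<lambda>j. pL (e j)) L \<and> dbasis n (\<lambda>j. pT (e j)) T \<and>
    (\<forall>x. x \<in> wQ W \<longleftrightarrow> (\<exists>l t. x = l + t \<and> l \<in> L \<and> t \<in> T \<and> (\<forall>i. t i \<in> I))) \<and> dsum (wP W) L T"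

lemma normal_decomposition_exists:
  assumes "window I \<sigma> \<sigma>1 W"
  shows "\<exists>n e pL pT L T. normal_decomposition W n e pL pT L T"
proof -
  obtain L T where LT: "submod L" "submod T" "dsum (wP W) L T"
      "wQ W = {l + t | l t. l \<in> L \<and> t \<in> imult I T}" and "fg_proj (wP W)"
    using assms unfolding window_def by blast
  then obtain n e where db: "dbasis n e (wP W)" using fg_proj_imp_dbasis by blast
  obtain pL pT where *: "lin_on id (wP W) pL" "lin_on id (wP W) pT"
    "\<forall>x\<in>wP W. pL x \<in> L \<and> pT x \<in> T \<and> x = pL x + pT x"
    "\<forall>x\<in>L. pL x = x \<and> pT x = 0" "\<forall>x\<in>T. pL x = 0 \<and> pT x = x"
    "L \<subseteq> wP W" "T \<subseteq> wP W" "dbasis n (\<lambda>j. pL (e j)) L" "dbasis n (\<lambda>j. pT (e j)) T"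
    using dbasis_summand[OF db LT(1-3)] by blast
  have Q: "\<forall>x. x \<in> wQ W \<longleftrightarrow> (\<exists>l t. x = l + t \<and> l \<in> L \<and> t \<in> T \<and> (\<forall>i. t i \<in> I))"
    unfolding LT(4) using imult_iff[OF *(9) ideal_I] by auto
  show ?thesis unfolding normal_decomposition_def using db * Q LT(3) by blast
qed

lemma normal_decompositionD:
  assumes "normal_decomposition W n e pL pT L T"
  shows "dbasis n e (wP W)" "lin_on id (wP W) pL" "lin_on id (wP W) pT"
    "\<And>x. x \<in> wP W \<Longrightarrow> pL x \<in> L \<and> pT x \<in> T \<and> x = pL x + pT x"
    "\<And>x. x \<in> L \<Longrightarrow> pL x = x \<and> pT x = 0" "\<And>x. x \<in> T \<Longrightarrow> pL x = 0 \<and> pT x = x"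
    "L \<subseteq> wP W" "T \<subseteq> wP W" "dbasis n (\<lambda>j. pL (e j)) L" "dbasis n (\<lambda>j. pT (e j)) T"
    "\<And>x. x \<in> wQ W \<longleftrightarrow> (\<exists>l t. x = l + t \<and> l \<in> L \<and> t \<in> T \<and> (\<forall>i. t i \<in> I))"
    "dsum (wP W) L T"
  using assms unfolding normal_decomposition_def by auto

lemma window_dbasis: "window I \<sigma> \<sigma>1 W \<Longrightarrow> \<exists>n e. dbasis n e (wP W)"
  unfolding window_def using fg_proj_imp_dbasis by blast

lemma submod_wP: "window I \<sigma> \<sigma>1 W \<Longrightarrow> submod (wP W)"
  using window_dbasis dbasisD(1) by blast

lemma submod_wQ:
  assumes "window I \<sigma> \<sigma>1 W"
  shows "submod (wQ W)"
proof -
  obtain L T where LT: "submod L" "submod T"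
      "wQ W = {l + t | l t. l \<in> L \<and> t \<in> imult I T}"
    using assms unfolding window_def by blast
  have T: "submod (imult I T)" unfolding imult_def by (rule submod_mspan)
  note L = submodD[OF LT(1)] and T = submodD[OF T]
  show ?thesis
    unfolding submod_def LT(3)
  proof (intro conjI ballI allI)
    show "0 \<in> {l + t |l t. l \<in> L \<and> t \<in> imult I T}"
      using L(1) T(1) by (intro CollectI exI[of _ 0]) simp
    fix x y a
    assume x: "x \<in> {l + t |l t. l \<in> L \<and> t \<in> imult I T}"
    then obtain l t where lt: "x = l + t" "l \<in> L" "t \<in> imult I T" by blast
    have "sc a x = sc a l + sc a t" unfolding lt(1) by (rule sc_add)
    then show "sc a x \<in> {l + t |l t. l \<in> L \<and> t \<in> imult I T}" using L(3) T(3) lt by blast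
    assume "y \<in> {l + t |l t. l \<in> L \<and> t \<in> imult I T}"
    then obtain l' t' where lt': "y = l' + t'" "l' \<in> L" "t' \<in> imult I T" by blast
    have "x + y = (l + l') + (t + t')" unfolding lt(1) lt'(1) by (simp add: algebra_simps)
    then show "x + y \<in> {l + t |l t. l \<in> L \<and> t \<in> imult I T}" using L(2) T(2) lt lt' by blast
  qed
qed

text \<open>The inclusion \<open>I P \<subseteq> Q\<close>: the projection to \<open>T\<close> is
  linear and keeps coordinates in \<open>I\<close>, while the \<open>L\<close>-part is
  unrestricted.\<close>

lemma I_wP_subset_wQ:
  assumes "window I \<sigma> \<sigma>1 W" "x \<in> wP W" "\<And>i. x i \<in> I"
  shows "x \<in> wQ W"
proof -
  obtain n e pL pT L T where nd: "normal_decomposition W n e pL pT L T"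
    using normal_decomposition_exists[OF assms(1)] by blast
  note db = normal_decompositionD(1)[OF nd] and lin = normal_decompositionD(2,3)[OF nd]
    and p = normal_decompositionD(4)[OF nd] and pL = normal_decompositionD(5)[OF nd]
    and pT = normal_decompositionD(6)[OF nd] and sub = normal_decompositionD(7,8)[OF nd]
    and dbT = normal_decompositionD(10)[OF nd] and Q = normal_decompositionD(11)[OF nd]
  have "pT x i \<in> I" for i
    by (rule lin_on_coords_in[OF db lin(2) ring_hom'_id assms(2) ideal_I]) (simp add: assms(3))
  then show ?thesis unfolding Q using p[OF assms(2)] by blast
qed

lemma sc_I_wQ: "window I \<sigma> \<sigma>1 W \<Longrightarrow> a \<in> I \<Longrightarrow> x \<in> wP W \<Longrightarrow> sc a x \<in> wQ W"
  using I_wP_subset_wQ submodD(3)[OF submod_wP] is_idealD(4)[OF ideal_I] by (simp add: sc_apply)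

text \<open>On combinations with coefficients in \<open>I\<close> the map \<open>\<phi>\<close> is
  computed from its companion \<open>\<phi>F\<close>. The vectors need only lie in
  \<open>P\<close>.\<close>

lemma \<sigma>1_lcomb:
  assumes W: "window I \<sigma> \<sigma>1 W" and \<phi>: "lin_on \<sigma> (wQ W) \<phi>"
    and \<phi>F: "\<And>a x. a \<in> I \<Longrightarrow> x \<in> wP W \<Longrightarrow> \<phi> (sc a x) = sc (\<sigma>1 a) (\<phi>F x)"
    and v: "\<And>j. j < m \<Longrightarrow> v j \<in> wP W" "\<And>j. j < m \<Longrightarrow> c j \<in> I"
  shows "\<phi> (lcomb m c v) = lcomb m (\<sigma>1 \<circ> c) (\<lambda>j. \<phi>F (v j))"
  by (rule additive_lcomb[OF \<phi> submod_wQ[OF W] hom]) (use v \<phi>F sc_I_wQ[OF W] in \<open>auto simp: o_apply\<close>)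

lemma wF1_coords:
  assumes "window I \<sigma> \<sigma>1 W" "dbasis n e (wP W)" "x \<in> wP W" "\<And>i. x i \<in> I"
  shows "wF1 W x = lcomb n (\<sigma>1 \<circ> x) (\<lambda>j. wF W (e j))"
proof -
  have "wF1 W (lcomb n x e) = lcomb n (\<sigma>1 \<circ> x) (\<lambda>j. wF W (e j))"
    by (rule \<sigma>1_lcomb[OF assms(1) windowD(5)[OF assms(1)] windowD(6)[OF assms(1)]])
      (use assms dbasisD(2)[OF assms(2)] in auto)
  then show ?thesis using dbasisD(3)[OF assms(2,3)] by simp
qed

text \<open>For \<open>x\<close> in \<open>Q\<close> and \<open>a\<close> in \<open>I\<close>,
  evaluating \<open>F\<^sub>1\<close> at \<open>a x\<close> by either rule gives \<open>\<sigma>1(a)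
  F(x) = \<sigma>(a) F\<^sub>1(x) = \<sigma>1(a) \<theta> F\<^sub>1(x)\<close>; the factor
  \<open>\<sigma>1(a)\<close> cancels.\<close>

lemma wF_on_wQ:
  assumes W: "window I \<sigma> \<sigma>1 W" and x: "x \<in> wQ W"
  shows "wF W x = sc \<theta> (wF1 W x)"
proof (rule \<sigma>1_cancel)
  fix a assume a: "a \<in> I"
  have "sc (\<sigma>1 a) (wF W x) = wF1 W (sc a x)" using windowD(1,6)[OF W] a x by auto
  also have "\<dots> = sc (\<sigma> a) (wF1 W x)" using lin_onD(2)[OF windowD(5)[OF W] submod_wQ[OF W] hom x] .
  also have "\<dots> = sc (\<sigma>1 a) (sc \<theta> (wF1 W x))" using \<theta>[OF a] by (simp add: mult.commute)
  finally show "sc (\<sigma>1 a) (wF W x) = sc (\<sigma>1 a) (sc \<theta> (wF1 W x))" .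
qed

text \<open>The source of all linear maps out of a window: \<open>V\<^sup>\<sharp>\<close> arises
  for \<open>N = P^(\<sigma>)\<close>, and the operator on lifts for \<open>N\<close> the target
  module. The compatibility of \<open>\<phi>\<close> with \<open>\<phi>F\<close> is the one that
  \<open>F\<^sub>1\<close> has with \<open>F\<close>.\<close>

lemma window_universal:
  assumes W: "window I \<sigma> \<sigma>1 W" and \<phi>: "lin_on \<sigma> (wQ W) \<phi>" and \<phi>F: "lin_on \<sigma> (wP W) \<phi>F"
    and comp: "\<And>a x. a \<in> I \<Longrightarrow> x \<in> wP W \<Longrightarrow> \<phi> (sc a x) = sc (\<sigma>1 a) (\<phi>F x)"
    and N: "submod N" "\<And>x. x \<in> wQ W \<Longrightarrow> \<phi> x \<in> N" "\<And>x. x \<in> wP W \<Longrightarrow> \<phi>F x \<in> N"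
  shows "\<exists>g. lin_on id (wP W) g \<and> (\<forall>x\<in>wP W. g x \<in> N) \<and>
    (\<forall>x\<in>wQ W. g (wF1 W x) = \<phi> x) \<and> (\<forall>x\<in>wP W. g (wF W x) = \<phi>F x)"
proof -
  obtain n e pL pT L T where nd: "normal_decomposition W n e pL pT L T"
    using normal_decomposition_exists[OF W] by blast
  note db = normal_decompositionD(1)[OF nd] and lin = normal_decompositionD(2,3)[OF nd]
    and p = normal_decompositionD(4)[OF nd] and pL = normal_decompositionD(5)[OF nd]
    and pT = normal_decompositionD(6)[OF nd] and sub = normal_decompositionD(7,8)[OF nd]
    and dbT = normal_decompositionD(10)[OF nd] and Q = normal_decompositionD(11)[OF nd]
  note subP = submod_wP[OF W] and subQ = submod_wQ[OF W]
  have LQ: "x \<in> wQ W" if "x \<in> L" for x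
    unfolding Q using that dbasisD(8)[OF dbT] is_idealD(1)[OF ideal_I]
    by (intro exI[of _ x] exI[of _ 0]) (simp add: zero_fun_apply)
  have TQ: "x \<in> wQ W" if "x \<in> T" "\<And>i. x i \<in> I" for x
    by (rule I_wP_subset_wQ[OF W]) (use that sub in auto)
  \<comment> \<open>\<open>F\<^sub>1\<close> is not defined on all of \<open>P\<close> and the image
    of \<open>F\<close> alone need not generate. Using the former on \<open>L\<close> and the latter
    on \<open>T\<close> gives one \<open>\<sigma>\<close>-linear map on \<open>P\<close>.\<close>
  define glue where "glue = (\<lambda>(f1 :: (nat \<Rightarrow> 'a) \<Rightarrow> nat \<Rightarrow> 'a) f x. f1 (pL x) + f (pT x))"
  have glue_lin: "lin_on \<sigma> (wP W) (glue f1 f)" if "lin_on \<sigma> (wQ W) f1" "lin_on \<sigma> (wP W) f" for f1 f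
    unfolding glue_def
    using lin_on_plus[OF lin_on_compose[OF lin(1) that(1)] lin_on_compose[OF lin(2) that(2)]] p LQ sub
    by auto
  have glue_L: "glue f1 f x = f1 x" if "x \<in> L" "lin_on \<sigma> (wP W) f" for f1 f x
    unfolding glue_def using pL[OF that(1)] lin_onD(3)[OF that(2) subP hom] by simp
  have glue_T: "glue f1 f x = f x" if "x \<in> T" "lin_on \<sigma> (wQ W) f1" for f1 f x
    unfolding glue_def using pT[OF that(1)] lin_onD(3)[OF that(2) subQ hom] by simp
  define \<Psi> where "\<Psi> = glue (wF1 W) (wF W)"
  define \<chi> where "\<chi> = glue \<phi> \<phi>F"
  note F = windowD(3)[OF W] and F1 = windowD(5)[OF W]
  have T_coords: "lcomb n t (\<lambda>j. pT (e j)) = t" if "t \<in> T" for t using dbasisD(3)[OF dbT that] .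
  have eT: "pT (e j) \<in> T" "pT (e j) \<in> wP W" if "j < n" for j
    using dbasisD(2)[OF dbT that] sub by auto
  have F1_T: "wF1 W t = lcomb n (\<sigma>1 \<circ> t) (\<lambda>j. wF W (pT (e j)))" if "t \<in> T" "\<And>i. t i \<in> I" for t
    using \<sigma>1_lcomb[OF W F1 windowD(6)[OF W], of n "\<lambda>j. pT (e j)" t] eT that T_coords by simp
  have \<phi>_T: "\<phi> t = lcomb n (\<sigma>1 \<circ> t) (\<lambda>j. \<phi>F (pT (e j)))" if "t \<in> T" "\<And>i. t i \<in> I" for t
    using \<sigma>1_lcomb[OF W \<phi> comp, of n "\<lambda>j. pT (e j)" t] eT that T_coords by simp
  have \<Psi>P: "\<Psi> x \<in> wP W" if "x \<in> wP W" for x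
    unfolding \<Psi>_def glue_def using p[OF that] LQ sub windowD(2,4)[OF W] by (auto intro!: submodD(2)[OF subP])
  \<comment> \<open>The part of \<open>x\<close> in \<open>I T\<close> contributes nothing new: its
    image is a combination of the values of \<open>F\<close> on \<open>T\<close>.\<close>
  have "wF1 W x \<in> mspan (\<Psi> ` wP W)" if xQ: "x \<in> wQ W" for x
  proof -
    obtain l t where x: "x = l + t" "l \<in> L" "t \<in> T" "\<And>i. t i \<in> I" using xQ unfolding Q by blast
    have "wF1 W x = wF1 W l + wF1 W t"
      unfolding x(1) by (rule lin_onD(1)[OF F1 subQ hom]) (use LQ TQ x in auto)
    moreover have "wF1 W l \<in> mspan (\<Psi> ` wP W)"
      using glue_L[OF x(2) F, of "wF1 W"] mspan_superset[of "\<Psi> ` wP W"] x(2) sub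
      by (metis \<Psi>_def imageI subsetD)
    moreover have "wF1 W t \<in> mspan (\<Psi> ` wP W)"
      unfolding F1_T[OF x(3,4)]
    proof (rule submod_lcomb[OF submod_mspan])
      fix j assume "j < n"
      then show "wF W (pT (e j)) \<in> mspan (\<Psi> ` wP W)"
        using glue_T[OF eT(1) F1, of j "wF W"] mspan_superset[of "\<Psi> ` wP W"] eT(2)
        by (metis \<Psi>_def imageI subsetD)
    qed
    ultimately show ?thesis by (simp add: submodD(2)[OF submod_mspan])
  qed
  then have gen: "wP W \<subseteq> mspan (\<Psi> ` wP W)"
    using mspan_subset[OF _ submod_mspan, of "wF1 W ` wQ W" "\<Psi> ` wP W"] windowD(7)[OF W] by blast
  have "\<exists>g. lin_on id (wP W) g \<and> (\<forall>x\<in>wP W. g x \<in> N) \<and> (\<forall>x\<in>wP W. g (\<Psi> x) = \<chi> x)"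
  proof (rule factor_through_generating[OF db _ \<Psi>P gen _ N(1)])
    show "lin_on \<sigma> (wP W) \<Psi>" "lin_on \<sigma> (wP W) \<chi>" unfolding \<Psi>_def \<chi>_def using glue_lin F F1 \<phi> \<phi>F by auto
    show "\<chi> x \<in> N" if "x \<in> wP W" for x
      unfolding \<chi>_def glue_def using p[OF that] LQ sub N(2,3) by (auto intro!: submodD(2)[OF N(1)])
  qed
  then obtain g where g: "lin_on id (wP W) g" "\<forall>x\<in>wP W. g x \<in> N" "\<And>x. x \<in> wP W \<Longrightarrow> g (\<Psi> x) = \<chi> x"
    by blast
  note gD = lin_onD[OF g(1) subP ring_hom'_id]
  have gL: "g (wF1 W l) = \<phi> l" if "l \<in> L" for l
    using g(3)[of l] glue_L[OF that F, of "wF1 W"] glue_L[OF that \<phi>F, of \<phi>] that sub by (auto simp: \<Psi>_def \<chi>_def)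
  have gT: "g (wF W t) = \<phi>F t" if "t \<in> T" for t
    using g(3)[of t] glue_T[OF that F1, of "wF W"] glue_T[OF that \<phi>, of \<phi>F] that sub by (auto simp: \<Psi>_def \<chi>_def)
  have gF1: "g (wF1 W x) = \<phi> x" if xQ: "x \<in> wQ W" for x
  proof -
    obtain l t where x: "x = l + t" "l \<in> L" "t \<in> T" "\<And>i. t i \<in> I" using xQ unfolding Q by blast
    have lt: "l \<in> wQ W" "t \<in> wQ W" using LQ TQ x by auto
    have "g (wF1 W x) = g (wF1 W l) + g (wF1 W t)"
      unfolding x(1) lin_onD(1)[OF F1 subQ hom lt] using gD(1) windowD(4)[OF W] lt by auto
    also have "g (wF1 W t) = lcomb n (\<sigma>1 \<circ> t) (\<lambda>j. g (wF W (pT (e j))))"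
      unfolding F1_T[OF x(3,4)] by (subst gD(6)) (use eT windowD(2)[OF W] in auto)
    also have "\<dots> = \<phi> t" unfolding \<phi>_T[OF x(3,4)] by (rule lcomb_cong) (use gT eT in auto)
    also have "g (wF1 W l) + \<phi> t = \<phi> x"
      unfolding x(1) gL[OF x(2)] lin_onD(1)[OF \<phi> subQ hom lt] ..
    finally show ?thesis .
  qed
  \<comment> \<open>After multiplication by \<open>\<sigma>1 a\<close> this is the identity for
    \<open>F\<^sub>1\<close> at \<open>a x\<close>, an element of \<open>Q\<close>.\<close>
  moreover have "g (wF W x) = \<phi>F x" if x: "x \<in> wP W" for x
  proof (rule \<sigma>1_cancel)
    fix a assume a: "a \<in> I"
    have "sc (\<sigma>1 a) (g (wF W x)) = g (wF1 W (sc a x))"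
      unfolding windowD(6)[OF W a x] using gD(2)[OF windowD(2)[OF W x]] by simp
    also have "\<dots> = sc (\<sigma>1 a) (\<phi>F x)" using gF1[OF sc_I_wQ[OF W a x]] comp[OF a x] by simp
    finally show "sc (\<sigma>1 a) (g (wF W x)) = sc (\<sigma>1 a) (\<phi>F x)" .
  qed
  ultimately show ?thesis using g by blast
qed

text \<open>Universality is applied to \<open>x \<mapsto> 1 \<otimes> x\<close> on \<open>Q\<close>.
  The companion on \<open>P\<close> is \<open>\<theta> \<otimes> x\<close>, compatible because
  \<open>\<sigma>(a) = \<theta> \<sigma>1(a)\<close>.\<close>

lemma Vsharp_exists:
  assumes W: "window I \<sigma> \<sigma>1 W"
  shows "\<exists>V. is_Vsharp \<sigma> W V"
proof -
  have "\<exists>g. lin_on id (wP W) g \<and> (\<forall>x\<in>wP W. g x \<in> bchg \<sigma> (wP W)) \<and>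
    (\<forall>x\<in>wQ W. g (wF1 W x) = \<sigma> \<circ> x) \<and> (\<forall>x\<in>wP W. g (wF W x) = sc \<theta> (\<sigma> \<circ> x))"
  proof (rule window_universal[OF W lin_on_comp_hom[OF hom] lin_on_sc[OF lin_on_comp_hom[OF hom]] _ submod_bchg])
    show "\<sigma> \<circ> sc a x = sc (\<sigma>1 a) (sc \<theta> (\<sigma> \<circ> x))" if "a \<in> I" for a x
      using \<theta>[OF that] by (simp add: comp_sc[OF hom] mult.commute)
  qed (use windowD(1)[OF W] in \<open>auto intro!: bchg_gen submodD(3)[OF submod_bchg]\<close>)
  then show ?thesis unfolding is_Vsharp_def by blast
qed

end

text \<open>If \<open>v j = V\<^sup>\<sharp>(e j)\<close> for a coordinate dual basis \<open>e\<close> of \<open>P\<close>, then \<open>vpow \<sigma> n v k x = (V\<^sup>\<sharp>)\<^sup>k x\<close>.\<close>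

primrec vpow :: "('a::comm_ring_1 \<Rightarrow> 'a) \<Rightarrow> nat \<Rightarrow> (nat \<Rightarrow> nat \<Rightarrow> 'a) \<Rightarrow> nat \<Rightarrow> (nat \<Rightarrow> 'a) \<Rightarrow> nat \<Rightarrow> 'a" where
  "vpow \<sigma> n v 0 x = x"
| "vpow \<sigma> n v (Suc k) x = lcomb n (vpow \<sigma> n v k x) (\<lambda>j. (\<sigma> ^^ k) \<circ> v j)"

lemma comp_bchg:
  assumes "y \<in> bchg \<sigma> P" "ring_hom' \<beta>"
  shows "\<beta> \<circ> y \<in> bchg (\<beta> \<circ> \<sigma>) P"
proof -
  obtain k c w where w: "\<forall>i<k. w i \<in> (\<lambda>v. \<sigma> \<circ> v) ` P" "y = lcomb k c w"
    using assms(1) unfolding bchg_def mspan_iff by blast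
  show ?thesis
    unfolding w(2) comp_lcomb[OF assms(2)]
  proof (rule submod_lcomb[OF submod_bchg])
    fix j assume "j < k"
    then obtain x where "x \<in> P" "w j = \<sigma> \<circ> x" using w(1) by auto
    then show "\<beta> \<circ> w j \<in> bchg (\<beta> \<circ> \<sigma>) P" using bchg_gen[of x P "\<beta> \<circ> \<sigma>"] by (simp add: comp_assoc)
  qed
qed

lemma vpow_in_bchg:
  fixes \<sigma> :: "'a::comm_ring_1 \<Rightarrow> 'a"
  assumes "ring_hom' \<sigma>" "\<And>j. j < n \<Longrightarrow> v j \<in> bchg \<sigma> P" "x \<in> P"
  shows "vpow \<sigma> n v k x \<in> bchg (\<sigma> ^^ k) P"
proof (cases k)
  case 0
  then show ?thesis using bchg_gen[OF assms(3), of id] by simp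
next
  case (Suc k)
  have *: "(\<sigma> ^^ k) \<circ> v j \<in> bchg (\<sigma> ^^ Suc k) P" if "j < n" for j
    unfolding funpow_Suc_right by (rule comp_bchg[OF assms(2)[OF that] ring_hom'_funpow[OF assms(1)]])
  show ?thesis unfolding Suc vpow.simps by (rule submod_lcomb[OF submod_bchg *])
qed

lemma itcomp_eq_vpow:
  fixes \<sigma> :: "'a::comm_ring_1 \<Rightarrow> 'a"
  assumes db: "dbasis n e P" and hom: "ring_hom' \<sigma>" and V: "\<And>x. x \<in> P \<Longrightarrow> V x \<in> bchg \<sigma> P"
    and fs: "\<And>k. lin_on id (bchg (\<sigma> ^^ k) P) (fs k)" "\<And>k x. x \<in> P \<Longrightarrow> fs k ((\<sigma> ^^ k) \<circ> x) = (\<sigma> ^^ k) \<circ> V x"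
    and x: "x \<in> P"
  shows "itcomp fs k x = vpow \<sigma> n (\<lambda>j. V (e j)) k x"
proof (induction k)
  case (Suc k)
  let ?y = "vpow \<sigma> n (\<lambda>j. V (e j)) k x"
  have y: "?y \<in> bchg (\<sigma> ^^ k) P" by (rule vpow_in_bchg[OF hom _ x]) (use V dbasisD(2)[OF db] in auto)
  have "fs k ?y = lcomb n ?y (\<lambda>j. fs k ((\<sigma> ^^ k) \<circ> e j))"
    using dbasis_lin_on[OF dbasis_bchg[OF db ring_hom'_funpow[OF hom]] fs(1) ring_hom'_id y] by simp
  also have "\<dots> = vpow \<sigma> n (\<lambda>j. V (e j)) (Suc k) x"
    by (auto intro!: lcomb_cong fs(2) dbasisD(2)[OF db])
  finally show ?case using Suc by (simp add: o_apply)
qed simp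

text \<open>The family \<open>fs\<close> carries no choice that matters: linearity and its values on
  the generators \<open>1 \<otimes> x\<close> determine it on each twist of \<open>P\<close>.
  Membership in \<open>J P^(\<sigma>^k)\<close> is a condition on coordinates.\<close>

lemma nilpotent_win_iff:
  assumes db: "dbasis n e (wP W)" and hom: "ring_hom' \<sigma>" and J: "is_ideal J"
  shows "nilpotent_win \<sigma> J W \<longleftrightarrow>
    (\<exists>V N. is_Vsharp \<sigma> W V \<and> (\<forall>k\<ge>N. \<forall>x\<in>wP W. \<forall>i. vpow \<sigma> n (\<lambda>j. V (e j)) k x i \<in> J))"
proof -
  let ?P = "wP W"
  have *: "itcomp fs k x \<in> imult J (bchg (\<sigma> ^^ k) ?P) \<longleftrightarrow> (\<forall>i. vpow \<sigma> n (\<lambda>j. V (e j)) k x i \<in> J)"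
    if V: "is_Vsharp \<sigma> W V" and fs: "\<forall>k. lin_on id (bchg (\<sigma> ^^ k) ?P) (fs k) \<and>
             (\<forall>x\<in>?P. fs k ((\<sigma> ^^ k) \<circ> x) = (\<sigma> ^^ k) \<circ> V x)" and x: "x \<in> ?P" for V fs k x
  proof -
    have V': "\<And>x. x \<in> ?P \<Longrightarrow> V x \<in> bchg \<sigma> ?P" using V by (auto simp: is_Vsharp_def)
    have "itcomp fs k x = vpow \<sigma> n (\<lambda>j. V (e j)) k x"
      by (rule itcomp_eq_vpow[OF db hom V' _ _ x]) (use fs in auto)
    moreover have "vpow \<sigma> n (\<lambda>j. V (e j)) k x \<in> bchg (\<sigma> ^^ k) ?P"
      by (rule vpow_in_bchg[OF hom _ x]) (use V' dbasisD(2)[OF db] in auto)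
    ultimately show ?thesis using imult_iff[OF dbasis_bchg[OF db ring_hom'_funpow[OF hom]] J] by simp
  qed
  show ?thesis
  proof
    assume "nilpotent_win \<sigma> J W"
    then obtain V fs N where 1: "is_Vsharp \<sigma> W V" and 2: "\<forall>k. lin_on id (bchg (\<sigma> ^^ k) ?P) (fs k) \<and>
             (\<forall>x\<in>?P. fs k ((\<sigma> ^^ k) \<circ> x) = (\<sigma> ^^ k) \<circ> V x)"
      and 3: "\<forall>k\<ge>N. \<forall>x\<in>?P. itcomp fs k x \<in> imult J (bchg (\<sigma> ^^ k) ?P)"
      unfolding nilpotent_win_def by blast
    show "\<exists>V N. is_Vsharp \<sigma> W V \<and> (\<forall>k\<ge>N. \<forall>x\<in>wP W. \<forall>i. vpow \<sigma> n (\<lambda>j. V (e j)) k x i \<in> J)"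
      using 1 3 *[OF 1 2] by blast
  next
    assume "\<exists>V N. is_Vsharp \<sigma> W V \<and> (\<forall>k\<ge>N. \<forall>x\<in>wP W. \<forall>i. vpow \<sigma> n (\<lambda>j. V (e j)) k x i \<in> J)"
    then obtain V N where 1: "is_Vsharp \<sigma> W V"
      and 3: "\<forall>k\<ge>N. \<forall>x\<in>?P. \<forall>i. vpow \<sigma> n (\<lambda>j. V (e j)) k x i \<in> J" by blast
    \<comment> \<open>Linear extension from the dual basis vectors
      \<open>(\<sigma> ^^ k) \<circ> e j\<close>.\<close>
    define fs where "fs = (\<lambda>k y. lcomb n y (\<lambda>j. (\<sigma> ^^ k) \<circ> V (e j)))"
    have lin: "lin_on id ?P V" using 1 by (simp add: is_Vsharp_def)
    have 2: "\<forall>k. lin_on id (bchg (\<sigma> ^^ k) ?P) (fs k) \<and> (\<forall>x\<in>?P. fs k ((\<sigma> ^^ k) \<circ> x) = (\<sigma> ^^ k) \<circ> V x)"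
    proof (intro allI conjI ballI)
      fix k
      show "lin_on id (bchg (\<sigma> ^^ k) ?P) (fs k)" unfolding fs_def by (rule lin_on_id_lcomb)
      fix x assume x: "x \<in> ?P"
      have "V x = lcomb n x (\<lambda>j. V (e j))" using dbasis_lin_on[OF db lin ring_hom'_id x] by simp
      then show "fs k ((\<sigma> ^^ k) \<circ> x) = (\<sigma> ^^ k) \<circ> V x"
        unfolding fs_def by (simp add: comp_lcomb[OF ring_hom'_funpow[OF hom]])
    qed
    show "nilpotent_win \<sigma> J W"
      unfolding nilpotent_win_def using 1 2 3 *[OF 1 2] by blast
  qed
qed

text \<open>The composition law: \<open>K + N\<close> steps are \<open>K\<close> steps followed by
  the \<open>\<sigma>^K\<close>-twist of \<open>N\<close> steps.\<close>

lemma vpow_add: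
  fixes \<sigma> :: "'a::comm_ring_1 \<Rightarrow> 'a"
  assumes db: "dbasis n e P" and hom: "ring_hom' \<sigma>" and v: "\<And>j. j < n \<Longrightarrow> v j \<in> bchg \<sigma> P" and x: "x \<in> P"
  shows "vpow \<sigma> n v (K + N) x = lcomb n (vpow \<sigma> n v K x) (\<lambda>j. (\<sigma> ^^ K) \<circ> vpow \<sigma> n v N (e j))"
proof (induction N)
  case 0
  have "vpow \<sigma> n v K x \<in> bchg (\<sigma> ^^ K) P" by (rule vpow_in_bchg[OF hom v x])
  from dbasisD(3)[OF dbasis_bchg[OF db ring_hom'_funpow[OF hom]] this] show ?case by simp
next
  case (Suc N)
  have "vpow \<sigma> n v (K + Suc N) x =
      lcomb n (vpow \<sigma> n v K x) (\<lambda>j. lcomb n ((\<sigma> ^^ K) \<circ> vpow \<sigma> n v N (e j)) (\<lambda>i. (\<sigma> ^^ (K + N)) \<circ> v i))"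
    by (simp add: Suc lcomb_lcomb)
  also have "\<dots> = lcomb n (vpow \<sigma> n v K x) (\<lambda>j. (\<sigma> ^^ K) \<circ> vpow \<sigma> n v (Suc N) (e j))"
    by (simp add: comp_lcomb[OF ring_hom'_funpow[OF hom]] funpow_add comp_assoc)
  finally show ?case .
qed

text \<open>The ideal power \<open>J^m\<close>; taking the intersection of all ideals that contain
  the products makes it an ideal by construction.\<close>

primrec ipow :: "'a::comm_ring_1 set \<Rightarrow> nat \<Rightarrow> 'a set" where
  "ipow J 0 = UNIV"
| "ipow J (Suc m) = \<Inter>{A. is_ideal A \<and> (\<forall>j\<in>J. \<forall>x\<in>ipow J m. x * j \<in> A)}"

lemma is_ideal_ipow: "is_ideal (ipow J m)"
  by (cases m) (auto simp: is_ideal_def)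

lemma ipow_mult: "x \<in> ipow J m \<Longrightarrow> j \<in> J \<Longrightarrow> x * j \<in> ipow J (Suc m)"
  by auto

text \<open>The hypothesis speaks of products of \<open>m\<close> elements only. Annihilating a
  fixed element is an ideal condition, so it passes from products to the ideals they
  generate.\<close>

lemma ipow_annihilates:
  assumes "\<And>js. (\<forall>i<m. js i \<in> J) \<Longrightarrow> (\<Prod>i<m. js i) * a = 0" and "s \<in> ipow J m"
  shows "s * a = 0"
proof -
  \<comment> \<open>Generalised for the induction: \<open>k\<close> factors are still hidden in the
    ideal power and \<open>r\<close> are explicit, with \<open>k + r = m\<close>. Each step makes
    one more factor explicit.\<close>
  have "s * (\<Prod>i<r. js i) * a = 0" if "k + r = m" "s \<in> ipow J k" "\<forall>i<r. js i \<in> J" for k r s js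
    using that
  proof (induction k arbitrary: r s js)
    case 0
    then show ?case using assms(1)[of js] by (simp add: mult.assoc)
  next
    case (Suc k)
    define A where "A = {s. s * (\<Prod>i<r. js i) * a = 0}"
    have "is_ideal A" unfolding A_def is_ideal_def by (auto simp: distrib_right mult.assoc)
    moreover have "x * j \<in> A" if "j \<in> J" "x \<in> ipow J k" for j x
    proof -
      let ?js = "\<lambda>i. if i < r then js i else j"
      have "x * (\<Prod>i<Suc r. ?js i) * a = 0"
        by (rule Suc.IH) (use Suc.prems that in auto)
      moreover have "(\<Prod>i<Suc r. ?js i) = (\<Prod>i<r. js i) * j" by simp
      ultimately show ?thesis by (simp add: A_def mult.assoc mult.left_commute mult.commute)
    qed
    ultimately have "ipow J (Suc k) \<subseteq> A" by auto
    then show ?case using Suc.prems by (auto simp: A_def)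
  qed
  from this[of m 0 s] show ?thesis using assms(2) by simp
qed

text \<open>By \<open>vpow_add\<close>, every further \<open>N\<close> steps multiply the
  coordinates by \<open>\<sigma>\<close>-twists of elements of \<open>J\<close>, and these remain in
  \<open>J\<close>.\<close>

lemma vpow_ipow:
  fixes \<sigma> :: "'a::comm_ring_1 \<Rightarrow> 'a"
  assumes db: "dbasis n e P" and hom: "ring_hom' \<sigma>" and v: "\<And>j. j < n \<Longrightarrow> v j \<in> bchg \<sigma> P"
    and J: "is_ideal J" "\<sigma> ` J \<subseteq> J" and N: "\<And>x i. x \<in> P \<Longrightarrow> vpow \<sigma> n v N x i \<in> J"
  shows "\<exists>K. \<forall>x\<in>P. \<forall>i. vpow \<sigma> n v K x i \<in> ipow J m"
proof (induction m)
  case (Suc m)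
  then obtain K where K: "\<And>x i. x \<in> P \<Longrightarrow> vpow \<sigma> n v K x i \<in> ipow J m" by blast
  have pow: "(\<sigma> ^^ k) a \<in> J" if "a \<in> J" for k a
    using that J(2) by (induction k) (auto simp: o_apply)
  have "vpow \<sigma> n v (K + N) x i \<in> ipow J (Suc m)" if x: "x \<in> P" for x i
  proof -
    have "vpow \<sigma> n v (K + N) x i = (\<Sum>j<n. vpow \<sigma> n v K x j * (\<sigma> ^^ K) (vpow \<sigma> n v N (e j) i))"
      by (subst vpow_add[OF db hom v x]) (simp_all add: lcomb_def o_apply)
    also have "\<dots> \<in> ipow J (Suc m)"
      by (intro is_ideal_sum[OF is_ideal_ipow] ipow_mult K[OF x] pow N dbasisD(2)[OF db]) simp
    finally show ?thesis .
  qed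
  then show ?case by blast
qed simp

section \<open>Contraction along the iterates of \<open>V\<^sup>\<sharp>\<close>\<close>

context wframe
begin

text \<open>From \<open>\<delta> (Suc k) \<circ> F\<^sub>1 = \<tau> \<circ> \<delta> k\<close> it
  follows that \<open>\<delta> (Suc k)\<close> is the linearisation of
  \<open>\<tau> \<circ> \<delta> k\<close> after \<open>V\<^sup>\<sharp>\<close>. Iterating collects
  all coefficients in \<open>(V\<^sup>\<sharp>)\<^sup>k\<close>, since \<open>\<tau>\<close> twists
  what it passes.\<close>

lemma contraction:
  assumes W: "window I \<sigma> \<sigma>1 W" and db: "dbasis n e (wP W)" and V: "is_Vsharp \<sigma> W V"
    and M: "submod M" "lin_on \<sigma> M \<tau>" "\<And>y. y \<in> M \<Longrightarrow> \<tau> y \<in> M"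
    and \<delta>: "\<And>k. lin_on id (wP W) (\<delta> k)" "\<And>k x. x \<in> wP W \<Longrightarrow> \<delta> k x \<in> M"
      "\<And>k x. x \<in> wQ W \<Longrightarrow> \<delta> (Suc k) (wF1 W x) = \<tau> (\<delta> k x)"
    and x: "x \<in> wP W"
  shows "\<delta> (k + i) x = lcomb n (vpow \<sigma> n (\<lambda>j. V (e j)) k x) (\<lambda>j. (\<tau> ^^ k) (\<delta> i (e j)))"
proof -
  have V': "lin_on id (wP W) V" "\<And>x. x \<in> wQ W \<Longrightarrow> V (wF1 W x) = \<sigma> \<circ> x"
    using V by (auto simp: is_Vsharp_def)
  \<comment> \<open>Both sides are linear, and on the generators \<open>F\<^sub>1 q\<close> they
    agree because \<open>V (F\<^sub>1 q) = \<sigma> \<circ> q\<close>.\<close>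
  have step: "\<delta> (Suc k) x = lcomb n (V x) (\<lambda>l. \<tau> (\<delta> k (e l)))" if x: "x \<in> wP W" for k x
  proof (rule lin_on_eq_on_mspan[OF \<delta>(1) _ submod_wP[OF W] ring_hom'_id])
    show "lin_on id (wP W) (\<lambda>x. lcomb n (V x) (\<lambda>l. \<tau> (\<delta> k (e l))))"
      using lin_on_compose[OF V'(1) lin_on_id_lcomb[of UNIV n]] by simp
    show "x \<in> mspan (wF1 W ` wQ W)" using x windowD(7)[OF W] by simp
    show "wF1 W ` wQ W \<subseteq> wP W" using windowD(4)[OF W] by auto
    fix y assume "y \<in> wF1 W ` wQ W"
    then obtain q where q: "q \<in> wQ W" "y = wF1 W q" by auto
    have "lin_on \<sigma> (wP W) (\<lambda>x. \<tau> (\<delta> k x))" using lin_on_compose[OF \<delta>(1) M(2)] \<delta>(2) by simp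
    then have "\<tau> (\<delta> k q) = lcomb n (\<sigma> \<circ> q) (\<lambda>l. \<tau> (\<delta> k (e l)))"
      using dbasis_lin_on[OF db _ hom] windowD(1)[OF W] q(1) by blast
    then show "\<delta> (Suc k) y = lcomb n (V y) (\<lambda>l. \<tau> (\<delta> k (e l)))"
      using \<delta>(3)[OF q(1)] V'(2)[OF q(1)] q(2) by simp
  qed
  have \<tau>k: "lin_on (\<sigma> ^^ k) M (\<tau> ^^ k) \<and> (\<forall>y\<in>M. (\<tau> ^^ k) y \<in> M)" for k
  proof (induction k)
    case 0
    show ?case by (simp add: lin_on_def)
  next
    case (Suc k)
    then show ?case using lin_on_compose[of "\<sigma> ^^ k" M "\<tau> ^^ k" \<sigma> M \<tau>] M(2,3) by (auto simp: o_def)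
  qed
  show ?thesis
  proof (induction k arbitrary: i)
    case 0
    show ?case using dbasis_lin_on[OF db \<delta>(1) ring_hom'_id x] by simp
  next
    case (Suc k)
    have "(\<tau> ^^ k) (\<delta> (Suc i) (e j)) = lcomb n ((\<sigma> ^^ k) \<circ> V (e j)) (\<lambda>l. (\<tau> ^^ Suc k) (\<delta> i (e l)))"
      if "j < n" for j
    proof -
      have "e j \<in> wP W" using dbasisD(2)[OF db that] .
      then show ?thesis
        unfolding step[OF \<open>e j \<in> wP W\<close>] using \<tau>k M(3) \<delta>(2) dbasisD(2)[OF db]
        by (subst lin_onD(6)[OF conjunct1[OF \<tau>k] M(1) hom_funpow]) (auto simp: funpow_swap1 o_apply)
    qed
    then have "\<delta> (Suc k + i) x = lcomb n (vpow \<sigma> n (\<lambda>j. V (e j)) k x)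
        (\<lambda>j. lcomb n ((\<sigma> ^^ k) \<circ> V (e j)) (\<lambda>l. (\<tau> ^^ Suc k) (\<delta> i (e l))))"
      using Suc[of "Suc i"] by (auto intro!: lcomb_cong)
    then show ?case by (simp add: lcomb_lcomb)
  qed
qed

end

section \<open>Base change along a surjection of frames\<close>

lemma descend_through:
  assumes "\<And>x y. x \<in> X \<Longrightarrow> y \<in> X \<Longrightarrow> \<iota> x = \<iota> y \<Longrightarrow> \<phi> x = \<phi> y"
  shows "\<exists>\<phi>'. \<forall>x\<in>X. \<phi>' (\<iota> x) = \<phi> x"
proof (intro exI ballI)
  fix x assume "x \<in> X"
  then show "\<phi> (inv_into X \<iota> (\<iota> x)) = \<phi> x"
    using assms inv_into_into[of "\<iota> x" \<iota> X] f_inv_into_f[of "\<iota> x" \<iota> X] by blast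
qed

lemma lin_on_descend:
  assumes "surj \<alpha>" "lin_on \<alpha> X \<iota>" "submod X" "lin_on \<gamma> X \<phi>" "\<And>s. \<gamma> s = \<beta> (\<alpha> s)"
    and "\<And>x. x \<in> X \<Longrightarrow> \<phi>' (\<iota> x) = \<phi> x"
  shows "lin_on \<beta> (\<iota> ` X) \<phi>'"
  unfolding lin_on_def
proof (intro conjI ballI allI)
  fix x' y' s'
  assume "x' \<in> \<iota> ` X"
  then obtain x where x: "x \<in> X" "x' = \<iota> x" by auto
  obtain s where s: "s' = \<alpha> s" using assms(1) by auto
  have "sc s' x' = \<iota> (sc s x)" using assms(2) x s by (simp add: lin_on_def)
  then show "\<phi>' (sc s' x') = sc (\<beta> s') (\<phi>' x')"
    using assms(4,5,6) x s submodD(3)[OF assms(3)] by (simp add: lin_on_def)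
  assume "y' \<in> \<iota> ` X"
  then obtain y where y: "y \<in> X" "y' = \<iota> y" by auto
  have "x' + y' = \<iota> (x + y)" using assms(2) x y by (simp add: lin_on_def)
  then show "\<phi>' (x' + y') = \<phi>' x' + \<phi>' y'"
    using assms(4,6) x y submodD(2)[OF assms(3)] by (simp add: lin_on_def)
qed

lemma submod_image:
  assumes "surj \<alpha>" "lin_on \<alpha> X \<iota>" "submod X" "ring_hom' \<alpha>"
  shows "submod (\<iota> ` X)"
  unfolding submod_def
proof (intro conjI ballI allI)
  show "0 \<in> \<iota> ` X" using lin_onD(3)[OF assms(2,3,4)] submodD(1)[OF assms(3)] by (metis imageI)
  fix x' y' s'
  assume "x' \<in> \<iota> ` X"
  then obtain x where x: "x \<in> X" "x' = \<iota> x" by auto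
  obtain s where s: "s' = \<alpha> s" using assms(1) by auto
  have "sc s' x' = \<iota> (sc s x)" using assms(2) x s by (simp add: lin_on_def)
  then show "sc s' x' \<in> \<iota> ` X" using submodD(3)[OF assms(3)] x by blast
  assume "y' \<in> \<iota> ` X"
  then obtain y where y: "y \<in> X" "y' = \<iota> y" by auto
  have "x' + y' = \<iota> (x + y)" using assms(2) x y by (simp add: lin_on_def)
  then show "x' + y' \<in> \<iota> ` X" using submodD(2)[OF assms(3)] x y by blast
qed

lemma win_morD:
  assumes "win_mor \<alpha> u W W' g"
  shows "x \<in> wP W \<Longrightarrow> g x \<in> wP W'" "lin_on \<alpha> (wP W) g" "x \<in> wQ W \<Longrightarrow> g x \<in> wQ W'"
    "x \<in> wP W \<Longrightarrow> wF W' (g x) = g (wF W x)" "x \<in> wQ W \<Longrightarrow> wF1 W' (g x) = sc u (g (wF1 W x))"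
  using assms by (auto simp: win_mor_def)

text \<open>With \<open>\<aa>\<close> the kernel of \<open>\<alpha>\<close>,
  \<open>I_if_\<alpha>\<close> is injectivity of \<open>R \<rightarrow> R'\<close>,
  \<open>ker_\<sigma>1\<close> is \<open>\<sigma>\<^sub>1(\<aa>) \<subseteq> \<aa>\<close>, and
  \<open>J_power_ker\<close> is \<open>J^m \<aa> = 0\<close> stated on products of elements.\<close>

locale frame_lift = S: wframe p I \<sigma> \<sigma>1 + S': wframe p I' \<sigma>' \<sigma>1'
  for p :: nat and I :: "'a::comm_ring_1 set" and \<sigma> \<sigma>1 :: "'a \<Rightarrow> 'a"
    and I' :: "'b::comm_ring_1 set" and \<sigma>' \<sigma>1' :: "'b \<Rightarrow> 'b" +
  fixes \<alpha> :: "'a \<Rightarrow> 'b" and u :: 'b and J :: "'a set" and m :: nat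
  assumes frame_hom: "frame_hom I \<sigma> \<sigma>1 I' \<sigma>' \<sigma>1' \<alpha> u"
    and I_if_\<alpha>: "\<alpha> s \<in> I' \<Longrightarrow> s \<in> I"
    and surj_\<alpha>: "surj \<alpha>"
    and ker_\<sigma>1: "\<alpha> a = 0 \<Longrightarrow> \<alpha> (\<sigma>1 a) = 0"
    and ideal_of_def_J: "ideal_of_def I \<sigma> \<sigma>1 J"
    and J_power_ker: "(\<And>i. i < m \<Longrightarrow> js i \<in> J) \<Longrightarrow> \<alpha> a = 0 \<Longrightarrow> (\<Prod>i<m. js i) * a = 0"
begin

lemma \<alpha>_hom: "ring_hom' \<alpha>"
  and \<alpha>_I: "a \<in> I \<Longrightarrow> \<alpha> a \<in> I'"
  and \<sigma>'_\<alpha>: "\<sigma>' (\<alpha> s) = \<alpha> (\<sigma> s)"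
  and \<sigma>1'_\<alpha>: "a \<in> I \<Longrightarrow> \<sigma>1' (\<alpha> a) = u * \<alpha> (\<sigma>1 a)"
  using frame_hom by (auto simp: frame_hom_def)

lemmas \<alpha>_simps = ring_hom'_simps[OF \<alpha>_hom]

definition ui :: 'b where "ui = (SOME v. u * v = 1)"

lemma u_ui [simp]: "u * ui = 1" "ui * u = 1"
proof -
  have "\<exists>v. u * v = 1" using frame_hom unfolding frame_hom_def dvd_def by metis
  then show "u * ui = 1" unfolding ui_def by (rule someI_ex)
  then show "ui * u = 1" by (simp add: mult.commute)
qed

lemma \<sigma>'_\<alpha>_funpow: "(\<sigma>' ^^ k) (\<alpha> s) = \<alpha> ((\<sigma> ^^ k) s)"
  by (induction k) (auto simp: o_apply \<sigma>'_\<alpha>)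

lemma \<sigma>'_\<alpha>_vec: "\<sigma>' \<circ> (\<alpha> \<circ> x) = \<alpha> \<circ> (\<sigma> \<circ> x)"
  "(\<sigma>' ^^ k) \<circ> (\<alpha> \<circ> x) = \<alpha> \<circ> ((\<sigma> ^^ k) \<circ> x)"
  by (auto simp: fun_eq_iff o_apply \<sigma>'_\<alpha> \<sigma>'_\<alpha>_funpow)

lemma ker_ideal: "is_ideal {a. \<alpha> a = 0}"
  by (auto simp: is_ideal_def \<alpha>_simps)

lemma ker_I: "\<alpha> a = 0 \<Longrightarrow> a \<in> I"
  using I_if_\<alpha> is_idealD(1)[OF S'.ideal_I] by simp

lemma J_ideal: "is_ideal J"
  and J_\<sigma>: "\<sigma> ` J \<subseteq> J"
  and J_I: "I \<subseteq> J"
  and J_\<theta>: "S.\<theta> \<in> J"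
proof -
  show ideal: "is_ideal J" using ideal_of_def_J by (simp add: ideal_of_def_def)
  have *: "x + y + S.\<theta> * s \<in> J" if "x \<in> \<sigma> ` J" "y \<in> I" for x y s
    using ideal_of_def_J that unfolding ideal_of_def_def by blast
  have z: "0 \<in> \<sigma> ` J" "0 \<in> I"
    using is_idealD(1)[OF ideal] is_idealD(1)[OF S.ideal_I] ring_hom'_simps(4)[OF S.hom] by (metis imageI, simp)
  show "\<sigma> ` J \<subseteq> J" using *[OF _ z(2), of _ 0] by auto
  show "I \<subseteq> J" using *[OF z(1), of _ 0] by auto
  show "S.\<theta> \<in> J" using *[OF z, of 1] by simp
qed

lemma ker_J: "\<alpha> a = 0 \<Longrightarrow> a \<in> J"
  using ker_I J_I by blast

lemma ipow_ker: "s \<in> ipow J m \<Longrightarrow> \<alpha> a = 0 \<Longrightarrow> s * a = 0"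
  using ipow_annihilates[of m J a s] J_power_ker by blast

lemma \<alpha>_image_J: "\<alpha> a \<in> \<alpha> ` J \<Longrightarrow> a \<in> J"
proof -
  assume "\<alpha> a \<in> \<alpha> ` J"
  then obtain b where b: "b \<in> J" "\<alpha> a = \<alpha> b" by auto
  then have "a - b \<in> J" by (intro ker_J) (simp add: \<alpha>_simps)
  then show "a \<in> J" using is_idealD(2)[OF J_ideal _ b(1)] by fastforce
qed

text \<open>The inverse of \<open>u\<close> compensates the factor by which
  \<open>\<sigma>1'\<close> differs from \<open>\<sigma>1\<close>.\<close>

lemma \<theta>'_eq: "S'.\<theta> = ui * \<alpha> S.\<theta>"
proof (rule S'.\<theta>_unique)
  fix a' assume a': "a' \<in> I'"
  obtain a where a: "a' = \<alpha> a" using surj_\<alpha> by auto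
  then have aI: "a \<in> I" using I_if_\<alpha> a' by simp
  have "ui * \<alpha> S.\<theta> * \<sigma>1' a' = ui * u * (\<alpha> S.\<theta> * \<alpha> (\<sigma>1 a))"
    unfolding a \<sigma>1'_\<alpha>[OF aI] by (simp only: mult.assoc mult.left_commute)
  also have "\<dots> = \<alpha> (\<sigma> a)" using S.\<theta>[OF aI] by (simp add: \<alpha>_simps)
  finally show "\<sigma>' a' = ui * \<alpha> S.\<theta> * \<sigma>1' a'" unfolding a \<sigma>'_\<alpha> by simp
qed

lemma \<alpha>_J_ideal: "is_ideal (\<alpha> ` J)"
  unfolding is_ideal_def
proof (intro conjI ballI allI)
  show "0 \<in> \<alpha> ` J" using is_idealD(1)[OF J_ideal] \<alpha>_simps(4) by (metis imageI)
  fix x' y' s' assume "x' \<in> \<alpha> ` J"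
  then obtain x where x: "x \<in> J" "x' = \<alpha> x" by auto
  obtain s where "s' = \<alpha> s" using surj_\<alpha> by auto
  then have "s' * x' = \<alpha> (s * x)" using x by (simp add: \<alpha>_simps)
  then show "s' * x' \<in> \<alpha> ` J" using is_idealD(3)[OF J_ideal x(1)] by blast
  assume "y' \<in> \<alpha> ` J"
  then obtain y where y: "y \<in> J" "y' = \<alpha> y" by auto
  then have "x' + y' = \<alpha> (x + y)" using x by (simp add: \<alpha>_simps)
  then show "x' + y' \<in> \<alpha> ` J" using is_idealD(2)[OF J_ideal x(1) y(1)] by blast
qed

lemma ideal_of_def_\<alpha>_J: "ideal_of_def I' \<sigma>' \<sigma>1' (\<alpha> ` J)"
  unfolding ideal_of_def_def
proof (intro conjI subsetI)
  note ideal = is_idealD[OF \<alpha>_J_ideal]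
  fix z assume "z \<in> {x + y + S'.\<theta> * s |x y s. x \<in> \<sigma>' ` \<alpha> ` J \<and> y \<in> I'}"
  then obtain j y s where z: "z = \<sigma>' (\<alpha> j) + y + S'.\<theta> * s" "j \<in> J" "y \<in> I'" by blast
  have "\<sigma>' (\<alpha> j) \<in> \<alpha> ` J" unfolding \<sigma>'_\<alpha> using J_\<sigma> z(2) by blast
  moreover obtain y0 where "y = \<alpha> y0" using surj_\<alpha> by auto
  then have "y \<in> \<alpha> ` J" using I_if_\<alpha> z(3) J_I by blast
  moreover have "S'.\<theta> * s \<in> \<alpha> ` J" unfolding \<theta>'_eq using J_\<theta> by (intro ideal(3,4)) simp
  ultimately show "z \<in> \<alpha> ` J" unfolding z(1) by (intro ideal(2))
qed (rule \<alpha>_J_ideal)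

section \<open>Reduction modulo the kernel as a model of base change\<close>

lemma lin_on_\<alpha>_ker:
  assumes "dbasis n e P" "lin_on \<alpha> P g" "x \<in> P" "\<And>i. \<alpha> (x i) = 0"
  shows "g x = 0"
proof -
  have "\<alpha> \<circ> x = 0" using assms(4) by (simp add: fun_eq_iff o_apply zero_fun_apply)
  then show ?thesis using dbasis_lin_on[OF assms(1,2) \<alpha>_hom assms(3)] by simp
qed

lemma lin_on_ker_coords:
  assumes "dbasis n e P" "lin_on id P f" "x \<in> P" "\<And>i. \<alpha> (x i) = 0"
  shows "\<alpha> (f x i) = 0"
  using lin_on_coords_in[OF assms(1,2) ring_hom'_id assms(3) ker_ideal] assms(4) by simp

lemma wF_ker:
  assumes "window I \<sigma> \<sigma>1 W" "x \<in> wP W" "\<And>i. \<alpha> (x i) = 0"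
  shows "\<alpha> (wF W x i) = 0"
proof -
  obtain n e where db: "dbasis n e (wP W)" using S.window_dbasis[OF assms(1)] by blast
  have "\<sigma> (x i) \<in> {a. \<alpha> a = 0}" for i
    using assms(3)[of i] ring_hom'_simps(4)[OF S'.hom] by (simp add: \<sigma>'_\<alpha>[symmetric])
  then have "wF W x i \<in> {a. \<alpha> a = 0}"
    by (rule lin_on_coords_in[OF db S.windowD(3)[OF assms(1)] S.hom assms(2) ker_ideal])
  then show ?thesis by simp
qed

text \<open>Vectors of \<open>\<aa>P\<close> have coordinates in \<open>I\<close>, so
  \<open>F\<^sub>1 x\<close> is the combination of the \<open>F (e j)\<close> with coefficients
  \<open>\<sigma>1 (x j)\<close>, which stay in the kernel.\<close>

lemma wF1_ker:
  assumes "window I \<sigma> \<sigma>1 W" "x \<in> wP W" "\<And>i. \<alpha> (x i) = 0"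
  shows "\<alpha> (wF1 W x i) = 0"
proof -
  obtain n e where db: "dbasis n e (wP W)" using S.window_dbasis[OF assms(1)] by blast
  have "wF1 W x i \<in> {a. \<alpha> a = 0}"
    unfolding S.wF1_coords[OF assms(1) db assms(2) ker_I[OF assms(3)]]
    by (rule lcomb_coords_in[OF ker_ideal]) (use ker_\<sigma>1 assms(3) in \<open>auto simp: o_apply\<close>)
  then show ?thesis by simp
qed

text \<open>\<open>W'\<close> is the quotient of \<open>W\<close> modulo the kernel of
  \<open>\<alpha>\<close>, up to isomorphism: the map is onto for both \<open>P\<close> and
  \<open>Q\<close>, and its kernel is \<open>\<aa>P\<close>. Unlike the universal property, these
  conditions can be used on elements.\<close>

definition reduction :: "'a win \<Rightarrow> 'b win \<Rightarrow> ((nat \<Rightarrow> 'a) \<Rightarrow> nat \<Rightarrow> 'b) \<Rightarrow> bool" where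
  "reduction W W' \<iota> \<longleftrightarrow> window I' \<sigma>' \<sigma>1' W' \<and> win_mor \<alpha> u W W' \<iota> \<and>
    \<iota> ` wP W = wP W' \<and> \<iota> ` wQ W = wQ W' \<and> (\<forall>x\<in>wP W. \<iota> x = 0 \<longrightarrow> (\<forall>i. \<alpha> (x i) = 0))"

lemma reductionD:
  assumes "reduction W W' \<iota>"
  shows "window I' \<sigma>' \<sigma>1' W'" "win_mor \<alpha> u W W' \<iota>" "\<iota> ` wP W = wP W'" "\<iota> ` wQ W = wQ W'"
    "x \<in> wP W \<Longrightarrow> \<iota> x = 0 \<Longrightarrow> \<alpha> (x i) = 0"
  using assms by (auto simp: reduction_def)

lemma reduction_diff:
  assumes "window I \<sigma> \<sigma>1 W" "reduction W W' \<iota>" "x \<in> wP W" "y \<in> wP W" "\<iota> x = \<iota> y"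
  shows "\<alpha> ((x - y) i) = 0"
proof (rule reductionD(5)[OF assms(2)])
  note lin = lin_onD[OF win_morD(2)[OF reductionD(2)[OF assms(2)]] S.submod_wP[OF assms(1)] \<alpha>_hom]
  show "x - y \<in> wP W" using submodD(5)[OF S.submod_wP[OF assms(1)]] assms by blast
  show "\<iota> (x - y) = 0" using lin(5)[OF assms(3,4)] assms(5) by simp
qed

lemma reduction_descend:
  assumes W: "window I \<sigma> \<sigma>1 W" and red: "reduction W W' \<iota>" and g: "lin_on \<alpha> (wP W) g"
  shows "\<exists>h. lin_on id (wP W') h \<and> (\<forall>x\<in>wP W. h (\<iota> x) = g x)"
proof -
  obtain n e where db: "dbasis n e (wP W)" using S.window_dbasis[OF W] by blast
  note subP = S.submod_wP[OF W]
  have "\<exists>h. \<forall>x\<in>wP W. h (\<iota> x) = g x"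
  proof (rule descend_through)
    fix x y assume xy: "x \<in> wP W" "y \<in> wP W" "\<iota> x = \<iota> y"
    have "g (x - y) = 0"
      by (rule lin_on_\<alpha>_ker[OF db g submodD(5)[OF subP xy(1,2)] reduction_diff[OF W red xy]])
    then show "g x = g y" using lin_onD(5)[OF g subP \<alpha>_hom xy(1,2)] by simp
  qed
  then obtain h where h: "\<And>x. x \<in> wP W \<Longrightarrow> h (\<iota> x) = g x" by blast
  have "lin_on id (\<iota> ` wP W) h"
    by (rule lin_on_descend[OF surj_\<alpha> win_morD(2)[OF reductionD(2)[OF red]] subP g _ h]) simp
  then show ?thesis using h reductionD(3)[OF red] by auto
qed

text \<open>A map out of \<open>W\<close> descends because \<open>\<alpha>\<close>-linear maps kill
  \<open>\<aa>P\<close>. Surjectivity on \<open>P\<close> and \<open>Q\<close> gives the morphism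
  conditions and uniqueness.\<close>

lemma reduction_base_change:
  assumes W: "window I \<sigma> \<sigma>1 W" and red: "reduction W W' \<iota>"
  shows "is_base_change I' \<sigma>' \<sigma>1' \<alpha> u W W' \<iota>"
  unfolding is_base_change_def
proof (intro conjI allI impI)
  show "window I' \<sigma>' \<sigma>1' W'" "win_mor \<alpha> u W W' \<iota>" using reductionD(1,2)[OF red] .
  note \<iota> = win_morD[OF reductionD(2)[OF red]]
  fix W'' g assume W'': "window I' \<sigma>' \<sigma>1' W''" and g: "win_mor \<alpha> u W W'' g"
  note gD = win_morD[OF g]
  obtain h where h: "lin_on id (wP W') h" "\<And>x. x \<in> wP W \<Longrightarrow> h (\<iota> x) = g x"
    using reduction_descend[OF W red gD(2)] by blast
  note PQ = reductionD(3,4)[OF red] and QP = S.windowD(1)[OF W]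
  have "win_mor id 1 W' W'' h"
    unfolding win_mor_def
  proof (intro conjI ballI h(1))
    fix y assume "y \<in> wP W'"
    then obtain x where x: "x \<in> wP W" "y = \<iota> x" using PQ by blast
    show "h y \<in> wP W''" using h(2) gD(1) x by simp
    show "wF W'' (h y) = h (wF W' y)"
      using h(2) gD(4) x \<iota>(4) S.windowD(2)[OF W] by simp
  next
    fix y assume "y \<in> wQ W'"
    then obtain x where x: "x \<in> wQ W" "y = \<iota> x" using PQ by blast
    then have xP: "x \<in> wP W" using QP by auto
    show "h y \<in> wQ W''" using h(2)[OF xP] gD(3) x by simp
    have F1: "wF1 W x \<in> wP W" using S.windowD(4)[OF W x(1)] .
    have "h (wF1 W' y) = sc u (h (\<iota> (wF1 W x)))"
      unfolding x(2) \<iota>(5)[OF x(1)]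
      using lin_onD(2)[OF h(1) S'.submod_wP[OF reductionD(1)[OF red]] ring_hom'_id \<iota>(1)[OF F1]] by simp
    then show "wF1 W'' (h y) = sc 1 (h (wF1 W' y))"
      using h(2)[OF xP] h(2)[OF F1] gD(5)[OF x(1)] x(2) by simp
  qed
  moreover have "h' y = h y" if "\<forall>x\<in>wP W. h' (\<iota> x) = g x" "y \<in> wP W'" for h' y
    using that h(2) PQ(1) by (metis imageE)
  ultimately show "\<exists>h. win_mor id 1 W' W'' h \<and> (\<forall>x\<in>wP W. h (\<iota> x) = g x) \<and>
      (\<forall>h'. win_mor id 1 W' W'' h' \<and> (\<forall>x\<in>wP W. h' (\<iota> x) = g x) \<longrightarrow> (\<forall>y\<in>wP W'. h' y = h y))"
    using h(2) by blast
qed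

text \<open>The model applies \<open>\<alpha>\<close> to every coordinate. \<open>F\<close> and
  \<open>F\<^sub>1\<close> induce maps on it because both preserve \<open>\<aa>P\<close>.\<close>

lemma reduction_exists:
  assumes W: "window I \<sigma> \<sigma>1 W"
  shows "\<exists>W' \<iota>. reduction W W' \<iota>"
proof -
  obtain n e pL pT L T where nd: "S.normal_decomposition W n e pL pT L T"
    using S.normal_decomposition_exists[OF W] by blast
  note db = S.normal_decompositionD(1)[OF nd] and lin = S.normal_decompositionD(2,3)[OF nd]
    and p = S.normal_decompositionD(4)[OF nd] and pL = S.normal_decompositionD(5)[OF nd]
    and pT = S.normal_decompositionD(6)[OF nd] and sub = S.normal_decompositionD(7,8)[OF nd]
    and dbL = S.normal_decompositionD(9)[OF nd] and dbT = S.normal_decompositionD(10)[OF nd]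
    and Q = S.normal_decompositionD(11)[OF nd]
  note subP = S.submod_wP[OF W] and subQ = S.submod_wQ[OF W] and WD = S.windowD[OF W]
  define \<iota> where "\<iota> = (\<lambda>x :: nat \<Rightarrow> 'a. \<alpha> \<circ> x)"
  have \<iota>_lin: "lin_on \<alpha> X \<iota>" for X unfolding \<iota>_def by (rule lin_on_comp_hom[OF \<alpha>_hom])
  have \<iota>_eq: "\<alpha> ((x - y) i) = 0" if "\<iota> x = \<iota> y" for x y i
    using fun_cong[OF that, of i] by (simp add: \<iota>_def o_apply minus_apply \<alpha>_simps)
  have \<iota>_0: "\<iota> x = 0 \<longleftrightarrow> (\<forall>i. \<alpha> (x i) = 0)" for x
    by (simp add: \<iota>_def fun_eq_iff o_apply zero_fun_apply)
  have \<iota>_diff: "\<iota> (x - y) = \<iota> x - \<iota> y" for x y unfolding \<iota>_def by (rule comp_diff[OF \<alpha>_hom])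
  have \<iota>_add: "\<iota> (x + y) = \<iota> x + \<iota> y" for x y unfolding \<iota>_def by (rule comp_add[OF \<alpha>_hom])
  have \<iota>_sc: "\<iota> (sc a x) = sc (\<alpha> a) (\<iota> x)" for a x unfolding \<iota>_def by (rule comp_sc[OF \<alpha>_hom])
  have "\<exists>F'. \<forall>x\<in>wP W. F' (\<iota> x) = \<iota> (wF W x)"
  proof (rule descend_through)
    fix x y assume xy: "x \<in> wP W" "y \<in> wP W" "\<iota> x = \<iota> y"
    have "\<iota> (wF W (x - y)) = 0"
      unfolding \<iota>_0 using wF_ker[OF W submodD(5)[OF subP xy(1,2)] \<iota>_eq[OF xy(3)]] by simp
    then show "\<iota> (wF W x) = \<iota> (wF W y)"
      unfolding lin_onD(5)[OF WD(3) subP S.hom xy(1,2)] \<iota>_diff by simp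
  qed
  then obtain F' where F': "\<And>x. x \<in> wP W \<Longrightarrow> F' (\<iota> x) = \<iota> (wF W x)" by blast
  \<comment> \<open>The factor \<open>u\<close> is built into \<open>F1'\<close>, as the definition
    of a morphism over \<open>\<alpha>\<close> demands.\<close>
  have "\<exists>F1'. \<forall>x\<in>wQ W. F1' (\<iota> x) = sc u (\<iota> (wF1 W x))"
  proof (rule descend_through)
    fix x y assume xy: "x \<in> wQ W" "y \<in> wQ W" "\<iota> x = \<iota> y"
    have "x - y \<in> wP W" using submodD(5)[OF subQ xy(1,2)] WD(1) by auto
    then have "\<iota> (wF1 W (x - y)) = 0"
      unfolding \<iota>_0 using wF1_ker[OF W _ \<iota>_eq[OF xy(3)]] by simp
    then show "sc u (\<iota> (wF1 W x)) = sc u (\<iota> (wF1 W y))"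
      unfolding lin_onD(5)[OF WD(5) subQ S.hom xy(1,2)] \<iota>_diff by simp
  qed
  then obtain F1' where F1': "\<And>x. x \<in> wQ W \<Longrightarrow> F1' (\<iota> x) = sc u (\<iota> (wF1 W x))" by blast
  define W' where "W' = \<lparr>wP = \<iota> ` wP W, wQ = \<iota> ` wQ W, wF = F', wF1 = F1'\<rparr>"
  have W'_simps: "wP W' = \<iota> ` wP W" "wQ W' = \<iota> ` wQ W" "wF W' = F'" "wF1 W' = F1'"
    by (simp_all add: W'_def)
  have db_image: "dbasis n (\<lambda>j. \<iota> (b j)) (\<iota> ` X)" if "dbasis n b X" for b X
  proof -
    have "\<iota> x \<in> fvec n" if "x \<in> X" for x
      using dbasisD(4)[OF \<open>dbasis n b X\<close> that] by (simp add: \<iota>_def fvec_def o_apply \<alpha>_simps)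
    moreover have "lcomb n (\<iota> x) (\<lambda>j. \<iota> (b j)) = \<iota> x" if "x \<in> X" for x
      using comp_lcomb[OF \<alpha>_hom, of n x b] dbasisD(3)[OF \<open>dbasis n b X\<close> that] by (simp add: \<iota>_def)
    ultimately show ?thesis
      unfolding dbasis_def using submod_image[OF surj_\<alpha> \<iota>_lin dbasisD(1)[OF that] \<alpha>_hom] dbasisD(2)[OF that] by auto
  qed
  have "window I' \<sigma>' \<sigma>1' W'"
    unfolding window_def W'_simps
  proof (intro conjI ballI)
    show "fg_proj (\<iota> ` wP W)" using db_image[OF db] by (rule dbasis_imp_fg_proj)
    show "\<iota> ` wQ W \<subseteq> \<iota> ` wP W" using WD(1) by auto
    show "F' y \<in> \<iota> ` wP W" if "y \<in> \<iota> ` wP W" for y using that F' WD(2) by auto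
    show "F1' y \<in> \<iota> ` wP W" if "y \<in> \<iota> ` wQ W" for y
      using that F1' WD(4) submodD(3)[OF submod_image[OF surj_\<alpha> \<iota>_lin subP \<alpha>_hom]] by auto
    show "lin_on \<sigma>' (\<iota> ` wP W) F'"
      by (rule lin_on_descend[OF surj_\<alpha> \<iota>_lin subP lin_on_compose[OF WD(3) \<iota>_lin[of UNIV]] _ F'])
        (auto simp: o_apply \<sigma>'_\<alpha>)
    show "lin_on \<sigma>' (\<iota> ` wQ W) F1'"
      by (rule lin_on_descend[OF surj_\<alpha> \<iota>_lin subQ lin_on_sc[OF lin_on_compose[OF WD(5) \<iota>_lin[of UNIV]]] _ F1'])
        (auto simp: o_apply \<sigma>'_\<alpha>)
    have "dsum (\<iota> ` wP W) (\<iota> ` L) (\<iota> ` T)"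
    proof -
      \<comment> \<open>If \<open>l\<close> and \<open>t\<close> have the same image, then
        \<open>l - t\<close> has coordinates in the kernel, and so has its projection to
        \<open>L\<close>, which is \<open>l\<close>.\<close>
      have 1: "y = 0" if yLT: "y \<in> \<iota> ` L \<inter> \<iota> ` T" for y
      proof -
        obtain l t where lt: "l \<in> L" "t \<in> T" "y = \<iota> l" "\<iota> l = \<iota> t" using yLT by auto
        then have P: "l \<in> wP W" "t \<in> wP W" using sub by auto
        have "\<alpha> (pL (l - t) i) = 0" for i
          by (rule lin_on_ker_coords[OF db lin(1) submodD(5)[OF subP P] \<iota>_eq[OF lt(4)]])
        moreover have "pL (l - t) = l"
          using lin_onD(5)[OF lin(1) subP ring_hom'_id P] pL[OF lt(1)] pT[OF lt(2)] by simp
        ultimately have "\<iota> l = 0" by (simp add: \<iota>_0)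
        then show ?thesis using lt(3) by simp
      qed
      have 2: "0 \<in> \<iota> ` L \<inter> \<iota> ` T"
      proof -
        have "\<iota> 0 = 0" by (simp add: \<iota>_0 zero_fun_apply \<alpha>_simps)
        then show ?thesis
          using dbasisD(8)[OF dbL] dbasisD(8)[OF dbT] by (metis IntI imageI)
      qed
      have 3: "y \<in> {x + y |x y. x \<in> \<iota> ` L \<and> y \<in> \<iota> ` T}" if yP: "y \<in> \<iota> ` wP W" for y
      proof -
        obtain x where x: "x \<in> wP W" "y = \<iota> x" using yP by auto
        then have "y = \<iota> (pL x) + \<iota> (pT x)" using p[OF x(1)] \<iota>_add[of "pL x" "pT x"] by simp
        then show ?thesis using p[OF x(1)] by blast
      qed
      have 4: "y \<in> \<iota> ` wP W" if ysum: "y \<in> {x + y |x y. x \<in> \<iota> ` L \<and> y \<in> \<iota> ` T}" for y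
      proof -
        obtain l t where lt: "l \<in> L" "t \<in> T" "y = \<iota> l + \<iota> t" using ysum by blast
        then have "l + t \<in> wP W" using sub submodD(2)[OF subP] by blast
        then show ?thesis using lt(3) \<iota>_add by (metis imageI)
      qed
      show ?thesis unfolding dsum_def using 1 2 3 4 by blast
    qed
    moreover have "\<iota> ` wQ W = {l + t |l t. l \<in> \<iota> ` L \<and> t \<in> imult I' (\<iota> ` T)}"
      unfolding imult_iff[OF db_image[OF dbT] S'.ideal_I]
    proof (intro Set.set_eqI iffI)
      fix y assume "y \<in> \<iota> ` wQ W"
      then obtain l t where lt: "l \<in> L" "t \<in> T" "\<And>i. t i \<in> I" "y = \<iota> (l + t)" unfolding image_iff Bex_def Q by blast
      have "\<iota> t i \<in> I'" for i using \<alpha>_I[OF lt(3)] by (simp add: \<iota>_def o_apply)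
      then show "y \<in> {l + t |l t. l \<in> \<iota> ` L \<and> t \<in> \<iota> ` T \<and> (\<forall>i. t i \<in> I')}"
        unfolding lt(4) \<iota>_add using lt by blast
    next
      fix y assume "y \<in> {l + t |l t. l \<in> \<iota> ` L \<and> t \<in> \<iota> ` T \<and> (\<forall>i. t i \<in> I')}"
      then obtain l t where lt: "l \<in> L" "t \<in> T" "\<And>i. \<iota> t i \<in> I'" "y = \<iota> l + \<iota> t" by blast
      have "t i \<in> I" for i using lt(3)[of i] I_if_\<alpha> by (simp add: \<iota>_def o_apply)
      then have "l + t \<in> wQ W" unfolding Q using lt by blast
      then show "y \<in> \<iota> ` wQ W" using lt(4) \<iota>_add by (metis imageI)
    qed
    ultimately show "\<exists>L T. submod L \<and> submod T \<and> dsum (\<iota> ` wP W) L T \<and>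
        \<iota> ` wQ W = {l + t |l t. l \<in> L \<and> t \<in> imult I' T}"
      using dbasisD(1)[OF db_image[OF dbL]] dbasisD(1)[OF db_image[OF dbT]] by blast
    show "F1' (sc a' y) = sc (\<sigma>1' a') (F' y)" if a': "a' \<in> I'" and y: "y \<in> \<iota> ` wP W" for a' y
    proof -
      obtain x where x: "x \<in> wP W" "y = \<iota> x" using y by auto
      obtain a where a: "a' = \<alpha> a" using surj_\<alpha> by auto
      then have aI: "a \<in> I" using a' I_if_\<alpha> by simp
      have "F1' (sc a' y) = sc u (\<iota> (sc (\<sigma>1 a) (wF W x)))"
        unfolding a x(2) \<iota>_sc[symmetric] F1'[OF S.sc_I_wQ[OF W aI x(1)]] WD(6)[OF aI x(1)] ..
      also have "\<dots> = sc (\<sigma>1' a') (F' y)" unfolding \<iota>_sc a \<sigma>1'_\<alpha>[OF aI] x(2) F'[OF x(1)] by simp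
      finally show ?thesis .
    qed
    show "mspan (F1' ` \<iota> ` wQ W) = \<iota> ` wP W"
    proof
      show "mspan (F1' ` \<iota> ` wQ W) \<subseteq> \<iota> ` wP W"
        by (rule mspan_subset[OF _ submod_image[OF surj_\<alpha> \<iota>_lin subP \<alpha>_hom]])
          (use F1' WD(4) submodD(3)[OF submod_image[OF surj_\<alpha> \<iota>_lin subP \<alpha>_hom]] in auto)
      show "\<iota> ` wP W \<subseteq> mspan (F1' ` \<iota> ` wQ W)"
      proof
        fix y assume "y \<in> \<iota> ` wP W"
        then obtain x where x: "x \<in> mspan (wF1 W ` wQ W)" "y = \<iota> x" using WD(7) by auto
        then obtain k c w where w: "\<forall>i<k. w i \<in> wF1 W ` wQ W" "x = lcomb k c w" unfolding mspan_iff by blast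
        have "y = lcomb k (\<alpha> \<circ> c) (\<lambda>j. \<iota> (w j))"
          unfolding x(2) w(2) \<iota>_def by (rule comp_lcomb[OF \<alpha>_hom])
        also have "\<dots> \<in> mspan (F1' ` \<iota> ` wQ W)"
        proof (rule submod_lcomb[OF submod_mspan])
          fix j assume "j < k"
          then obtain q where q: "q \<in> wQ W" "w j = wF1 W q" using w(1) by auto
          \<comment> \<open>Generators over \<open>S\<close> become generators over
            \<open>S'\<close> because \<open>u\<close> can be divided out.\<close>
          have "\<iota> (w j) = sc ui (F1' (\<iota> q))" unfolding q(2) F1'[OF q(1)] by simp
          moreover have "F1' (\<iota> q) \<in> mspan (F1' ` \<iota> ` wQ W)"
            by (rule subsetD[OF mspan_superset]) (use q(1) in auto)
          ultimately show "\<iota> (w j) \<in> mspan (F1' ` \<iota> ` wQ W)"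
            using submodD(3)[OF submod_mspan] by simp
        qed
        finally show "y \<in> mspan (F1' ` \<iota> ` wQ W)" .
      qed
    qed
  qed
  moreover have "win_mor \<alpha> u W W' \<iota>"
    unfolding win_mor_def W'_simps using F' F1' \<iota>_lin by auto
  ultimately have "reduction W W' \<iota>"
    unfolding reduction_def W'_simps using \<iota>_0 by auto
  then show ?thesis by blast
qed

text \<open>Representing objects are unique up to isomorphism, so an arbitrary base change inherits
  the properties of the explicit model.\<close>

lemma base_change_reduction:
  assumes W: "window I \<sigma> \<sigma>1 W" and bc: "is_base_change I' \<sigma>' \<sigma>1' \<alpha> u W W' \<iota>"
  shows "reduction W W' \<iota>"
proof -
  obtain W0 \<iota>0 where red: "reduction W W0 \<iota>0" using reduction_exists[OF W] by blast
  have W': "window I' \<sigma>' \<sigma>1' W'" and \<iota>: "win_mor \<alpha> u W W' \<iota>"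
    and univ: "\<And>W'' g. window I' \<sigma>' \<sigma>1' W'' \<Longrightarrow> win_mor \<alpha> u W W'' g \<Longrightarrow>
           (\<exists>h. win_mor id 1 W' W'' h \<and> (\<forall>x\<in>wP W. h (\<iota> x) = g x) \<and>
              (\<forall>h'. win_mor id 1 W' W'' h' \<and> (\<forall>x\<in>wP W. h' (\<iota> x) = g x) \<longrightarrow> (\<forall>y\<in>wP W'. h' y = h y)))"
    using bc unfolding is_base_change_def by blast+
  note red0 = reductionD[OF red]
  obtain h where h: "win_mor id 1 W' W0 h" "\<And>x. x \<in> wP W \<Longrightarrow> h (\<iota> x) = \<iota>0 x"
    using univ[OF red0(1,2)] by blast
  have "\<exists>h. win_mor id 1 W0 W' h \<and> (\<forall>x\<in>wP W. h (\<iota>0 x) = \<iota> x)"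
    using reduction_base_change[OF W red] W' \<iota> unfolding is_base_change_def by blast
  then obtain h0 where h0: "win_mor id 1 W0 W' h0" "\<And>x. x \<in> wP W \<Longrightarrow> h0 (\<iota>0 x) = \<iota> x" by blast
  note hD = win_morD[OF h(1)] and h0D = win_morD[OF h0(1)]
  have comp: "win_mor id 1 W' W' (\<lambda>y. h0 (h y))"
    unfolding win_mor_def
    using hD h0D lin_on_compose[OF hD(2) h0D(2) hD(1)] by simp
  have idm: "win_mor id 1 W' W' (\<lambda>y. y)" unfolding win_mor_def by (simp add: lin_on_def)
  obtain hh where "\<And>h'. win_mor id 1 W' W' h' \<Longrightarrow> (\<forall>x\<in>wP W. h' (\<iota> x) = \<iota> x) \<Longrightarrow> (\<forall>y\<in>wP W'. h' y = hh y)"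
    using univ[OF W' \<iota>] by blast
  \<comment> \<open>Both the identity and the round trip through the model extend
    \<open>\<iota>\<close>; uniqueness in the universal property identifies them.\<close>
  from this[OF comp] this[OF idm] have inv: "h0 (h y) = y" if "y \<in> wP W'" for y
    using h(2) h0(2) that by simp
  have QP: "wQ W \<subseteq> wP W" using S.windowD(1)[OF W] .
  have "wP W' \<subseteq> \<iota> ` wP W"
  proof
    fix y assume y: "y \<in> wP W'"
    then obtain x where "x \<in> wP W" "h y = \<iota>0 x" using hD(1) red0(3) by blast
    then show "y \<in> \<iota> ` wP W" using inv[OF y] h0(2) by (metis imageI)
  qed
  moreover have "wQ W' \<subseteq> \<iota> ` wQ W"
  proof
    fix y assume y: "y \<in> wQ W'"
    then obtain x where "x \<in> wQ W" "h y = \<iota>0 x" using hD(3) red0(4) by blast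
    then show "y \<in> \<iota> ` wQ W" using inv[of y] S'.windowD(1)[OF W'] y h0(2) QP by (metis imageI subsetD)
  qed
  moreover have "\<alpha> (x i) = 0" if "x \<in> wP W" "\<iota> x = 0" for x i
    using red0(5)[OF that(1)] h(2)[OF that(1)] that(2)
      lin_onD(3)[OF hD(2) S'.submod_wP[OF W'] ring_hom'_id] by simp
  ultimately show ?thesis
    unfolding reduction_def using W' \<iota> win_morD(1,3)[OF \<iota>] by auto
qed

section \<open>Nilpotence and full faithfulness\<close>

text \<open>The combination with the vectors \<open>\<sigma>' \<circ> \<iota> (e j)\<close>
  identifies the base change of \<open>P^(\<sigma>)\<close> with the twist of \<open>P'\<close>. On
  a generator \<open>F\<^sub>1 q\<close> both sides equal
  \<open>\<sigma>' \<circ> \<iota> q\<close>.\<close>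

lemma reduction_Vsharp:
  assumes W: "window I \<sigma> \<sigma>1 W" and red: "reduction W W' \<iota>" and db: "dbasis n e (wP W)"
    and V: "is_Vsharp \<sigma> W V" and V': "is_Vsharp \<sigma>' W' V'" and x: "x \<in> wP W"
  shows "lcomb n (\<alpha> \<circ> V x) (\<lambda>j. \<sigma>' \<circ> \<iota> (e j)) = sc u (V' (\<iota> x))"
proof (rule lin_on_eq_on_mspan[OF _ _ S.submod_wP[OF W] \<alpha>_hom])
  note \<iota> = win_morD[OF reductionD(2)[OF red]] and subP' = S'.submod_wP[OF reductionD(1)[OF red]]
  have VD: "lin_on id (wP W) V" "\<And>x. x \<in> wQ W \<Longrightarrow> V (wF1 W x) = \<sigma> \<circ> x"
    and VD': "lin_on id (wP W') V'" "\<And>x. x \<in> wQ W' \<Longrightarrow> V' (wF1 W' x) = \<sigma>' \<circ> x"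
    using V V' by (auto simp: is_Vsharp_def)
  show "lin_on \<alpha> (wP W) (\<lambda>x. lcomb n (\<alpha> \<circ> V x) (\<lambda>j. \<sigma>' \<circ> \<iota> (e j)))"
    using lin_on_compose[OF VD(1) lin_on_lcomb[OF \<alpha>_hom, of UNIV n]] by simp
  show "lin_on \<alpha> (wP W) (\<lambda>x. sc u (V' (\<iota> x)))"
    using lin_on_sc[OF lin_on_compose[OF \<iota>(2) VD'(1) \<iota>(1)]] by simp
  show "x \<in> mspan (wF1 W ` wQ W)" using x S.windowD(7)[OF W] by simp
  show "wF1 W ` wQ W \<subseteq> wP W" using S.windowD(4)[OF W] by auto
  fix y assume "y \<in> wF1 W ` wQ W"
  then obtain q where q: "q \<in> wQ W" "y = wF1 W q" by auto
  have qP: "q \<in> wP W" using S.windowD(1)[OF W] q(1) by auto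
  have "lcomb n (\<alpha> \<circ> V y) (\<lambda>j. \<sigma>' \<circ> \<iota> (e j)) = lcomb n (\<sigma>' \<circ> (\<alpha> \<circ> q)) (\<lambda>j. \<sigma>' \<circ> \<iota> (e j))"
    unfolding q(2) VD(2)[OF q(1)] \<sigma>'_\<alpha>_vec ..
  also have "\<dots> = \<sigma>' \<circ> \<iota> q"
    unfolding comp_lcomb[OF S'.hom, symmetric] using dbasis_lin_on[OF db \<iota>(2) \<alpha>_hom qP] by simp
  also have "\<dots> = V' (sc u (\<iota> y))" using VD'(2)[OF \<iota>(3)[OF q(1)]] \<iota>(5)[OF q(1)] q(2) by simp
  also have "\<dots> = sc u (V' (\<iota> y))"
    using lin_onD(2)[OF VD'(1) subP' ring_hom'_id \<iota>(1)[OF S.windowD(4)[OF W q(1)]]] q(2) by simp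
  finally show "lcomb n (\<alpha> \<circ> V y) (\<lambda>j. \<sigma>' \<circ> \<iota> (e j)) = sc u (V' (\<iota> y))" .
qed

text \<open>Each step contributes one factor \<open>u\<close>, twisted by the number of steps before
  it; the resulting product is a unit.\<close>

lemma reduction_vpow:
  assumes W: "window I \<sigma> \<sigma>1 W" and red: "reduction W W' \<iota>" and db: "dbasis n e (wP W)"
    and db': "dbasis n' e' (wP W')"
    and V: "is_Vsharp \<sigma> W V" and V': "is_Vsharp \<sigma>' W' V'" and x: "x \<in> wP W"
  shows "lcomb n (\<alpha> \<circ> vpow \<sigma> n (\<lambda>j. V (e j)) k x) (\<lambda>j. (\<sigma>' ^^ k) \<circ> \<iota> (e j)) =
    sc (\<Prod>i<k. (\<sigma>' ^^ i) u) (vpow \<sigma>' n' (\<lambda>j. V' (e' j)) k (\<iota> x))"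
proof (induction k)
  case 0
  show ?case using dbasis_lin_on[OF db win_morD(2)[OF reductionD(2)[OF red]] \<alpha>_hom x] by (simp add: o_def)
next
  case (Suc k)
  note \<iota> = win_morD[OF reductionD(2)[OF red]]
  let ?s = "\<sigma>' ^^ k" and ?z = "vpow \<sigma> n (\<lambda>j. V (e j)) k x"
  note shom = S'.hom_funpow[of k]
  have inner: "lcomb n (?s \<circ> (\<alpha> \<circ> V (e j))) (\<lambda>l. (\<sigma>' ^^ Suc k) \<circ> \<iota> (e l)) =
      sc (?s u) (lcomb n' (?s \<circ> \<iota> (e j)) (\<lambda>i. ?s \<circ> V' (e' i)))" if j: "j < n" for j
  proof -
    have ej: "e j \<in> wP W" "\<iota> (e j) \<in> wP W'" using dbasisD(2)[OF db j] \<iota>(1) by auto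
    have "lcomb n (?s \<circ> (\<alpha> \<circ> V (e j))) (\<lambda>l. (\<sigma>' ^^ Suc k) \<circ> \<iota> (e l)) =
        ?s \<circ> lcomb n (\<alpha> \<circ> V (e j)) (\<lambda>l. \<sigma>' \<circ> \<iota> (e l))"
      unfolding comp_lcomb[OF shom] funpow_Suc_right comp_assoc ..
    also have "\<dots> = sc (?s u) (?s \<circ> V' (\<iota> (e j)))"
      unfolding reduction_Vsharp[OF W red db V V' ej(1)] by (rule comp_sc[OF shom])
    also have "V' (\<iota> (e j)) = lcomb n' (\<iota> (e j)) (\<lambda>i. V' (e' i))"
      using dbasis_lin_on[OF db' _ ring_hom'_id ej(2), of V'] V' by (simp add: is_Vsharp_def)
    finally show ?thesis unfolding comp_lcomb[OF shom] .
  qed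
  have "lcomb n (\<alpha> \<circ> vpow \<sigma> n (\<lambda>j. V (e j)) (Suc k) x) (\<lambda>j. (\<sigma>' ^^ Suc k) \<circ> \<iota> (e j)) =
      lcomb n (\<alpha> \<circ> ?z) (\<lambda>j. lcomb n (?s \<circ> (\<alpha> \<circ> V (e j))) (\<lambda>l. (\<sigma>' ^^ Suc k) \<circ> \<iota> (e l)))"
    unfolding vpow.simps comp_lcomb[OF \<alpha>_hom] lcomb_lcomb \<sigma>'_\<alpha>_vec ..
  also have "\<dots> = lcomb n (\<alpha> \<circ> ?z) (\<lambda>j. sc (?s u) (lcomb n' (?s \<circ> \<iota> (e j)) (\<lambda>i. ?s \<circ> V' (e' i))))"
    by (rule lcomb_cong) (use inner in auto)
  also have "\<dots> = sc (?s u) (lcomb n' (lcomb n (\<alpha> \<circ> ?z) (\<lambda>j. ?s \<circ> \<iota> (e j))) (\<lambda>i. ?s \<circ> V' (e' i)))"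
    unfolding lcomb_sc_right lcomb_lcomb ..
  also have "\<dots> = sc (\<Prod>i<Suc k. (\<sigma>' ^^ i) u) (vpow \<sigma>' n' (\<lambda>j. V' (e' j)) (Suc k) (\<iota> x))"
    unfolding Suc.IH lcomb_sc by (simp add: mult.commute)
  finally show ?case .
qed

text \<open>The iterates correspond up to a unit, which does not affect membership in an ideal. As
  the kernel lies in \<open>J\<close>, membership in \<open>J\<close> can be tested after applying
  \<open>\<alpha>\<close>.\<close>

lemma nilpotent_reduction_iff:
  assumes W: "window I \<sigma> \<sigma>1 W" and red: "reduction W W' \<iota>"
  shows "nilpotent_win \<sigma> J W \<longleftrightarrow> nilpotent_win \<sigma>' (\<alpha> ` J) W'"
proof -
  note W' = reductionD(1)[OF red] and \<iota> = win_morD[OF reductionD(2)[OF red]]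
  obtain n e where db: "dbasis n e (wP W)" using S.window_dbasis[OF W] by blast
  obtain n' e' where db': "dbasis n' e' (wP W')" using S'.window_dbasis[OF W'] by blast
  note nil = nilpotent_win_iff[OF db S.hom J_ideal] and nil' = nilpotent_win_iff[OF db' S'.hom \<alpha>_J_ideal]
  obtain ck where ck: "\<And>k. (\<Prod>i<k. (\<sigma>' ^^ i) u) * ck k = 1"
  proof -
    have "(\<Prod>i<k. (\<sigma>' ^^ i) u) * (\<Prod>i<k. (\<sigma>' ^^ i) ui) = 1" for k
      unfolding prod.distrib[symmetric] ring_hom'_simps(3)[OF S'.hom_funpow, symmetric]
      by (simp add: ring_hom'_simps(1)[OF S'.hom_funpow])
    then show thesis by (rule that)
  qed
  show ?thesis
  proof
    assume "nilpotent_win \<sigma> J W"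
    then obtain V N where V: "is_Vsharp \<sigma> W V"
      and N: "\<And>k x i. k \<ge> N \<Longrightarrow> x \<in> wP W \<Longrightarrow> vpow \<sigma> n (\<lambda>j. V (e j)) k x i \<in> J" unfolding nil by blast
    obtain V' where V': "is_Vsharp \<sigma>' W' V'" using S'.Vsharp_exists[OF W'] by blast
    have "vpow \<sigma>' n' (\<lambda>j. V' (e' j)) k y i \<in> \<alpha> ` J" if k: "k \<ge> N" and y: "y \<in> wP W'" for k y i
    proof -
      obtain x where x: "x \<in> wP W" "y = \<iota> x" using y reductionD(3)[OF red] by blast
      let ?l = "lcomb n (\<alpha> \<circ> vpow \<sigma> n (\<lambda>j. V (e j)) k x) (\<lambda>j. (\<sigma>' ^^ k) \<circ> \<iota> (e j))"
      let ?c = "\<Prod>i<k. (\<sigma>' ^^ i) u"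
      have "?l i \<in> \<alpha> ` J"
        by (rule lcomb_coords_in[OF \<alpha>_J_ideal]) (use N[OF k x(1)] in \<open>auto simp: o_apply\<close>)
      then have "ck k * ?l i \<in> \<alpha> ` J" by (rule is_idealD(3)[OF \<alpha>_J_ideal])
      moreover have "ck k * ?l i = (?c * ck k) * vpow \<sigma>' n' (\<lambda>j. V' (e' j)) k y i"
        unfolding reduction_vpow[OF W red db db' V V' x(1)] sc_apply x(2) by (simp only: mult.assoc mult.left_commute)
      ultimately show ?thesis unfolding ck by simp
    qed
    then show "nilpotent_win \<sigma>' (\<alpha> ` J) W'" unfolding nil' using V' by blast
  next
    assume "nilpotent_win \<sigma>' (\<alpha> ` J) W'"
    then obtain V' N where V': "is_Vsharp \<sigma>' W' V'"
      and N: "\<And>k x i. k \<ge> N \<Longrightarrow> x \<in> wP W' \<Longrightarrow> vpow \<sigma>' n' (\<lambda>j. V' (e' j)) k x i \<in> \<alpha> ` J" unfolding nil' by blast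
    obtain V where V: "is_Vsharp \<sigma> W V" using S.Vsharp_exists[OF W] by blast
    \<comment> \<open>\<open>\<kappa>\<close> identifies \<open>P'\<close> with the coordinatewise
      image of \<open>P\<close>. It recovers the coordinates of an iterate over \<open>S\<close>,
      modulo the kernel, from the iterate over \<open>S'\<close>.\<close>
    obtain \<kappa> where \<kappa>: "lin_on id (wP W') \<kappa>" "\<And>x. x \<in> wP W \<Longrightarrow> \<kappa> (\<iota> x) = \<alpha> \<circ> x"
      using reduction_descend[OF W red lin_on_comp_hom[OF \<alpha>_hom]] by blast
    have "vpow \<sigma> n (\<lambda>j. V (e j)) k x i \<in> J" if k: "k \<ge> N" and x: "x \<in> wP W" for k x i
    proof -
      let ?s = "\<sigma>' ^^ k" and ?z = "vpow \<sigma> n (\<lambda>j. V (e j)) k x"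
      let ?l = "lcomb n (\<alpha> \<circ> ?z) (\<lambda>j. ?s \<circ> \<iota> (e j))"
      note shom = S'.hom_funpow[of k]
      have l: "?l i \<in> \<alpha> ` J" for i
        unfolding reduction_vpow[OF W red db db' V V' x] sc_apply
        by (rule is_idealD(3)[OF \<alpha>_J_ideal N[OF k \<iota>(1)[OF x]]])
      have "lcomb n' ?l (\<lambda>l. ?s \<circ> \<kappa> (e' l)) i \<in> \<alpha> ` J"
        by (rule lcomb_coords_in[OF \<alpha>_J_ideal]) (rule l)
      moreover have "lcomb n' ?l (\<lambda>l. ?s \<circ> \<kappa> (e' l)) = \<alpha> \<circ> ?z"
      proof -
        have "lcomb n' (?s \<circ> \<iota> (e j)) (\<lambda>l. ?s \<circ> \<kappa> (e' l)) = \<alpha> \<circ> ((\<sigma> ^^ k) \<circ> e j)" if j: "j < n" for j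
        proof -
          have ej: "e j \<in> wP W" "\<iota> (e j) \<in> wP W'" using dbasisD(2)[OF db j] \<iota>(1) by auto
          have "lcomb n' (?s \<circ> \<iota> (e j)) (\<lambda>l. ?s \<circ> \<kappa> (e' l)) = ?s \<circ> \<kappa> (\<iota> (e j))"
            unfolding comp_lcomb[OF shom, symmetric]
            using dbasis_lin_on[OF db' \<kappa>(1) ring_hom'_id ej(2)] by simp
          then show ?thesis unfolding \<kappa>(2)[OF ej(1)] \<sigma>'_\<alpha>_vec .
        qed
        then have "lcomb n' ?l (\<lambda>l. ?s \<circ> \<kappa> (e' l)) = lcomb n (\<alpha> \<circ> ?z) (\<lambda>j. \<alpha> \<circ> ((\<sigma> ^^ k) \<circ> e j))"
          unfolding lcomb_lcomb by (intro lcomb_cong) auto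
        also have "\<dots> = \<alpha> \<circ> lcomb n ?z (\<lambda>j. (\<sigma> ^^ k) \<circ> e j)" unfolding comp_lcomb[OF \<alpha>_hom] ..
        also have "lcomb n ?z (\<lambda>j. (\<sigma> ^^ k) \<circ> e j) = ?z"
        proof (rule dbasisD(3)[OF dbasis_bchg[OF db S.hom_funpow]])
          show "?z \<in> bchg (\<sigma> ^^ k) (wP W)"
            by (rule vpow_in_bchg[OF S.hom _ x]) (use V dbasisD(2)[OF db] in \<open>auto simp: is_Vsharp_def\<close>)
        qed
        finally show ?thesis .
      qed
      ultimately have "\<alpha> (?z i) \<in> \<alpha> ` J" by (simp add: o_apply)
      then show ?thesis by (rule \<alpha>_image_J)
    qed
    then show "nilpotent_win \<sigma> J W" unfolding nil using V by blast
  qed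
qed

text \<open>One bound \<open>K\<close> serves all sequences \<open>\<delta>\<close>. The iteration
  of lifts applies it to successive differences, the uniqueness proof to a constant
  sequence.\<close>

lemma nilpotent_contraction:
  assumes W1: "window I \<sigma> \<sigma>1 W1" and nil: "nilpotent_win \<sigma> J W1" and W2: "window I \<sigma> \<sigma>1 W2"
  shows "\<exists>K. \<forall>\<delta>. (\<forall>k. lin_on id (wP W1) (\<delta> k) \<and>
      (\<forall>x\<in>wP W1. \<delta> k x \<in> wP W2 \<and> (\<forall>i. \<alpha> (\<delta> k x i) = 0)) \<and>
      (\<forall>x\<in>wQ W1. \<delta> (Suc k) (wF1 W1 x) = wF1 W2 (\<delta> k x))) \<longrightarrow> (\<forall>x\<in>wP W1. \<delta> K x = 0)"
proof -
  obtain n e where db: "dbasis n e (wP W1)" using S.window_dbasis[OF W1] by blast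
  obtain V N where V: "is_Vsharp \<sigma> W1 V"
    and N: "\<forall>k\<ge>N. \<forall>x\<in>wP W1. \<forall>i. vpow \<sigma> n (\<lambda>j. V (e j)) k x i \<in> J"
    using nil unfolding nilpotent_win_iff[OF db S.hom J_ideal] by blast
  have "\<exists>K. \<forall>x\<in>wP W1. \<forall>i. vpow \<sigma> n (\<lambda>j. V (e j)) K x i \<in> ipow J m"
    by (rule vpow_ipow[OF db S.hom _ J_ideal J_\<sigma>, where N = N])
      (use V N dbasisD(2)[OF db] in \<open>auto simp: is_Vsharp_def\<close>)
  then obtain K where K: "\<And>x i. x \<in> wP W1 \<Longrightarrow> vpow \<sigma> n (\<lambda>j. V (e j)) K x i \<in> ipow J m" by blast
  \<comment> \<open>\<open>M\<close> is \<open>\<aa>P\<^sub>2\<close>. It lies in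
    \<open>Q\<^sub>2\<close> because the kernel is contained in \<open>I\<close>, and
    \<open>F\<^sub>1\<close> maps it to itself.\<close>
  define M where "M = {y \<in> wP W2. \<forall>i. \<alpha> (y i) = 0}"
  note P2 = submodD[OF S.submod_wP[OF W2]]
  have M: "submod M"
    unfolding M_def submod_def using P2 by (auto simp: vec_apply \<alpha>_simps)
  have MQ: "M \<subseteq> wQ W2" unfolding M_def using S.I_wP_subset_wQ[OF W2] ker_I by auto
  have F1M: "wF1 W2 y \<in> M" if "y \<in> M" for y
    using that wF1_ker[OF W2] S.windowD(4)[OF W2] MQ unfolding M_def by auto
  have F1lin: "lin_on \<sigma> M (wF1 W2)" using lin_on_subset[OF S.windowD(5)[OF W2] MQ] .
  show ?thesis
  proof (intro exI allI impI ballI)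
    fix \<delta> x
    assume \<delta>: "\<forall>k. lin_on id (wP W1) (\<delta> k) \<and>
      (\<forall>x\<in>wP W1. \<delta> k x \<in> wP W2 \<and> (\<forall>i. \<alpha> (\<delta> k x i) = 0)) \<and>
      (\<forall>x\<in>wQ W1. \<delta> (Suc k) (wF1 W1 x) = wF1 W2 (\<delta> k x))" and x: "x \<in> wP W1"
    have \<delta>M: "\<delta> k x \<in> M" if "x \<in> wP W1" for k x using \<delta> that unfolding M_def by auto
    have "\<delta> (K + 0) x = lcomb n (vpow \<sigma> n (\<lambda>j. V (e j)) K x) (\<lambda>j. (wF1 W2 ^^ K) (\<delta> 0 (e j)))"
      by (rule S.contraction[OF W1 db V M F1lin F1M _ \<delta>M _ x]) (use \<delta> in auto)
    moreover have "(wF1 W2 ^^ k) y \<in> M" if "y \<in> M" for k y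
      using that F1M by (induction k) (auto simp: o_apply)
    \<comment> \<open>Coefficients in \<open>J^m\<close> meet entries in the kernel, and
      \<open>J^m\<close> annihilates the kernel.\<close>
    then have "vpow \<sigma> n (\<lambda>j. V (e j)) K x j * (wF1 W2 ^^ K) (\<delta> 0 (e j)) i = 0" if "j < n" for i j
      using ipow_ker[OF K[OF x]] \<delta>M[OF dbasisD(2)[OF db that]] unfolding M_def by blast
    ultimately show "\<delta> K x = 0" by (simp add: lcomb_def fun_eq_iff zero_fun_apply)
  qed
qed

text \<open>On \<open>P\<^sub>1\<close>, the window homomorphisms above \<open>h\<close> are exactly
  the linear lifts fixed by the operator \<open>U\<close>, and the contraction provides one and only
  one such lift.\<close>

lemma fully_faithful:
  assumes W1: "window I \<sigma> \<sigma>1 W1" and nil: "nilpotent_win \<sigma> J W1" and W2: "window I \<sigma> \<sigma>1 W2"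
    and red1: "reduction W1 W1' \<iota>1" and red2: "reduction W2 W2' \<iota>2"
    and h: "win_mor id 1 W1' W2' h"
  shows "\<exists>f. win_mor id 1 W1 W2 f \<and> (\<forall>x\<in>wP W1. h (\<iota>1 x) = \<iota>2 (f x)) \<and>
    (\<forall>f'. win_mor id 1 W1 W2 f' \<and> (\<forall>x\<in>wP W1. h (\<iota>1 x) = \<iota>2 (f' x)) \<longrightarrow> (\<forall>x\<in>wP W1. f' x = f x))"
proof -
  note P1 = S.submod_wP[OF W1] and P2 = S.submod_wP[OF W2] and Q2 = S.submod_wQ[OF W2]
    and W1D = S.windowD[OF W1] and W2D = S.windowD[OF W2]
    and \<iota>1 = win_morD[OF reductionD(2)[OF red1]] and \<iota>2 = win_morD[OF reductionD(2)[OF red2]]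
    and hD = win_morD[OF h] and P2' = S'.submod_wP[OF reductionD(1)[OF red2]]
    and P1' = S'.submod_wP[OF reductionD(1)[OF red1]]
  note \<iota>2lin = lin_onD[OF \<iota>2(2) P2 \<alpha>_hom]
  obtain n e where db: "dbasis n e (wP W1)" using S.window_dbasis[OF W1] by blast
  define lifts where "lifts f \<longleftrightarrow> lin_on id (wP W1) f \<and> (\<forall>x\<in>wP W1. f x \<in> wP W2 \<and> \<iota>2 (f x) = h (\<iota>1 x))" for f
  have h\<iota>_lin: "lin_on \<alpha> (wP W1) (\<lambda>x. h (\<iota>1 x))" using lin_on_compose[OF \<iota>1(2) hD(2) \<iota>1(1)] by simp
  \<comment> \<open>Compare \<open>f x\<close> with an element \<open>q\<close> of
    \<open>Q\<^sub>2\<close> having the same image: their difference lies in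
    \<open>\<aa>P\<^sub>2\<close>, hence in \<open>Q\<^sub>2\<close>.\<close>
  have lifts_Q: "f x \<in> wQ W2" if f: "lifts f" and x: "x \<in> wQ W1" for f x
  proof -
    have xP: "x \<in> wP W1" using W1D(1) x by auto
    have fx: "f x \<in> wP W2" "\<iota>2 (f x) = h (\<iota>1 x)" using f xP by (auto simp: lifts_def)
    have "h (\<iota>1 x) \<in> \<iota>2 ` wQ W2" using hD(3)[OF \<iota>1(3)[OF x]] reductionD(4)[OF red2] by simp
    then obtain q where q: "q \<in> wQ W2" "\<iota>2 (f x) = \<iota>2 q" using fx(2) by auto
    then have qP: "q \<in> wP W2" using W2D(1) by auto
    have "f x - q \<in> wQ W2"
      by (rule S.I_wP_subset_wQ[OF W2 submodD(5)[OF P2 fx(1) qP] ker_I[OF reduction_diff[OF W2 red2 fx(1) qP q(2)]]])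
    then show ?thesis using submodD(2)[OF Q2 _ q(1)] by fastforce
  qed
  have "\<exists>g. lifts g \<and> (\<forall>x\<in>wQ W1. g (wF1 W1 x) = wF1 W2 (f x)) \<and> (\<forall>x\<in>wP W1. g (wF W1 x) = wF W2 (f x))"
    if f: "lifts f" for f
  proof -
    have flin: "lin_on id (wP W1) f" and fP: "\<And>x. x \<in> wP W1 \<Longrightarrow> f x \<in> wP W2"
      and f\<iota>: "\<And>x. x \<in> wP W1 \<Longrightarrow> \<iota>2 (f x) = h (\<iota>1 x)" using f by (auto simp: lifts_def)
    have "\<exists>g. lin_on id (wP W1) g \<and> (\<forall>x\<in>wP W1. g x \<in> wP W2) \<and>
        (\<forall>x\<in>wQ W1. g (wF1 W1 x) = wF1 W2 (f x)) \<and> (\<forall>x\<in>wP W1. g (wF W1 x) = wF W2 (f x))"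
    proof (rule S.window_universal[OF W1 _ _ _ P2])
      show "lin_on \<sigma> (wQ W1) (\<lambda>x. wF1 W2 (f x))"
        using lin_on_compose[OF lin_on_subset[OF flin W1D(1)] W2D(5) lifts_Q[OF f]] by simp
      show "lin_on \<sigma> (wP W1) (\<lambda>x. wF W2 (f x))" using lin_on_compose[OF flin W2D(3) fP] by simp
      show "wF1 W2 (f (sc a x)) = sc (\<sigma>1 a) (wF W2 (f x))" if "a \<in> I" "x \<in> wP W1" for a x
        using lin_onD(2)[OF flin P1 ring_hom'_id that(2)] W2D(6)[OF that(1) fP[OF that(2)]] by simp
    qed (use W2D(2,4) fP lifts_Q[OF f] in auto)
    then obtain g where g: "lin_on id (wP W1) g" "\<And>x. x \<in> wP W1 \<Longrightarrow> g x \<in> wP W2"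
      "\<And>x. x \<in> wQ W1 \<Longrightarrow> g (wF1 W1 x) = wF1 W2 (f x)" "\<forall>x\<in>wP W1. g (wF W1 x) = wF W2 (f x)" by blast
    \<comment> \<open>The new map still lifts \<open>h\<close>: on generators
      \<open>F\<^sub>1 q\<close> both sides agree after multiplication by \<open>u\<close>, because
      \<open>h\<close> commutes with \<open>F\<^sub>1\<close>.\<close>
    have "\<iota>2 (g x) = h (\<iota>1 x)" if x: "x \<in> wP W1" for x
    proof (rule lin_on_eq_on_mspan[OF _ h\<iota>_lin P1 \<alpha>_hom])
      show "lin_on \<alpha> (wP W1) (\<lambda>x. \<iota>2 (g x))" using lin_on_compose[OF g(1) \<iota>2(2) g(2)] by simp
      show "x \<in> mspan (wF1 W1 ` wQ W1)" "wF1 W1 ` wQ W1 \<subseteq> wP W1" using x W1D(4,7) by auto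
      fix y assume "y \<in> wF1 W1 ` wQ W1"
      then obtain q where q: "q \<in> wQ W1" "y = wF1 W1 q" by auto
      have qP: "q \<in> wP W1" using W1D(1) q(1) by auto
      have "sc u (\<iota>2 (g y)) = wF1 W2' (\<iota>2 (f q))"
        unfolding q(2) g(3)[OF q(1)] using \<iota>2(5)[OF lifts_Q[OF f q(1)]] by simp
      also have "\<dots> = h (sc u (\<iota>1 y))"
        using f\<iota>[OF qP] hD(5)[OF \<iota>1(3)[OF q(1)]] \<iota>1(5)[OF q(1)] q(2) by simp
      also have "\<dots> = sc u (h (\<iota>1 y))"
        using lin_onD(2)[OF hD(2) P1' ring_hom'_id \<iota>1(1)[OF W1D(4)[OF q(1)]]] q(2) by simp
      finally have "sc ui (sc u (\<iota>2 (g y))) = sc ui (sc u (h (\<iota>1 y)))" by simp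
      then show "\<iota>2 (g y) = h (\<iota>1 y)" by simp
    qed
    then show ?thesis using g unfolding lifts_def by blast
  qed
  then obtain U where U: "\<And>f. lifts f \<Longrightarrow> lifts (U f)"
    "\<And>f x. lifts f \<Longrightarrow> x \<in> wQ W1 \<Longrightarrow> U f (wF1 W1 x) = wF1 W2 (f x)"
    "\<And>f x. lifts f \<Longrightarrow> x \<in> wP W1 \<Longrightarrow> U f (wF W1 x) = wF W2 (f x)"
    by metis
  have diff: "lin_on id (wP W1) (\<lambda>x. f x - g x) \<and>
      (\<forall>x\<in>wP W1. f x - g x \<in> wP W2 \<and> (\<forall>i. \<alpha> ((f x - g x) i) = 0)) \<and>
      (\<forall>x\<in>wQ W1. wF1 W2 (f x) - wF1 W2 (g x) = wF1 W2 (f x - g x))"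
    if f: "lifts f" and g: "lifts g" for f g
  proof (intro conjI ballI allI)
    show "lin_on id (wP W1) (\<lambda>x. f x - g x)" using f g by (auto simp: lifts_def intro: lin_on_diff)
    show "wF1 W2 (f x) - wF1 W2 (g x) = wF1 W2 (f x - g x)" if "x \<in> wQ W1" for x
      using lin_onD(5)[OF W2D(5) Q2 S.hom lifts_Q[OF f that] lifts_Q[OF g that]] by simp
    fix x assume x: "x \<in> wP W1"
    then have fg: "f x \<in> wP W2" "g x \<in> wP W2" "\<iota>2 (f x) = \<iota>2 (g x)" using f g by (auto simp: lifts_def)
    show "f x - g x \<in> wP W2" using submodD(5)[OF P2 fg(1,2)] .
    show "\<alpha> ((f x - g x) i) = 0" for i by (rule reduction_diff[OF W2 red2 fg])
  qed
  obtain K where K: "\<And>\<delta>. (\<forall>k. lin_on id (wP W1) (\<delta> k) \<and>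
      (\<forall>x\<in>wP W1. \<delta> k x \<in> wP W2 \<and> (\<forall>i. \<alpha> (\<delta> k x i) = 0)) \<and>
      (\<forall>x\<in>wQ W1. \<delta> (Suc k) (wF1 W1 x) = wF1 W2 (\<delta> k x))) \<Longrightarrow> (\<forall>x\<in>wP W1. \<delta> K x = 0)"
    using nilpotent_contraction[OF W1 nil W2] by blast
  \<comment> \<open>The initial lift: choose preimages of the images of the dual basis and extend by
    coordinates, ignoring \<open>F\<close> and \<open>F\<^sub>1\<close>.\<close>
  have "\<forall>j<n. \<exists>y\<in>wP W2. \<iota>2 y = h (\<iota>1 (e j))"
    using hD(1) \<iota>1(1) dbasisD(2)[OF db] reductionD(3)[OF red2] by (metis imageE)
  then obtain y where y: "\<And>j. j < n \<Longrightarrow> y j \<in> wP W2 \<and> \<iota>2 (y j) = h (\<iota>1 (e j))" by metis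
  define f0 where "f0 = (\<lambda>x. lcomb n x y)"
  have f0: "lifts f0"
    unfolding lifts_def
  proof (intro conjI ballI)
    show "lin_on id (wP W1) f0" unfolding f0_def by (rule lin_on_id_lcomb)
    fix x assume x: "x \<in> wP W1"
    show "f0 x \<in> wP W2" unfolding f0_def by (rule submod_lcomb[OF P2]) (use y in auto)
    have "\<iota>2 (f0 x) = lcomb n (\<alpha> \<circ> x) (\<lambda>j. \<iota>2 (y j))" unfolding f0_def by (rule \<iota>2lin(6)) (use y in auto)
    also have "\<dots> = lcomb n (\<alpha> \<circ> x) (\<lambda>j. h (\<iota>1 (e j)))" by (rule lcomb_cong) (use y in auto)
    also have "\<dots> = h (\<iota>1 x)" using dbasis_lin_on[OF db h\<iota>_lin \<alpha>_hom x] by simp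
    finally show "\<iota>2 (f0 x) = h (\<iota>1 x)" .
  qed
  define fk where "fk k = (U ^^ k) f0" for k
  have fk: "lifts (fk k)" "fk (Suc k) = U (fk k)" for k
    unfolding fk_def by (induction k) (auto simp: f0 U(1) o_apply)
  have fk_F1: "fk (Suc k) (wF1 W1 x) = wF1 W2 (fk k x)" if "x \<in> wQ W1" for k x
    unfolding fk(2) by (rule U(2)[OF fk(1) that])
  \<comment> \<open>Successive differences of the iterates form a sequence of maps into
    \<open>\<aa>P\<^sub>2\<close> of the contracting kind, so the iteration is stationary at
    \<open>K\<close>.\<close>
  have "\<forall>x\<in>wP W1. fk (Suc K) x - fk K x = 0"
    by (rule K[of "\<lambda>k x. fk (Suc k) x - fk k x"]) (use diff[OF fk(1) fk(1)] fk_F1 in auto)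
  then have fix_K: "U (fk K) x = fk K x" if "x \<in> wP W1" for x using that fk(2)[of K] by simp
  \<comment> \<open>For a fixed point, \<open>U f \<circ> F\<^sub>1 = F\<^sub>1 \<circ> f\<close>
    and its analogue for \<open>F\<close> are the commutation rules of a morphism.\<close>
  have mor: "win_mor id 1 W1 W2 (fk K)"
    unfolding win_mor_def
    using fk(1)[of K] lifts_Q[OF fk(1)] fix_K[OF W1D(2)] fix_K[OF W1D(4)] U(2,3)[OF fk(1)]
    by (auto simp: lifts_def)
  have uniq: "f' x = fk K x" if f': "win_mor id 1 W1 W2 f'" "\<forall>x\<in>wP W1. h (\<iota>1 x) = \<iota>2 (f' x)" and x: "x \<in> wP W1" for f' x
  proof -
    note f'D = win_morD[OF f'(1)] and kD = win_morD[OF mor]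
    have l: "lifts f'" unfolding lifts_def using f'D f'(2) by auto
    \<comment> \<open>The difference of two homomorphisms commutes with \<open>F\<^sub>1\<close>, so
      the constant sequence satisfies the hypotheses of the contraction.\<close>
    have "\<forall>x\<in>wP W1. f' x - fk K x = 0"
      by (rule K[of "\<lambda>_ x. f' x - fk K x"])
        (use diff[OF l fk(1)[of K]] f'D(5) kD(5) in auto)
    then show ?thesis using x by simp
  qed
  show ?thesis
  proof (intro exI[of _ "fk K"] conjI allI impI ballI)
    show "win_mor id 1 W1 W2 (fk K)" by (rule mor)
    show "h (\<iota>1 x) = \<iota>2 (fk K x)" if "x \<in> wP W1" for x
      using fk(1)[of K] that by (auto simp: lifts_def)
  qed (use uniq in blast)
qed

end

section \<open>Direct sums in disjoint blocks of coordinates\<close>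

definition shift :: "nat \<Rightarrow> (nat \<Rightarrow> 'a::comm_ring_1) \<Rightarrow> nat \<Rightarrow> 'a" where
  "shift a y = (\<lambda>i. if i < a then 0 else y (i - a))"

lemma shift_simps: "shift a 0 = 0" "shift a (x + y) = shift a x + shift a y" "shift a (sc s x) = sc s (shift a x)"
  by (auto simp: shift_def fun_eq_iff vec_apply)

lemma shift_lcomb: "shift a (lcomb n c v) = lcomb n c (\<lambda>j. shift a (v j))"
  by (auto simp: shift_def lcomb_def fun_eq_iff)

lemma submod_shift:
  assumes "submod T"
  shows "submod (shift a ` T)"
proof (rule submod_image[OF surj_id _ assms ring_hom'_id])
  show "lin_on id T (shift a)" by (simp add: lin_on_def shift_simps)
qed

context frame_lift
begin

section \<open>Lifting windows\<close>

text \<open>Since \<open>\<alpha>\<close> is onto, the span of the reduced vectors is just their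
  set. The isomorphism with \<open>P'\<close> therefore becomes an \<open>\<alpha>\<close>-linear
  surjection from \<open>P\<close> whose kernel consists of vectors with coordinates in the kernel
  of \<open>\<alpha>\<close>.\<close>

lemma lift_dbasis:
  assumes lift: "\<forall>P' :: (nat \<Rightarrow> 'b) set. fg_proj P' \<longrightarrow>
      (\<exists>P :: (nat \<Rightarrow> 'a) set. fg_proj P \<and> (\<exists>f. lin_on id (bchg \<alpha> P) f \<and> bij_betw f (bchg \<alpha> P) P'))"
    and "fg_proj P'"
  shows "\<exists>n e P \<iota>. dbasis n e P \<and> lin_on \<alpha> P \<iota> \<and> \<iota> ` P = P' \<and> (\<forall>x\<in>P. \<iota> x = 0 \<longrightarrow> (\<forall>i. \<alpha> (x i) = 0))"
proof -
  obtain P f where P: "fg_proj P" and f: "lin_on id (bchg \<alpha> P) f" "bij_betw f (bchg \<alpha> P) P'"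
    using lift assms(2) by blast
  obtain n e where db: "dbasis n e P" using fg_proj_imp_dbasis[OF P] by blast
  have sub: "submod ((\<lambda>x. \<alpha> \<circ> x) ` P)"
    by (rule submod_image[OF surj_\<alpha> lin_on_comp_hom[OF \<alpha>_hom] dbasisD(1)[OF db] \<alpha>_hom])
  have bchg: "bchg \<alpha> P = (\<lambda>x. \<alpha> \<circ> x) ` P"
    unfolding bchg_def using mspan_subset[OF subset_refl sub] mspan_superset by (intro equalityI)
  have "lin_on \<alpha> P (\<lambda>x. f (\<alpha> \<circ> x))"
    using lin_on_compose[OF lin_on_comp_hom[OF \<alpha>_hom, of P] f(1) bchg_gen] by simp
  moreover have "(\<lambda>x. f (\<alpha> \<circ> x)) ` P = P'"
    using f(2) unfolding bij_betw_def bchg image_image by simp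
  moreover have "\<alpha> (x i) = 0" if "x \<in> P" "f (\<alpha> \<circ> x) = 0" for x i
  proof -
    have "f (\<alpha> \<circ> x) = f 0" using that(2) lin_onD(3)[OF f(1) submod_bchg ring_hom'_id] by simp
    then have "\<alpha> \<circ> x = 0"
      using f(2) bchg_gen[OF that(1)] submodD(1)[OF submod_bchg] unfolding bij_betw_def inj_on_def by blast
    then show ?thesis by (metis o_apply zero_fun_apply)
  qed
  ultimately show ?thesis using db by blast
qed

text \<open>The summands \<open>L'\<close> and \<open>T'\<close> are lifted separately and put into
  disjoint blocks of \<open>S^(a + b)\<close>. Vanishing of a block then detects \<open>L\<close>
  and \<open>T\<close>, which allows \<open>F\<close> and \<open>F\<^sub>1\<close> to be defined by
  cases on the coordinate index.\<close>

lemma lift_dbasis_sum: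
  assumes L: "dbasis a eL L0" "lin_on \<alpha> L0 \<iota>L" "\<iota>L ` L0 = L'" "\<forall>x\<in>L0. \<iota>L x = 0 \<longrightarrow> (\<forall>i. \<alpha> (x i) = 0)"
    and T: "dbasis b eT T0" "lin_on \<alpha> T0 \<iota>T" "\<iota>T ` T0 = T'" "\<forall>x\<in>T0. \<iota>T x = 0 \<longrightarrow> (\<forall>i. \<alpha> (x i) = 0)"
    and P': "dsum P' L' T'" "submod L'" "submod T'"
  shows "\<exists>e P L T \<iota>. dbasis (a + b) e P \<and> submod L \<and> submod T \<and> dsum P L T \<and> lin_on \<alpha> P \<iota> \<and>
    \<iota> ` P = P' \<and> \<iota> ` L = L' \<and> \<iota> ` T = T' \<and> (\<forall>x\<in>P. \<iota> x = 0 \<longrightarrow> (\<forall>i. \<alpha> (x i) = 0)) \<and>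
    (\<forall>j<a. e j \<in> L) \<and> (\<forall>j<b. e (a + j) \<in> T) \<and> (\<forall>x\<in>L. \<forall>j\<ge>a. x j = 0) \<and> (\<forall>x\<in>T. \<forall>j<a. x j = 0)"
proof -
  note LD = dbasisD[OF L(1)] and TD = dbasisD[OF T(1)]
  define e where "e = (\<lambda>j. if j < a then eL j else shift a (eT (j - a)))"
  define P where "P = {x + shift a y | x y. x \<in> L0 \<and> y \<in> T0}"
  define low where "low = (\<lambda>(z :: nat \<Rightarrow> 'a) i. if i < a then z i else 0)"
  define high where "high = (\<lambda>(z :: nat \<Rightarrow> 'a) i. z (i + a))"
  define \<iota> where "\<iota> = (\<lambda>z. \<iota>L (low z) + \<iota>T (high z))"
  have low: "low (x + shift a y) = x" and high: "high (x + shift a y) = y" if "x \<in> L0" "y \<in> T0" for x y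
    using LD(4)[OF that(1)] by (auto simp: low_def high_def shift_def fun_eq_iff plus_fun_apply)
  have \<iota>: "\<iota> (x + shift a y) = \<iota>L x + \<iota>T y" if "x \<in> L0" "y \<in> T0" for x y
    unfolding \<iota>_def low[OF that] high[OF that] ..
  have lin: "lin_on id X low" "lin_on id X high" for X
    by (auto simp: lin_on_def low_def high_def fun_eq_iff vec_apply)
  have PD: "low z \<in> L0 \<and> high z \<in> T0 \<and> z = low z + shift a (high z)" if zP: "z \<in> P" for z
  proof -
    obtain x y where "x \<in> L0" "y \<in> T0" "z = x + shift a y" using zP unfolding P_def by blast
    then show ?thesis using low high by simp
  qed
  have P_intro: "x + shift a y \<in> P" if "x \<in> L0" "y \<in> T0" for x y using that unfolding P_def by blast
  have L_P: "x \<in> P" if "x \<in> L0" for x using P_intro[OF that TD(8)] by (simp add: shift_simps)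
  have T_P: "shift a y \<in> P" if "y \<in> T0" for y using P_intro[OF LD(8) that] by simp
  have \<iota>_L: "\<iota> x = \<iota>L x" if "x \<in> L0" for x
    using \<iota>[OF that TD(8)] lin_onD(3)[OF T(2) TD(1) \<alpha>_hom] by (simp add: shift_simps)
  have \<iota>_T: "\<iota> (shift a y) = \<iota>T y" if "y \<in> T0" for y
    using \<iota>[OF LD(8) that] lin_onD(3)[OF L(2) LD(1) \<alpha>_hom] by simp
  have zero: "{0} \<subseteq> L0 \<inter> shift a ` T0"
    using LD(8) TD(8) shift_simps(1) by (metis IntI empty_subsetI imageI insert_subset)
  have int: "L0 \<inter> shift a ` T0 \<subseteq> {0}"
  proof
    fix z assume "z \<in> L0 \<inter> shift a ` T0"
    then obtain y where z: "z \<in> L0" "z = shift a y" by blast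
    have "z i = 0" for i using LD(4)[OF z(1), of i] z(2) by (cases "i < a") (auto simp: shift_def)
    then show "z \<in> {0}" by (simp add: fun_eq_iff zero_fun_apply)
  qed
  have ds: "dsum P L0 (shift a ` T0)"
    unfolding dsum_def using int zero by (auto simp: P_def)
  have "submod P"
    unfolding submod_def
  proof (intro conjI ballI allI)
    show "0 \<in> P" using L_P[OF LD(8)] .
    fix z w s assume z: "z \<in> P"
    have "sc s z = sc s (low z) + shift a (sc s (high z))"
      using PD[OF z] by (metis sc_add shift_simps(3))
    then show "sc s z \<in> P" using P_intro PD[OF z] LD(6) TD(6) by simp
    assume w: "w \<in> P"
    have "z + w = (low z + shift a (high z)) + (low w + shift a (high w))" using PD[OF z] PD[OF w] by simp
    also have "\<dots> = (low z + low w) + shift a (high z + high w)" by (simp add: shift_simps algebra_simps)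
    finally show "z + w \<in> P" using P_intro PD[OF z] PD[OF w] LD(5) TD(5) by simp
  qed
  moreover have "P \<subseteq> fvec (a + b)"
  proof
    fix z assume "z \<in> P"
    then have z: "low z \<in> L0" "high z \<in> T0" "z = low z + shift a (high z)" using PD by auto
    have "z i = 0" if "i \<ge> a + b" for i
      using TD(4)[OF z(2), of "i - a"] that by (simp add: high_def)
    then show "z \<in> fvec (a + b)" by (simp add: fvec_def)
  qed
  moreover have "lcomb (a + b) z e = z" if "z \<in> P" for z
  proof -
    have z: "low z \<in> L0" "high z \<in> T0" "z = low z + shift a (high z)" using PD[OF that] by auto
    have "lcomb a (low z) eL + lcomb b (high z) (\<lambda>j. shift a (eT j)) = lcomb (a + b) z e"
      unfolding lcomb_append e_def by (rule lcomb_cong) (auto simp: low_def high_def)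
    then show ?thesis unfolding shift_lcomb[symmetric] LD(3)[OF z(1)] TD(3)[OF z(2)] z(3)[symmetric] by simp
  qed
  moreover have eL: "\<forall>j<a. e j \<in> L0" and eT: "\<forall>j<b. e (a + j) \<in> shift a ` T0"
    using LD(2) TD(2) by (auto simp: e_def)
  then have "\<forall>j<a + b. e j \<in> P"
    using L_P T_P by (metis add_diff_inverse_nat image_iff nat_add_left_cancel_less)
  ultimately have db: "dbasis (a + b) e P" by (simp add: dbasis_def)
  have \<iota>_lin: "lin_on \<alpha> P \<iota>"
    unfolding \<iota>_def
    using lin_on_plus[OF lin_on_compose[OF lin(1) L(2)] lin_on_compose[OF lin(2) T(2)]] PD by auto
  have img: "\<iota> ` L0 = L'" "\<iota> ` shift a ` T0 = T'"
    using L(3) T(3) \<iota>_L \<iota>_T by (auto simp: image_image)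
  have imgP: "\<iota> ` P = P'"
  proof (intro equalityI subsetI)
    fix y assume "y \<in> \<iota> ` P"
    then obtain x where "x \<in> P" "y = \<iota> x" by auto
    then have "y = \<iota>L (low x) + \<iota>T (high x)" "low x \<in> L0" "high x \<in> T0" using PD by (auto simp: \<iota>_def)
    then show "y \<in> P'" using P'(1) L(3) T(3) unfolding dsum_def by blast
  next
    fix y assume "y \<in> P'"
    then obtain l t where "l \<in> L0" "t \<in> T0" "y = \<iota>L l + \<iota>T t"
      using P'(1) L(3) T(3) unfolding dsum_def by blast
    then show "y \<in> \<iota> ` P" using \<iota> P_intro by (metis imageI)
  qed
  have ker: "\<alpha> (z i) = 0" if z: "z \<in> P" "\<iota> z = 0" for z i
  proof -
    have h: "low z \<in> L0" "high z \<in> T0" using PD[OF z(1)] by auto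
    have m: "\<iota>L (low z) \<in> L'" "\<iota>T (high z) \<in> T'" using h L(3) T(3) by auto
    \<comment> \<open>If the sum of the two images is zero, both lie in
      \<open>L' \<inter> T'\<close> and vanish, so the kernel can be computed blockwise.\<close>
    have eq: "\<iota>L (low z) = - \<iota>T (high z)" using z(2) unfolding \<iota>_def by (simp add: eq_neg_iff_add_eq_0)
    then have "\<iota>L (low z) \<in> L' \<inter> T'" using m submodD(4)[OF P'(3)] by simp
    then have "\<iota>L (low z) = 0" using P'(1) unfolding dsum_def by blast
    moreover from this have "\<iota>T (high z) = 0" using eq by simp
    ultimately have 0: "\<alpha> (low z i) = 0" "\<alpha> (high z i) = 0" for i using L(4) T(4) h by auto
    show ?thesis
      using 0(1)[of i] 0(2)[of "i - a"] by (cases "i < a") (auto simp: low_def high_def)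
  qed
  have ker': "\<forall>x\<in>P. \<iota> x = 0 \<longrightarrow> (\<forall>i. \<alpha> (x i) = 0)" using ker by blast
  have supp: "\<forall>x\<in>L0. \<forall>j\<ge>a. x j = 0" "\<forall>x\<in>shift a ` T0. \<forall>j<a. x j = 0"
    using LD(4) by (auto simp: shift_def)
  show ?thesis
    by (intro exI[of _ e] exI[of _ P] exI[of _ L0] exI[of _ "shift a ` T0"] exI[of _ \<iota>] conjI)
      (rule db LD(1) submod_shift[OF TD(1)] ds \<iota>_lin imgP img ker' eL eT supp)+
qed

text \<open>Nakayama for the nilpotent ideal \<open>\<aa> \<subseteq> J\<close>: each step improves the error by a factor in \<open>\<aa>\<close>.\<close>

lemma nakayama_ker:
  assumes db: "dbasis n e P" and N: "submod N" "N \<subseteq> P"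
    and approx: "\<And>x. x \<in> P \<Longrightarrow> \<exists>y\<in>N. \<forall>i. \<alpha> ((x - y) i) = 0"
  shows "P \<subseteq> N"
proof
  note dD = dbasisD[OF db]
  have "\<forall>j<n. \<exists>y. y \<in> N \<and> (\<forall>i. \<alpha> ((e j - y) i) = 0)" using approx dD(2) by blast
  then obtain y where y: "\<And>j. j < n \<Longrightarrow> y j \<in> N" "\<And>j i. j < n \<Longrightarrow> \<alpha> ((e j - y j) i) = 0" by metis
  \<comment> \<open>Correcting \<open>v\<close> by the combination of the approximants
    \<open>y j\<close> leaves an error with the old coefficients, now multiplying vectors
    \<open>e j - y j\<close> with entries in the kernel.\<close>
  have step: "\<exists>w\<in>N. x - w = lcomb n (x - v) (\<lambda>j. e j - y j)" if "x \<in> P" "v \<in> N" for x v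
  proof
    let ?z = "x - v"
    have "?z \<in> P" using that N(2) dD(7) by blast
    then have "?z = lcomb n ?z e" using dD(3) by simp
    also have "\<dots> = lcomb n ?z y + lcomb n ?z (\<lambda>j. e j - y j)"
      by (auto simp: lcomb_def fun_eq_iff vec_apply algebra_simps sum.distrib sum_subtractf)
    finally have "x - (v + lcomb n ?z y) = lcomb n ?z (\<lambda>j. e j - y j)" by (simp add: algebra_simps)
    then show "x - (v + lcomb n ?z y) = lcomb n ?z (\<lambda>j. e j - y j)" .
    show "v + lcomb n ?z y \<in> N"
      by (rule submodD(2)[OF N(1) that(2) submod_lcomb[OF N(1)]]) (use y in auto)
  qed
  fix x assume x: "x \<in> P"
  have "\<exists>w\<in>N. \<forall>i. (x - w) i \<in> ipow J k" for k
  proof (induction k)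
    case 0
    show ?case using submodD(1)[OF N(1)] by auto
  next
    case (Suc k)
    then obtain v where v: "v \<in> N" "\<And>i. (x - v) i \<in> ipow J k" by blast
    obtain w where w: "w \<in> N" "x - w = lcomb n (x - v) (\<lambda>j. e j - y j)" using step[OF x v(1)] by blast
    have "(x - w) i \<in> ipow J (Suc k)" for i
      unfolding w(2) lcomb_def
      by (rule is_ideal_sum[OF is_ideal_ipow], rule ipow_mult) (use v y(2) ker_J in auto)
    then show ?case using w(1) by blast
  qed
  \<comment> \<open>One correction after the error has reached \<open>J^m\<close> turns it into
    products from \<open>J^m \<aa>\<close>, which are zero.\<close>
  then obtain v where v: "v \<in> N" "\<And>i. (x - v) i \<in> ipow J m" by blast
  obtain w where w: "w \<in> N" "x - w = lcomb n (x - v) (\<lambda>j. e j - y j)" using step[OF x v(1)] by blast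
  have "x - w = 0"
    unfolding w(2) using ipow_ker[OF v(2)] y(2) by (simp add: lcomb_def fun_eq_iff zero_fun_apply)
  then show "x \<in> N" using w(1) by simp
qed

lemma essentially_surjective:
  assumes lift: "\<forall>P' :: (nat \<Rightarrow> 'b) set. fg_proj P' \<longrightarrow>
      (\<exists>P :: (nat \<Rightarrow> 'a) set. fg_proj P \<and> (\<exists>f. lin_on id (bchg \<alpha> P) f \<and> bij_betw f (bchg \<alpha> P) P'))"
    and W': "window I' \<sigma>' \<sigma>1' W'"
  shows "\<exists>W \<iota>. window I \<sigma> \<sigma>1 W \<and> reduction W W' \<iota>"
proof -
  obtain n' e' pL' pT' L' T' where nd: "S'.normal_decomposition W' n' e' pL' pT' L' T'"
    using S'.normal_decomposition_exists[OF W'] by blast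
  note sub' = S'.normal_decompositionD(7,8)[OF nd] and dbL' = S'.normal_decompositionD(9)[OF nd]
    and dbT' = S'.normal_decompositionD(10)[OF nd] and Q' = S'.normal_decompositionD(11)[OF nd]
    and ds' = S'.normal_decompositionD(12)[OF nd]
  note W'D = S'.windowD[OF W'] and subP' = S'.submod_wP[OF W'] and subQ' = S'.submod_wQ[OF W']
  obtain a eL L0 \<iota>L where L0: "dbasis a eL L0" "lin_on \<alpha> L0 \<iota>L" "\<iota>L ` L0 = L'"
    "\<forall>x\<in>L0. \<iota>L x = 0 \<longrightarrow> (\<forall>i. \<alpha> (x i) = 0)"
    using lift_dbasis[OF lift dbasis_imp_fg_proj[OF dbL']] by blast
  obtain b eT T0 \<iota>T where T0: "dbasis b eT T0" "lin_on \<alpha> T0 \<iota>T" "\<iota>T ` T0 = T'"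
    "\<forall>x\<in>T0. \<iota>T x = 0 \<longrightarrow> (\<forall>i. \<alpha> (x i) = 0)"
    using lift_dbasis[OF lift dbasis_imp_fg_proj[OF dbT']] by blast
  let ?N = "a + b"
  obtain e P L T \<iota> where db: "dbasis ?N e P" and LT: "submod L" "submod T" "dsum P L T"
    and \<iota>_lin: "lin_on \<alpha> P \<iota>" and img: "\<iota> ` P = wP W'" "\<iota> ` L = L'" "\<iota> ` T = T'"
    and ker: "\<forall>x\<in>P. \<iota> x = 0 \<longrightarrow> (\<forall>i. \<alpha> (x i) = 0)"
    and eL: "\<forall>j<a. e j \<in> L" and eT: "\<forall>j<b. e (a + j) \<in> T"
    and L_0: "\<forall>x\<in>L. \<forall>j\<ge>a. x j = 0" and T_0: "\<forall>x\<in>T. \<forall>j<a. x j = 0"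
    using lift_dbasis_sum[OF L0 T0 ds' dbasisD(1)[OF dbL'] dbasisD(1)[OF dbT']]
    by (elim exE conjE) (rule that, assumption+)
  note dD = dbasisD[OF db] and \<iota>D = lin_onD[OF \<iota>_lin dbasisD(1)[OF db] \<alpha>_hom]
  obtain pL pT where p: "\<forall>x\<in>P. pL x \<in> L \<and> pT x \<in> T \<and> x = pL x + pT x"
    and sub: "L \<subseteq> P" "T \<subseteq> P" and dbT: "dbasis ?N (\<lambda>j. pT (e j)) T"
    using dbasis_summand[OF db LT] by blast
  have LQ': "y \<in> wQ W'" if "y \<in> L'" for y
    unfolding Q' using that dbasisD(8)[OF dbT'] is_idealD(1)[OF S'.ideal_I]
    by (intro exI[of _ y] exI[of _ 0]) (simp add: zero_fun_apply)
  \<comment> \<open>The prescribed values: \<open>F\<^sub>1\<close> where the dual basis vector lies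
    in \<open>L\<close>, \<open>F\<close> where it lies in \<open>T\<close>.\<close>
  define G' where "G' = (\<lambda>j. if j < a then wF1 W' (\<iota> (e j)) else wF W' (\<iota> (e j)))"
  have e_img: "\<iota> (e j) \<in> wP W'" if "j < ?N" for j using dD(2)[OF that] img(1) by blast
  have eL_img: "\<iota> (e j) \<in> wQ W'" if "j < a" for j using eL img(2) LQ' that by blast
  \<comment> \<open>The inverse of \<open>u\<close> anticipates the factor \<open>u\<close> in the
    compatibility of \<open>F\<^sub>1\<close> with \<open>\<iota>\<close>; \<open>F\<close> commutes
    with \<open>\<iota>\<close> without a factor.\<close>
  have "\<exists>y\<in>P. \<iota> y = (if j < a then sc ui (G' j) else G' j)" if j: "j < ?N" for j
  proof -
    have "(if j < a then sc ui (G' j) else G' j) \<in> wP W'"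
      using W'D(2)[OF e_img[OF j]] W'D(4)[OF eL_img] submodD(3)[OF subP'] by (auto simp: G'_def)
    then show ?thesis using img(1) by (metis imageE)
  qed
  then obtain g where g: "\<And>j. j < ?N \<Longrightarrow> g j \<in> P"
    "\<And>j. j < ?N \<Longrightarrow> \<iota> (g j) = (if j < a then sc ui (G' j) else G' j)" by metis
  \<comment> \<open>On \<open>L\<close> the relation \<open>F = \<theta> F\<^sub>1\<close> forces
    the factor \<open>\<theta>\<close>, and on \<open>T\<close> the coordinates lie in
    \<open>I\<close>, so \<open>F\<^sub>1\<close> sees them through \<open>\<sigma>1\<close>. Since
    \<open>e\<close> is only a dual basis, \<open>g j\<close> need not be the value at
    \<open>e j\<close>; the formulas are in coordinates and need no choice of
    representation.\<close>
  define cF where "cF = (\<lambda>z j. if j < a then S.\<theta> * \<sigma> (z j) else \<sigma> (z j))"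
  define cF1 where "cF1 = (\<lambda>z j. if j < a then \<sigma> (z j) else \<sigma>1 (z j))"
  \<comment> \<open>Elements of \<open>L\<close> vanish in the coordinates from \<open>a\<close> on
    and elements of \<open>T\<close> in those below \<open>a\<close>, so this is
    \<open>L + I T\<close>.\<close>
  define Q where "Q = {z \<in> P. \<forall>j\<ge>a. z j \<in> I}"
  define W where "W = \<lparr>wP = P, wQ = Q, wF = (\<lambda>z. lcomb ?N (cF z) g), wF1 = (\<lambda>z. lcomb ?N (cF1 z) g)\<rparr>"
  have W_simps: "wP W = P" "wQ W = Q" "wF W = (\<lambda>z. lcomb ?N (cF z) g)" "wF1 W = (\<lambda>z. lcomb ?N (cF1 z) g)"
    by (simp_all add: W_def)
  have inP: "lcomb ?N c g \<in> P" for c by (rule submod_lcomb[OF dD(1)]) (rule g)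
  note hom = ring_hom'_simps[OF S.hom]
  have cF_lin: "cF (x + y) = cF x + cF y" "cF (sc s x) = sc (\<sigma> s) (cF x)" for x y s
    by (auto simp: cF_def fun_eq_iff vec_apply hom algebra_simps)
  have cF1_add: "lcomb ?N (cF1 (x + y)) g = lcomb ?N (cF1 x) g + lcomb ?N (cF1 y) g" if "x \<in> Q" "y \<in> Q" for x y
    unfolding lcomb_add[symmetric]
    by (rule lcomb_cong) (use that S.\<sigma>1_add in \<open>auto simp: cF1_def Q_def vec_apply hom\<close>)
  have cF1_sc: "lcomb ?N (cF1 (sc s x)) g = sc (\<sigma> s) (lcomb ?N (cF1 x) g)" if "x \<in> Q" for x s
    unfolding lcomb_sc[symmetric]
    by (rule lcomb_cong) (use that S.\<sigma>1_mult in \<open>auto simp: cF1_def Q_def vec_apply hom\<close>)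
  have Q_eq: "Q = {l + t |l t. l \<in> L \<and> t \<in> imult I T}"
    unfolding imult_iff[OF dbT S.ideal_I]
  proof (intro Set.set_eqI iffI)
    fix z assume z: "z \<in> Q"
    then have zp: "pL z \<in> L" "pT z \<in> T" "z = pL z + pT z" using p by (auto simp: Q_def)
    have "pT z i \<in> I" for i
    proof (cases "i < a")
      case True
      then show ?thesis using T_0 zp(2) is_idealD(1)[OF S.ideal_I] by auto
    next
      case False
      then have "z i = pT z i" using fun_cong[OF zp(3), of i] L_0 zp(1) by (simp add: plus_fun_apply)
      moreover have "z i \<in> I" using z False by (auto simp: Q_def)
      ultimately show ?thesis by simp
    qed
    then show "z \<in> {l + t |l t. l \<in> L \<and> t \<in> T \<and> (\<forall>i. t i \<in> I)}" using zp by blast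
  next
    fix z assume "z \<in> {l + t |l t. l \<in> L \<and> t \<in> T \<and> (\<forall>i. t i \<in> I)}"
    then obtain l t where "l \<in> L" "t \<in> T" "\<And>i. t i \<in> I" "z = l + t" by blast
    moreover from this have "l + t \<in> P" using sub by (intro dD(5)) auto
    ultimately show "z \<in> Q" using L_0 by (auto simp: Q_def plus_fun_apply)
  qed
  have \<iota>_lcomb: "\<iota> (lcomb ?N c g) = lcomb ?N (\<alpha> \<circ> c) (\<lambda>j. \<iota> (g j))" for c by (rule \<iota>D(6)) (rule g)
  have \<iota>_coord: "\<iota> z = lcomb ?N (\<alpha> \<circ> z) (\<lambda>j. \<iota> (e j))" if "z \<in> P" for z
    by (rule dbasis_lin_on[OF db \<iota>_lin \<alpha>_hom that])
  have \<iota>_F: "wF W' (\<iota> z) = \<iota> (lcomb ?N (cF z) g)" if z: "z \<in> P" for z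
  proof -
    have "wF W' (\<iota> z) = lcomb ?N (\<alpha> \<circ> cF z) (\<lambda>j. \<iota> (g j))"
      unfolding \<iota>_coord[OF z]
    proof (rule additive_lcomb[OF W'D(3) subP' S'.hom])
      fix j assume j: "j < ?N"
      show "sc ((\<alpha> \<circ> z) j) (\<iota> (e j)) \<in> wP W'" using submodD(3)[OF subP' e_img[OF j]] .
      have "wF W' (sc ((\<alpha> \<circ> z) j) (\<iota> (e j))) = sc (\<alpha> (\<sigma> (z j))) (wF W' (\<iota> (e j)))"
        using lin_onD(2)[OF W'D(3) subP' S'.hom e_img[OF j]] by (simp add: o_apply \<sigma>'_\<alpha>)
      also have "\<dots> = sc ((\<alpha> \<circ> cF z) j) (\<iota> (g j))"
      proof (cases "j < a")
        case True
        then show ?thesis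
          using S'.wF_on_wQ[OF W' eL_img[OF True]] g(2)[OF j]
          by (simp add: o_apply cF_def G'_def \<theta>'_eq \<alpha>_simps mult.commute mult.left_commute)
      qed (use g(2)[OF j] in \<open>simp add: o_apply cF_def G'_def\<close>)
      finally show "wF W' (sc ((\<alpha> \<circ> z) j) (\<iota> (e j))) = sc ((\<alpha> \<circ> cF z) j) (\<iota> (g j))" .
    qed
    then show ?thesis unfolding \<iota>_lcomb .
  qed
  have \<iota>_F1: "wF1 W' (\<iota> z) = sc u (\<iota> (lcomb ?N (cF1 z) g))" if z: "z \<in> Q" for z
  proof -
    have zP: "z \<in> P" and zI: "\<And>j. j \<ge> a \<Longrightarrow> z j \<in> I" using z by (auto simp: Q_def)
    have "wF1 W' (\<iota> z) = lcomb ?N (sc u (\<alpha> \<circ> cF1 z)) (\<lambda>j. \<iota> (g j))"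
      unfolding \<iota>_coord[OF zP]
    proof (rule additive_lcomb[OF W'D(5) subQ' S'.hom])
      fix j assume j: "j < ?N"
      show "sc ((\<alpha> \<circ> z) j) (\<iota> (e j)) \<in> wQ W'"
        by (cases "j < a") (auto simp: o_apply \<alpha>_I zI
            intro: submodD(3)[OF subQ' eL_img] S'.sc_I_wQ[OF W' _ e_img[OF j]])
      show "wF1 W' (sc ((\<alpha> \<circ> z) j) (\<iota> (e j))) = sc (sc u (\<alpha> \<circ> cF1 z) j) (\<iota> (g j))"
      proof (cases "j < a")
        case True
        have "u * (\<alpha> (\<sigma> (z j)) * ui) = \<alpha> (\<sigma> (z j))" by (metis mult.left_commute mult.right_neutral u_ui(1))
        then show ?thesis
          using lin_onD(2)[OF W'D(5) subQ' S'.hom eL_img[OF True]] g(2)[OF j] True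
          by (simp add: vec_apply cF1_def G'_def \<sigma>'_\<alpha> mult.assoc)
      next
        case False
        then show ?thesis
          using W'D(6)[OF \<alpha>_I[OF zI] e_img[OF j], of j] g(2)[OF j] \<sigma>1'_\<alpha>[OF zI, of j]
          by (simp add: vec_apply cF1_def G'_def)
      qed
    qed
    then show ?thesis unfolding lcomb_sc \<iota>_lcomb .
  qed
  have \<iota>_Q: "\<iota> ` Q = wQ W'"
  proof (intro equalityI subsetI)
    fix y assume "y \<in> \<iota> ` Q"
    then obtain l t where lt: "l \<in> L" "t \<in> T" "\<And>i. t i \<in> I" "y = \<iota> (l + t)"
      unfolding Q_eq imult_iff[OF dbT S.ideal_I] by blast
    then have P: "l \<in> P" "t \<in> P" using sub by auto
    have "\<iota> t i \<in> I'" for i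
      by (rule lin_on_coords_in[OF db \<iota>_lin \<alpha>_hom P(2) S'.ideal_I \<alpha>_I[OF lt(3)]])
    moreover have "y = \<iota> l + \<iota> t" using lt(4) \<iota>D(1)[OF P] by simp
    ultimately show "y \<in> wQ W'" unfolding Q' using lt img by blast
  next
    fix y assume "y \<in> wQ W'"
    then obtain l' t' where lt': "l' \<in> L'" "t' \<in> T'" "\<And>i. t' i \<in> I'" "y = l' + t'" unfolding Q' by blast
    obtain l where l: "l \<in> L" "l' = \<iota> l" using lt'(1) img(2) by blast
    have "\<forall>j<n'. \<exists>w. w \<in> T \<and> \<iota> w = pT' (e' j)" using dbasisD(2)[OF dbT'] img(3) by (metis imageE)
    then obtain w where w: "\<And>j. j < n' \<Longrightarrow> w j \<in> T \<and> \<iota> (w j) = pT' (e' j)" by metis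
    \<comment> \<open>The coordinates of \<open>t'\<close> lift to elements of \<open>I\<close>,
      because \<open>I\<close> is the full preimage of \<open>I'\<close>. Used as coefficients of
      lifted generators of \<open>T'\<close>, they give a lift of \<open>t'\<close> in
      \<open>I T\<close>.\<close>
    define s where "s = (\<lambda>j. inv_into UNIV \<alpha> (t' j))"
    have s: "\<alpha> (s j) = t' j" for j unfolding s_def by (rule surj_f_inv_f[OF surj_\<alpha>])
    have sI: "s j \<in> I" for j by (rule I_if_\<alpha>) (simp add: s lt'(3))
    let ?t = "lcomb n' s w"
    have t: "?t \<in> T" by (rule submod_lcomb[OF LT(2)]) (use w in auto)
    have tI: "?t i \<in> I" for i by (rule lcomb_coords_in[OF S.ideal_I]) (rule sI)
    have "\<iota> ?t = lcomb n' (\<alpha> \<circ> s) (\<lambda>j. \<iota> (w j))" by (rule \<iota>D(6)) (use w sub in auto)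
    also have "\<dots> = lcomb n' t' (\<lambda>j. pT' (e' j))" by (rule lcomb_cong) (use w s in \<open>auto simp: o_apply\<close>)
    also have "\<dots> = t'" by (rule dbasisD(3)[OF dbT' lt'(2)])
    finally have "y = \<iota> (l + ?t)"
      using lt'(4) l(2) \<iota>D(1)[OF subsetD[OF sub(1) l(1)] subsetD[OF sub(2) t]] by simp
    moreover have "l + ?t \<in> Q" unfolding Q_eq imult_iff[OF dbT S.ideal_I] using l t tI by blast
    ultimately show "y \<in> \<iota> ` Q" by blast
  qed
  have gen: "mspan ((\<lambda>z. lcomb ?N (cF1 z) g) ` Q) = P" (is "mspan ?A = P")
  proof
    show AP: "mspan ?A \<subseteq> P" by (rule mspan_subset[OF _ dD(1)]) (use inP in auto)
    show "P \<subseteq> mspan ?A"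
    proof (rule nakayama_ker[OF db submod_mspan AP])
      fix x assume x: "x \<in> P"
      have "\<iota> x \<in> mspan (wF1 W' ` wQ W')" using W'D(7) img(1) x by blast
      then obtain k c v where v: "\<forall>i<k. v i \<in> wF1 W' ` wQ W'" "\<iota> x = lcomb k c v" unfolding mspan_iff by blast
      have "\<forall>i<k. \<exists>q. q \<in> Q \<and> v i = wF1 W' (\<iota> q)" using v(1) \<iota>_Q by (metis imageE)
      then obtain q where q: "\<And>i. i < k \<Longrightarrow> q i \<in> Q \<and> v i = wF1 W' (\<iota> (q i))" by metis
      \<comment> \<open>The coefficients absorb the \<open>u\<close> by which
        \<open>F\<^sub>1\<close> over \<open>S'\<close> differs from the image of
        \<open>F\<^sub>1\<close> over \<open>S\<close>.\<close>
      define d where "d = (\<lambda>i. inv_into UNIV \<alpha> (c i * u))"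
      have d: "\<alpha> (d i) = c i * u" for i unfolding d_def by (rule surj_f_inv_f[OF surj_\<alpha>])
      let ?f = "\<lambda>i. lcomb ?N (cF1 (q i)) g"
      let ?y = "lcomb k d ?f"
      have y: "?y \<in> mspan ?A"
        by (rule submod_lcomb[OF submod_mspan], rule subsetD[OF mspan_superset]) (use q in auto)
      have "\<iota> ?y = lcomb k (\<alpha> \<circ> d) (\<lambda>i. \<iota> (?f i))" by (rule \<iota>D(6)) (rule inP)
      also have "\<dots> = lcomb k c (\<lambda>i. sc u (\<iota> (?f i)))"
        by (auto simp: lcomb_def fun_eq_iff o_apply d sc_apply mult.assoc)
      also have "\<dots> = \<iota> x" unfolding v(2) by (rule lcomb_cong) (use q \<iota>_F1 in auto)
      finally have "\<iota> (x - ?y) = 0" using \<iota>D(5)[OF x subsetD[OF AP y]] by simp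
      then have "\<forall>i. \<alpha> ((x - ?y) i) = 0" using ker dD(7)[OF x subsetD[OF AP y]] by blast
      then show "\<exists>y\<in>mspan ?A. \<forall>i. \<alpha> ((x - y) i) = 0" using y by blast
    qed
  qed
  have "window I \<sigma> \<sigma>1 W"
    unfolding window_def W_simps
  proof (intro conjI ballI)
    show "fg_proj P" by (rule dbasis_imp_fg_proj[OF db])
    show "Q \<subseteq> P" by (auto simp: Q_def)
    show "lcomb ?N (cF z) g \<in> P" "lcomb ?N (cF1 z) g \<in> P" for z by (rule inP)+
    show "lin_on \<sigma> P (\<lambda>z. lcomb ?N (cF z) g)" by (simp add: lin_on_def cF_lin lcomb_add lcomb_sc)
    show "lin_on \<sigma> Q (\<lambda>z. lcomb ?N (cF1 z) g)" by (simp add: lin_on_def cF1_add cF1_sc)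
    show "\<exists>L T. submod L \<and> submod T \<and> dsum P L T \<and> Q = {l + t |l t. l \<in> L \<and> t \<in> imult I T}"
      using LT Q_eq by blast
    show "mspan ((\<lambda>z. lcomb ?N (cF1 z) g) ` Q) = P" by (rule gen)
    show "lcomb ?N (cF1 (sc s x)) g = sc (\<sigma>1 s) (lcomb ?N (cF x) g)" if s: "s \<in> I" and "x \<in> P" for s x
      unfolding lcomb_sc[symmetric]
    proof (rule lcomb_cong)
      fix j
      have "\<sigma> (s * x j) = \<sigma>1 s * (S.\<theta> * \<sigma> (x j))" using S.\<theta>[OF s] by (simp add: hom mult.commute mult.left_commute)
      moreover have "\<sigma>1 (s * x j) = \<sigma>1 s * \<sigma> (x j)" using S.\<sigma>1_mult[OF s, of "x j"] by (simp add: mult.commute)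
      ultimately show "cF1 (sc s x) j = sc (\<sigma>1 s) (cF x) j" by (simp add: cF1_def cF_def sc_apply)
    qed simp
  qed
  moreover have "reduction W W' \<iota>"
    unfolding reduction_def win_mor_def W_simps
    using W' \<iota>_lin img(1) \<iota>_Q \<iota>_F \<iota>_F1 ker by auto
  ultimately show ?thesis by blast
qed

end

theorem theorem10p3:
  fixes p :: nat
    and I :: "'a::comm_ring_1 set" and \<sigma> \<sigma>1 :: "'a \<Rightarrow> 'a"
    and I' :: "'b::comm_ring_1 set" and \<sigma>' \<sigma>1' :: "'b \<Rightarrow> 'b"
    and \<alpha> :: "'a \<Rightarrow> 'b" and u :: 'b
    and J :: "'a set"
  assumes F: "frame p I \<sigma> \<sigma>1"
    and F': "frame p I' \<sigma>' \<sigma>1'"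
    and hom: "frame_hom I \<sigma> \<sigma>1 I' \<sigma>' \<sigma>1' \<alpha> u"
    and R_inj: "\<forall>s. \<alpha> s \<in> I' \<longrightarrow> s \<in> I"
    and R_surj: "\<forall>s'. \<exists>s. \<alpha> s - s' \<in> I'"
    and S_surj: "surj \<alpha>"
    and filt: "\<exists>n (\<aa> :: nat \<Rightarrow> 'a set). \<aa> 0 = {s. \<alpha> s = 0} \<and> \<aa> n = {0} \<and>
                 (\<forall>i\<le>n. is_ideal (\<aa> i)) \<and> (\<forall>i<n. \<aa> (Suc i) \<subseteq> \<aa> i) \<and>
                 (\<forall>i<n. \<sigma> ` \<aa> i \<subseteq> \<aa> (Suc i)) \<and> (\<forall>i\<le>n. \<sigma>1 ` \<aa> i \<subseteq> \<aa> i)"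
    and lift: "\<forall>P' :: (nat \<Rightarrow> 'b) set. fg_proj P' \<longrightarrow>
                 (\<exists>P :: (nat \<Rightarrow> 'a) set. fg_proj P \<and>
                    (\<exists>f. lin_on id (bchg \<alpha> P) f \<and> bij_betw f (bchg \<alpha> P) P'))"
    and J: "ideal_of_def I \<sigma> \<sigma>1 J"
    and Jnil: "\<exists>m::nat. \<forall>js. (\<forall>i<m. js i \<in> J) \<longrightarrow>
                 (\<forall>a. \<alpha> a = 0 \<longrightarrow> (\<Prod>i<m. js i) * a = 0)"
  shows "nil_crystalline I \<sigma> \<sigma>1 J I' \<sigma>' \<sigma>1' (\<alpha> ` J) \<alpha> u"
proof -
  obtain m :: nat where m: "\<forall>js. (\<forall>i<m. js i \<in> J) \<longrightarrow> (\<forall>a. \<alpha> a = 0 \<longrightarrow> (\<Prod>i<m. js i) * a = 0)"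
    using Jnil by blast
  \<comment> \<open>The filtration starts at the kernel, so its stability under
    \<open>\<sigma>1\<close> at index 0 is stability of the kernel.\<close>
  have ker: "\<alpha> (\<sigma>1 a) = 0" if "\<alpha> a = 0" for a
    using filt that by (metis (mono_tags, lifting) image_subset_iff le0 mem_Collect_eq)
  interpret frame_lift p I \<sigma> \<sigma>1 I' \<sigma>' \<sigma>1' \<alpha> u J m
    by unfold_locales (use F F' hom R_inj S_surj ker J m in auto)
  show ?thesis
    unfolding nil_crystalline_def
  proof (intro conjI allI impI)
    show "ideal_of_def I \<sigma> \<sigma>1 J" "ideal_of_def I' \<sigma>' \<sigma>1' (\<alpha> ` J)" by (fact J, rule ideal_of_def_\<alpha>_J)
    show "\<alpha> ` J \<subseteq> \<alpha> ` J" by simp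
  next
    fix W assume "window I \<sigma> \<sigma>1 W \<and> nilpotent_win \<sigma> J W"
    then show "\<exists>W' \<iota>. is_base_change I' \<sigma>' \<sigma>1' \<alpha> u W W' \<iota>"
      using reduction_exists reduction_base_change by blast
  next
    fix W W' \<iota>
    assume "window I \<sigma> \<sigma>1 W \<and> nilpotent_win \<sigma> J W \<and> is_base_change I' \<sigma>' \<sigma>1' \<alpha> u W W' \<iota>"
    then show "nilpotent_win \<sigma>' (\<alpha> ` J) W'"
      using base_change_reduction nilpotent_reduction_iff by blast
  next
    fix W1 W2 W1' W2' \<iota>1 \<iota>2 h
    assume *: "window I \<sigma> \<sigma>1 W1 \<and> nilpotent_win \<sigma> J W1 \<and> window I \<sigma> \<sigma>1 W2 \<and> nilpotent_win \<sigma> J W2 \<and>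
        is_base_change I' \<sigma>' \<sigma>1' \<alpha> u W1 W1' \<iota>1 \<and> is_base_change I' \<sigma>' \<sigma>1' \<alpha> u W2 W2' \<iota>2"
      and h: "win_mor id 1 W1' W2' h"
    show "\<exists>f. win_mor id 1 W1 W2 f \<and> (\<forall>x\<in>wP W1. h (\<iota>1 x) = \<iota>2 (f x)) \<and>
        (\<forall>f'. win_mor id 1 W1 W2 f' \<and> (\<forall>x\<in>wP W1. h (\<iota>1 x) = \<iota>2 (f' x)) \<longrightarrow> (\<forall>x\<in>wP W1. f' x = f x))"
      by (rule fully_faithful[OF _ _ _ _ _ h]) (use * base_change_reduction in auto)
  next
    fix W' assume W': "window I' \<sigma>' \<sigma>1' W' \<and> nilpotent_win \<sigma>' (\<alpha> ` J) W'"
    then obtain W \<iota> where "window I \<sigma> \<sigma>1 W" "reduction W W' \<iota>" using essentially_surjective[OF lift] by blast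
    then show "\<exists>W \<iota>. window I \<sigma> \<sigma>1 W \<and> nilpotent_win \<sigma> J W \<and> is_base_change I' \<sigma>' \<sigma>1' \<alpha> u W W' \<iota>"
      using nilpotent_reduction_iff reduction_base_change W' by blast
  qed
qed

end
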